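(* Let $X$ be an infinite-dimensional Banach space with a basis $\{u_i\}$, and let the asymptotic structure of $X$ be taken with respect to a family $\mathcal{B}(X)$ which is either $\mathcal{B}^0(X)$ (all finite-codimensional subspaces) or $\mathcal{B}^t(X)$ (all tail subspaces $\overline{\mathrm{span}}\{u_i\}_{i>m}$, $m\in\mathbb{N}$). Assume that there exists a constant $C$ such that permissible subspaces of $X$ far enough are $C$-complemented by means of permissible projections. Then $X$ is an asymptotic-$\ell_p$ space for some $1\le p\le\infty$, with respect to the same family $\mathcal{B}(X)$; that is, there are $1\le p\le\infty$ and a constant $C'$ such that $d_b(E,\ell_p^n)\le C'$ for every $n\in\mathbb{N}$ and every $E\in\{X\}_n$.
   Context: $S(Z)$ denotes the unit sphere of a normed space $Z$. $\mathcal{M}_n$ is the space of all $n$-dimensional Banach spaces with a (distinguished, ordered) normalized basis whose basis constant is at most $2$. For $E,F\in\mathcal{M}_n$ with bases $\{e_i\},\{f_i\}$, put $d_b(E,F)=\|I:E\to F\|\,\|I^{-1}:F\to E\|$, where $Ie_i=f_i$; $\ell_p^n$ carries its standard unit vector basis. Two finite sequences $\{x_i\}_{i=1}^n,\{e_i\}_{i=1}^n$ are $(1+\varepsilon)$-equivalent if $\|J\|\,\|J^{-1}\|\le 1+\varepsilon$, where $J$ is the linear map $x_i\mapsto e_i$ between their spans. Standing assumption on $\mathcal{B}(X)$ (automatic for $\mathcal{B}^0(X)$): for every finite-dimensional subspace $F\subset X$ and every $\delta>0$ there is $Z\in\mathcal{B}(X)$ with $\|f\|\le(1+\delta)\|f+z\|$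 for all $f\in F$, $z\in Z$; so the subspace player below can always ensure that the chosen vectors have basis constant less than $1+\delta$. Asymptotic game: there are two players, $\mathbf{S}$ and $\mathbf{V}$. In the $k$th move $\mathbf{S}$ chooses $X_k\in\mathcal{B}(X)$, and then $\mathbf{V}$ chooses $x_k\in S(X_k)$ such that $x_1,\dots,x_k$ is a basic sequence with basis constant at most $2$ (if $\mathbf{V}$ has no admissible choice, $\mathbf{V}$ loses). In the vector game for $E\in\mathcal{M}_n$ with basis $\{e_i\}$ and $\varepsilon>0$, $\mathbf{V}$ wins if after $n$ moves $\{x_i\}_{i=1}^n$ is $(1+\varepsilon)$-equivalent to $\{e_i\}_{i=1}^n$. $E$ is an asymptotic space for $X$ if $\mathbf{V}$ has a winning strategy in this game for every $\varepsilon>0$; $\{X\}_n\subset\mathcal{M}_n$ is the set of all $n$-dimensional asymptotic spaces. In the subspace game for $\mathcal{F}\subset\mathcal{M}_n$ and $\varepsilon>0$, $\mathbf{S}$ wins if after $n$ moves $\{x_i\}_{i=1}^n$ is $(1+\varepsilon)$-equivalent to the basis of some space in $\mathcal{F}$. "Permissible subspaces of $X$ far enough satisfy a property $\mathcal{P}$" means: for every $n\in\mathbb{N}$ and $\varepsilon>0$, $\mathbf{S}$ has a winning strategy in the subspace game for $\{X\}_n$ and $\varepsilon$ such that every $n$-tuple $\{x_i\}_{i=1}^n$ resulting from a game in which $\mathbf{S}$ follows this strategy spans a subspace with property $\mathcal{P}$. Permissible projection: let $\{u_i^*\}\subset X^*$ be biorthogonal to $\{u_i\}$; a functional is finitely supported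 if it lies in $\mathrm{span}\{u_i^*\}$, and its support is the set of indices $j$ with nonzero coefficient at $u_j^*$. A projection $P$ of $X$ onto $Y=\mathrm{span}[y_i]$ is ($\{u_i\}$-)permissible if $P=\sum_i g_i\otimes y_i$ (i.e. $Px=\sum_i g_i(x)y_i$) with $g_i\in X^*$ finitely supported and $\max\mathrm{supp}(g_i)<\min\mathrm{supp}(g_{i+1})$ for all $i$. The property in the hypothesis is: the span of the resulting $n$-tuple $\{x_i\}$ is the range of a permissible projection $P=\sum_i g_i\otimes x_i$ with $\|P\|\le C$. *)

theory Defs
  imports "HOL-Analysis.Analysis"
begin

text \<open>
  Sequences are indexed from \<open>0\<close>.  An \<open>n\<close>-dimensional space with a distinguished ordered basis
  \<open>e\<^sub>0, \<dots>, e\<^sub>n\<^sub>-\<^sub>1\<close> is represented, up to isometry carrying basis to basis, by the norm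
  \<open>N a = \<parallel>\<Sum>i<n. a\<^sub>i e\<^sub>i\<parallel>\<close> of its coefficient sequences.  Coefficients are functions on all of \<open>nat\<close>;
  by the definiteness clause below, \<open>N a\<close> depends only on the first \<open>n\<close> of them.
\<close>

type_synonym cnorm = "(nat \<Rightarrow> real) \<Rightarrow> real"

definition is_cnorm :: "nat \<Rightarrow> cnorm \<Rightarrow> bool" where
  "is_cnorm n N \<longleftrightarrow>
     (\<forall>a. 0 \<le> N a) \<and>
     (\<forall>a. N a = 0 \<longleftrightarrow> (\<forall>i<n. a i = 0)) \<and>
     (\<forall>c a. N (\<lambda>i. c * a i) = \<bar>c\<bar> * N a) \<and>
     (\<forall>a b. N (\<lambda>i. a i + b i) \<le> N a + N b)"

text \<open>
  Operator norm of the formal identity \<open>e\<^sub>i \<mapsto> f\<^sub>i\<close> between the spaces with coefficient norms \<open>N\<close> and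
  \<open>M\<close>, with the same convention \<open>0 / 0 = 0\<close> as in \<^const>\<open>onorm\<close>.  The supremum is finite whenever
  \<open>N\<close> and \<open>M\<close> are both norms on the same finite-dimensional coefficient space.
\<close>

definition cnorm_onorm :: "cnorm \<Rightarrow> cnorm \<Rightarrow> real" where
  "cnorm_onorm N M = (SUP a. M a / N a)"

definition d_b :: "cnorm \<Rightarrow> cnorm \<Rightarrow> real" where
  "d_b N M = cnorm_onorm N M * cnorm_onorm M N"

definition basis_constant :: "nat \<Rightarrow> cnorm \<Rightarrow> real" where
  "basis_constant n N =
     (SUP m\<in>{..n}. cnorm_onorm N (\<lambda>a. N (\<lambda>i. if i < m then a i else 0)))"

definition M_space :: "nat \<Rightarrow> cnorm set" where
  "M_space n = {N. is_cnorm n N \<and>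
     (\<forall>i<n. N (\<lambda>j. if j = i then 1 else 0) = 1) \<and>
     basis_constant n N \<le> 2}"

definition lp_cnorm :: "ereal \<Rightarrow> nat \<Rightarrow> cnorm" where
  "lp_cnorm p n a =
     (if p = \<infinity> then Max ((\<lambda>i. \<bar>a i\<bar>) ` {..<n})
      else (\<Sum>i<n. \<bar>a i\<bar> powr real_of_ereal p) powr (1 / real_of_ereal p))"

definition seq_cnorm :: "nat \<Rightarrow> (nat \<Rightarrow> 'a::real_normed_vector) \<Rightarrow> cnorm" where
  "seq_cnorm n x a = norm (\<Sum>i<n. a i *\<^sub>R x i)"

definition basic_seq_le :: "real \<Rightarrow> nat \<Rightarrow> (nat \<Rightarrow> 'a::real_normed_vector) \<Rightarrow> bool" where
  "basic_seq_le K n x \<longleftrightarrow>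
     inj_on x {..<n} \<and> independent (x ` {..<n}) \<and> basis_constant n (seq_cnorm n x) \<le> K"

definition equivalent_to_basis ::
    "real \<Rightarrow> nat \<Rightarrow> (nat \<Rightarrow> 'a::real_normed_vector) \<Rightarrow> cnorm \<Rightarrow> bool" where
  "equivalent_to_basis K n x E \<longleftrightarrow> d_b (seq_cnorm n x) E \<le> K"

definition schauder_basis :: "(nat \<Rightarrow> 'a::real_normed_vector) \<Rightarrow> bool" where
  "schauder_basis u \<longleftrightarrow> (\<forall>x. \<exists>!a. (\<lambda>i. a i *\<^sub>R u i) sums x)"

definition finite_codim_subspaces :: "'a::real_normed_vector set set" where
  "finite_codim_subspaces =
     {Z. subspace Z \<and> closed Z \<and> (\<exists>F. finite F \<and> span (Z \<union> F) = UNIV)}"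

definition tail_subspaces :: "(nat \<Rightarrow> 'a::real_normed_vector) \<Rightarrow> 'a set set" where
  "tail_subspaces u = {closure (span (u ` {m..})) | m. True}"

definition almost_monotone_family :: "'a::real_normed_vector set set \<Rightarrow> bool" where
  "almost_monotone_family B \<longleftrightarrow>
     (\<forall>S \<delta>. finite S \<longrightarrow> 0 < \<delta> \<longrightarrow>
        (\<exists>Z\<in>B. \<forall>f\<in>span S. \<forall>z\<in>Z. norm f \<le> (1 + \<delta>) * norm (f + z)))"

text \<open>Admissibility of the vector \<open>x k\<close> as V's answer to the subspace \<open>Z\<close>, after \<open>x 0, \<dots>, x (k-1)\<close>.\<close>

definition admissible_move ::
    "'a::real_normed_vector set \<Rightarrow> (nat \<Rightarrow> 'a) \<Rightarrow> nat \<Rightarrow> bool" where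
  "admissible_move Z x k \<longleftrightarrow> x k \<in> Z \<inter> sphere 0 1 \<and> basic_seq_le 2 (Suc k) x"

text \<open>
  A strategy for V maps the list of subspaces played by S so far (including the current one) to a
  vector; V's own earlier moves are determined by the strategy.  As V loses when unable to move, a
  winning strategy always provides an admissible answer.
\<close>

definition V_winning_strategy ::
    "'a::real_normed_vector set set \<Rightarrow> nat \<Rightarrow> cnorm \<Rightarrow> real \<Rightarrow> ('a set list \<Rightarrow> 'a) \<Rightarrow> bool" where
  "V_winning_strategy B n E \<epsilon> \<tau> \<longleftrightarrow>
     (\<forall>Z. (\<forall>k<n. Z k \<in> B) \<longrightarrow>
        (let x = (\<lambda>k. \<tau> (map Z [0..<Suc k])) in
           (\<forall>k<n. admissible_move (Z k) x k) \<and> equivalent_to_basis (1 + \<epsilon>) n x E))"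

definition asymptotic_spaces :: "'a::real_normed_vector set set \<Rightarrow> nat \<Rightarrow> cnorm set" where
  "asymptotic_spaces B n = {E \<in> M_space n. \<forall>\<epsilon>>0. \<exists>\<tau>. V_winning_strategy B n E \<epsilon> \<tau>}"

text \<open>
  A strategy for S maps the list of vectors played by V so far to the next subspace.  A game that
  stops early because V has no admissible move is won by S and yields no \<open>n\<close>-tuple, so only complete
  games need to be considered.
\<close>

definition S_outcome ::
    "nat \<Rightarrow> ('a::real_normed_vector list \<Rightarrow> 'a set) \<Rightarrow> (nat \<Rightarrow> 'a) \<Rightarrow> bool" where
  "S_outcome n \<sigma> x \<longleftrightarrow> (\<forall>k<n. admissible_move (\<sigma> (map x [0..<k])) x k)"

definition S_winning_strategy ::
    "'a::real_normed_vector set set \<Rightarrow> nat \<Rightarrow> cnorm set \<Rightarrow> real \<Rightarrow> ('a list \<Rightarrow> 'a set) \<Rightarrow> bool" where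
  "S_winning_strategy B n \<F> \<epsilon> \<sigma> \<longleftrightarrow>
     (\<forall>xs. \<sigma> xs \<in> B) \<and>
     (\<forall>x. S_outcome n \<sigma> x \<longrightarrow> (\<exists>E\<in>\<F>. equivalent_to_basis (1 + \<epsilon>) n x E))"

definition permissible_far_enough ::
    "'a::real_normed_vector set set \<Rightarrow> (nat \<Rightarrow> (nat \<Rightarrow> 'a) \<Rightarrow> bool) \<Rightarrow> bool" where
  "permissible_far_enough B P \<longleftrightarrow>
     (\<forall>n\<ge>1. \<forall>\<epsilon>>0. \<exists>\<sigma>. S_winning_strategy B n (asymptotic_spaces B n) \<epsilon> \<sigma> \<and>
        (\<forall>x. S_outcome n \<sigma> x \<longrightarrow> P n x))"

definition biorthogonal ::
    "(nat \<Rightarrow> 'a::real_normed_vector) \<Rightarrow> (nat \<Rightarrow> 'a \<Rightarrow>\<^sub>L real) \<Rightarrow> bool" where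
  "biorthogonal u us \<longleftrightarrow> (\<forall>i j. blinfun_apply (us i) (u j) = (if i = j then 1 else 0))"

definition functional_supp ::
    "(nat \<Rightarrow> 'a::real_normed_vector \<Rightarrow>\<^sub>L real) \<Rightarrow> ('a \<Rightarrow>\<^sub>L real) \<Rightarrow> nat set" where
  "functional_supp us g = {j. representation (range us) g (us j) \<noteq> 0}"

text \<open>
  The functionals \<open>g i\<close> of a permissible projection onto the span of linearly independent vectors
  are nonzero, so \<open>Max\<close> and \<open>Min\<close> below are taken over nonempty finite sets.
\<close>

definition permissible_projection ::
    "(nat \<Rightarrow> 'a::real_normed_vector \<Rightarrow>\<^sub>L real) \<Rightarrow> nat \<Rightarrow> (nat \<Rightarrow> 'a) \<Rightarrow>
     (nat \<Rightarrow> 'a \<Rightarrow>\<^sub>L real) \<Rightarrow> ('a \<Rightarrow>\<^sub>L 'a) \<Rightarrow> bool" where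
  "permissible_projection us n y g P \<longleftrightarrow>
     P o\<^sub>L P = P \<and>
     range (blinfun_apply P) = span (y ` {..<n}) \<and>
     (\<forall>v. blinfun_apply P v = (\<Sum>i<n. blinfun_apply (g i) v *\<^sub>R y i)) \<and>
     (\<forall>i<n. g i \<in> span (range us)) \<and>
     (\<forall>i. Suc i < n \<longrightarrow> Max (functional_supp us (g i)) < Min (functional_supp us (g (Suc i))))"

definition permissibly_complemented ::
    "(nat \<Rightarrow> 'a::real_normed_vector \<Rightarrow>\<^sub>L real) \<Rightarrow> real \<Rightarrow> nat \<Rightarrow> (nat \<Rightarrow> 'a) \<Rightarrow> bool" where
  "permissibly_complemented us C n x \<longleftrightarrow>
     (\<exists>g P. permissible_projection us n x g P \<and> norm P \<le> C)"

definition asymptotic_lp :: "'a::real_normed_vector set set \<Rightarrow> ereal \<Rightarrow> bool" where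
  "asymptotic_lp B p \<longleftrightarrow>
     (\<exists>C'. \<forall>n\<ge>1. \<forall>E\<in>asymptotic_spaces B n. d_b E (lp_cnorm p n) \<le> C')"

end

theory Submission
  imports Defs "HOL-Library.Ramsey"
begin

text \<open>
  The heart of the matter is that any two asymptotic spaces \<open>E\<close>, \<open>F\<close> of the same dimension are
  equivalent with a constant that depends only on \<open>C\<close>.  Once this is known, \<open>\<ell>\<^sub>p\<close> appears as in
  Zippin's theorem on perfectly homogeneous bases.

  To compare \<open>E\<close> and \<open>F\<close>, the vector player produces, in one long game, a copy \<open>u\<^sub>j\<close> of \<open>E\<close> and a copy
  \<open>w\<^sub>j\<close> of \<open>F\<close>, with many further unit vectors in between.  By Ramsey's theorem, these further vectors
  contain differences \<open>v\<^sub>j\<close>, of norm between \<open>1/4\<close> and \<open>2\<close>, such that any set of them can be dropped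
  from a linear combination of all the \<open>u\<^sub>j\<close>, \<open>w\<^sub>j\<close>, \<open>v\<^sub>j\<close> at the cost of a factor \<open>2\<close>
  (\<open>suppressing_differences\<close>): if the norm does not notice which two members of a long family are
  subtracted, then averaging over consecutive pairs makes the differences telescope.  In particular
  the sequence \<open>v\<close> is unconditional.

  Now consider the subspace spanned by \<open>x\<^sub>j = v\<^sub>j + \<lambda> u\<^sub>j\<close>, with dummy differences between consecutive
  \<open>x\<^sub>j\<close>, and a permissible projection \<open>P = \<Sum> g\<^sub>j \<otimes> x\<^sub>j\<close> onto it.  The supports of the \<open>g\<^sub>j\<close> are successive
  and each meets the region where its own vector lives, so \<open>g\<^sub>j\<close> nearly vanishes on everything that is
  not adjacent to that region; the dummies absorb the adjacent terms.  Hence \<open>P v\<^sub>j\<close> is \<open>a\<^sub>j x\<^sub>j\<close> up to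
  dummies and a small error, where \<open>a\<^sub>j = 1 - \<lambda> g\<^sub>j(u\<^sub>j)\<close> lies in \<open>[1/2, 3/2]\<close> if \<open>\<lambda>\<close> is a small multiple of
  \<open>1/C\<close> (\<open>twisted_projection\<close>).  Applying \<open>P\<close> to \<open>\<Sum> (c\<^sub>j / a\<^sub>j) v\<^sub>j\<close> and dropping all differences from the
  result bounds \<open>\<lambda> \<parallel>\<Sum> c\<^sub>j u\<^sub>j\<parallel>\<close>; as \<open>v\<close> is unconditional, \<open>v\<close> dominates \<open>u\<close>.  With \<open>x\<^sub>j = w\<^sub>j + \<lambda> v\<^sub>j\<close>
  instead, one applies \<open>P\<close> to \<open>\<Sum> c\<^sub>j w\<^sub>j\<close>, obtaining a bound for \<open>\<Sum> c\<^sub>j a\<^sub>j (w\<^sub>j + \<lambda> v\<^sub>j)\<close> with and without the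
  \<open>v\<^sub>j\<close>, hence for \<open>\<lambda> \<Sum> c\<^sub>j a\<^sub>j v\<^sub>j\<close>; so \<open>w\<close> dominates \<open>v\<close>.  Together, \<open>w\<close> dominates \<open>u\<close>
  (\<open>comparison\<close>), and the roles of \<open>E\<close> and \<open>F\<close> can be exchanged.

  The comparison applies to every pattern that the vector player can force, in particular to
  normalized blocks of a copy of an asymptotic space.  Changing signs shows that asymptotic spaces
  are uniformly lattice-like; sums of ones over equal blocks show that \<open>\<phi>(n) = \<parallel>e\<^sub>0 + \<dots> + e\<^sub>n\<^sub>-\<^sub>1\<parallel>\<close>
  satisfies \<open>\<phi>(2\<^sup>k\<^sup>+\<^sup>l) \<approx> \<phi>(2\<^sup>k) \<phi>(2\<^sup>l)\<close>, so that \<open>\<phi>(n) \<approx> n\<^sup>\<theta>\<close> for some \<open>0 \<le> \<theta> \<le> 1\<close>; and \<open>\<theta> = 1/p\<close>.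
  Replacing the \<open>i\<close>-th coefficient \<open>a\<^sub>i\<close> by a block of about \<open>T \<bar>a\<^sub>i\<bar>\<^sup>p\<close> ones, for large \<open>T\<close>, then gives
  \<open>\<parallel>\<Sum> a\<^sub>i e\<^sub>i\<parallel> \<approx> (\<Sum> \<bar>a\<^sub>i\<bar>\<^sup>p)\<^sup>1\<^sup>/\<^sup>p\<close>.
\<close>

section \<open>Norms on coefficient sequences\<close>

definition unit_coeff :: "nat \<Rightarrow> nat \<Rightarrow> real" where
  "unit_coeff i = (\<lambda>j. if j = i then 1 else 0)"

lemma cnorm_nonneg: "is_cnorm n N \<Longrightarrow> 0 \<le> N a"
  and cnorm_eq_0_iff: "is_cnorm n N \<Longrightarrow> N a = 0 \<longleftrightarrow> (\<forall>i<n. a i = 0)"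
  and cnorm_scale: "is_cnorm n N \<Longrightarrow> N (\<lambda>i. c * a i) = \<bar>c\<bar> * N a"
  and cnorm_triangle: "is_cnorm n N \<Longrightarrow> N (\<lambda>i. a i + b i) \<le> N a + N b"
  unfolding is_cnorm_def by blast+

lemma cnorm_diff:
  assumes "is_cnorm n N"
  shows "N a \<le> N b + N (\<lambda>i. a i - b i)"
  using cnorm_triangle[OF assms, of b "\<lambda>i. a i - b i"] by simp

lemma cnorm_minus:
  assumes "is_cnorm n N"
  shows "N (\<lambda>i. - a i) = N a"
  using cnorm_scale[OF assms, of "-1" a] by simp

lemma cnorm_cong:
  assumes N: "is_cnorm n N" and ab: "\<And>i. i < n \<Longrightarrow> a i = b i"
  shows "N a = N b"
proof -
  have "N (\<lambda>i. a i - b i) = 0" "N (\<lambda>i. b i - a i) = 0"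
    using ab by (auto simp: cnorm_eq_0_iff[OF N])
  then show ?thesis
    using cnorm_diff[OF N, of a b] cnorm_diff[OF N, of b a] by linarith
qed

lemma cnorm_sum_le:
  assumes N: "is_cnorm n N" and "finite S"
  shows "N (\<lambda>i. \<Sum>s\<in>S. g s i) \<le> (\<Sum>s\<in>S. N (g s))"
  using assms(2)
proof (induction S rule: finite_induct)
  case empty
  then show ?case using cnorm_eq_0_iff[OF N, of "\<lambda>_. 0"] by simp
next
  case (insert s S)
  then show ?case
    using cnorm_triangle[OF N, of "g s" "\<lambda>i. \<Sum>s\<in>S. g s i"] by simp
qed

lemma cnorm_le_sum_coeffs:
  assumes N: "is_cnorm n N"
  shows "N a \<le> (\<Sum>i<n. \<bar>a i\<bar> * N (unit_coeff i))"
proof -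
  have "N a = N (\<lambda>j. \<Sum>i<n. a i * unit_coeff i j)"
    by (rule cnorm_cong[OF N]) (simp add: unit_coeff_def if_distrib cong: if_cong)
  also have "\<dots> \<le> (\<Sum>i<n. N (\<lambda>j. a i * unit_coeff i j))"
    by (rule cnorm_sum_le[OF N]) simp
  finally show ?thesis by (simp add: cnorm_scale[OF N])
qed

text \<open>
  Induction on the dimension replaces compactness of the unit sphere.  In the step, the distance
  from the last unit vector to the span of the others is positive: otherwise a minimizing sequence
  would, by the induction hypothesis, be Cauchy in every coordinate, and the norm would vanish at
  its limit.
\<close>

lemma cnorm_controls_coeffs:
  assumes "is_cnorm n N"
  obtains \<delta> where "0 < \<delta>" "\<And>a i. i < n \<Longrightarrow> \<delta> * \<bar>a i\<bar> \<le> N a"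
proof -
  have "\<exists>\<delta>>0. \<forall>a. \<forall>i<n. \<delta> * \<bar>a i\<bar> \<le> N a"
    using assms
  proof (induction n arbitrary: N)
    case 0
    then show ?case by (auto intro: exI[of _ 1])
  next
    case (Suc n)
    note N = Suc.prems
    define N' where "N' a = N (\<lambda>i. if i < n then a i else 0)" for a
    have "is_cnorm n N'"
      unfolding is_cnorm_def
    proof (intro conjI allI)
      fix a b :: "nat \<Rightarrow> real" and c
      show "0 \<le> N' a" by (simp add: N'_def cnorm_nonneg[OF N])
      show "N' a = 0 \<longleftrightarrow> (\<forall>i<n. a i = 0)" by (auto simp: N'_def cnorm_eq_0_iff[OF N])
      have "(\<lambda>i. if i < n then c * a i else 0) = (\<lambda>i. c * (if i < n then a i else 0))" by auto
      then show "N' (\<lambda>i. c * a i) = \<bar>c\<bar> * N' a" by (simp add: N'_def cnorm_scale[OF N])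
      have "(\<lambda>i. if i < n then a i + b i else 0) =
        (\<lambda>i. (if i < n then a i else 0) + (if i < n then b i else 0))" by auto
      then show "N' (\<lambda>i. a i + b i) \<le> N' a + N' b" by (simp add: N'_def cnorm_triangle[OF N])
    qed
    from Suc.IH[OF this] obtain \<delta> where \<delta>: "\<delta> > 0" "\<And>a i. i < n \<Longrightarrow> \<delta> * \<bar>a i\<bar> \<le> N' a" by blast
    have d1: "\<exists>d>0. \<forall>a. d \<le> N (a(n := 1))"
    proof (rule ccontr)
      assume "\<not> ?thesis"
      then have "\<forall>k::nat. \<exists>a. N (a(n := 1)) < 1 / real (Suc k)"
        by (metis not_le of_nat_0_less_iff zero_less_Suc zero_less_divide_1_iff)
      then obtain a where a: "\<And>k. N ((a k)(n := 1)) < 1 / real (Suc k)" by metis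
      have diff: "\<delta> * \<bar>a k i - a l i\<bar> \<le> 1 / real (Suc k) + 1 / real (Suc l)" if "i < n" for k l i
      proof -
        have "\<delta> * \<bar>a k i - a l i\<bar> \<le> N' (\<lambda>i. a k i - a l i)" using \<delta>(2)[OF that] .
        also have "\<dots> = N (\<lambda>i. ((a k)(n := 1)) i + - ((a l)(n := 1)) i)"
          unfolding N'_def by (rule cnorm_cong[OF N]) auto
        also have "\<dots> \<le> N ((a k)(n := 1)) + N (\<lambda>i. - ((a l)(n := 1)) i)"
          using cnorm_triangle[OF N] .
        also have "\<dots> \<le> 1 / real (Suc k) + 1 / real (Suc l)"
          unfolding cnorm_minus[OF N] using a[of k] a[of l] by linarith
        finally show ?thesis .
      qed
      have "Cauchy (\<lambda>k. a k i)" if i: "i < n" for i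
      proof (rule metric_CauchyI)
        fix e :: real assume "e > 0"
        then obtain M :: nat where M: "M > 0" "1 / real M < \<delta> * e / 2"
          using \<delta>(1) by (metis half_gt_zero mult_pos_pos nat_approx_posE zero_less_Suc)
        have "dist (a k i) (a l i) < e" if "k \<ge> M" "l \<ge> M" for k l
        proof -
          have "1 / real (Suc k) \<le> 1 / real M" "1 / real (Suc l) \<le> 1 / real M"
            using that M(1) by (auto simp: field_simps)
          then have "\<delta> * \<bar>a k i - a l i\<bar> < \<delta> * e" using diff[OF i, of k l] M(2) by linarith
          then show ?thesis using \<delta>(1) by (simp add: dist_real_def)
        qed
        then show "\<exists>M. \<forall>k\<ge>M. \<forall>l\<ge>M. dist (a k i) (a l i) < e" by blast
      qed
      then have "\<forall>i. \<exists>b. i < n \<longrightarrow> (\<lambda>k. a k i) \<longlonglongrightarrow> b"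
        by (meson Cauchy_convergent convergent_def)
      then obtain b where b: "\<And>i. i < n \<Longrightarrow> (\<lambda>k. a k i) \<longlonglongrightarrow> b i" by metis
      have le: "N (b(n := 1)) \<le> 1 / real (Suc k) + (\<Sum>i<n. \<bar>b i - a k i\<bar> * N (unit_coeff i))" for k
      proof -
        have "N (b(n := 1)) \<le> N ((a k)(n := 1)) + N (\<lambda>i. (b(n := 1)) i - ((a k)(n := 1)) i)"
          by (rule cnorm_diff[OF N])
        also have "N (\<lambda>i. (b(n := 1)) i - ((a k)(n := 1)) i) \<le> (\<Sum>i<n. \<bar>b i - a k i\<bar> * N (unit_coeff i))"
          using cnorm_le_sum_coeffs[OF N, of "\<lambda>i. (b(n := 1)) i - ((a k)(n := 1)) i"] by simp
        finally show ?thesis using a[of k] by linarith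
      qed
      have "(\<lambda>k. 1 / real (Suc k) + (\<Sum>i<n. \<bar>b i - a k i\<bar> * N (unit_coeff i)))
          \<longlonglongrightarrow> 0 + (\<Sum>i<n. \<bar>b i - b i\<bar> * N (unit_coeff i))"
        by (intro tendsto_intros LIMSEQ_Suc[OF lim_1_over_n] b) auto
      then have "N (b(n := 1)) \<le> 0"
        using le by (intro LIMSEQ_le_const[where X="\<lambda>k. 1 / real (Suc k) + (\<Sum>i<n. \<bar>b i - a k i\<bar> * N (unit_coeff i))"]) auto
      then have "N (b(n := 1)) = 0" using cnorm_nonneg[OF N, of "b(n := 1)"] by linarith
      then show False using cnorm_eq_0_iff[OF N] by auto
    qed
    then obtain d where d: "d > 0" "\<And>a. d \<le> N (a(n := 1))" by blast
    have last: "d * \<bar>a n\<bar> \<le> N a" for a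
    proof (cases "a n = 0")
      case True
      then show ?thesis using cnorm_nonneg[OF N] by simp
    next
      case False
      have "d * \<bar>a n\<bar> \<le> N ((\<lambda>i. a i / a n)(n := 1)) * \<bar>a n\<bar>"
        by (intro mult_right_mono d) auto
      also have "\<dots> = N (\<lambda>i. a n * ((\<lambda>i. a i / a n)(n := 1)) i)"
        using cnorm_scale[OF N, of "a n" "(\<lambda>i. a i / a n)(n := 1)"] by (simp only: mult.commute)
      also have "\<dots> = N a" by (rule cnorm_cong[OF N]) (use False in auto)
      finally show ?thesis .
    qed
    define u where "u = N (unit_coeff n)"
    have u0: "u \<ge> 0" by (simp add: u_def cnorm_nonneg[OF N])
    have rest: "\<delta> * \<bar>a i\<bar> \<le> (1 + u / d) * N a" if "i < n" for a i
    proof -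
      have "\<delta> * \<bar>a i\<bar> \<le> N' a" using \<delta>(2)[OF that] .
      also have "N' a = N (\<lambda>i. a i + (- a n) * unit_coeff n i)"
        unfolding N'_def by (rule cnorm_cong[OF N]) (auto simp: unit_coeff_def less_Suc_eq)
      also have "\<dots> \<le> N a + \<bar>a n\<bar> * u"
        using cnorm_triangle[OF N, of a "\<lambda>i. (- a n) * unit_coeff n i"] cnorm_scale[OF N, of "- a n" "unit_coeff n"]
        by (simp add: u_def)
      also have "\<bar>a n\<bar> * u \<le> (N a / d) * u"
        using last[of a] d(1) u0 by (intro mult_right_mono) (auto simp: field_simps)
      finally show ?thesis by (simp add: algebra_simps)
    qed
    define \<epsilon> where "\<epsilon> = min d (\<delta> / (1 + u / d))"
    have p: "1 + u / d > 0" using u0 d(1) by (simp add: add_pos_nonneg)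
    have "\<epsilon> * \<bar>a i\<bar> \<le> N a" if "i < Suc n" for a i
    proof (cases "i = n")
      case True
      have "\<epsilon> * \<bar>a n\<bar> \<le> d * \<bar>a n\<bar>" by (intro mult_right_mono) (auto simp: \<epsilon>_def)
      then show ?thesis using last[of a] True by simp
    next
      case False
      have "\<epsilon> * \<bar>a i\<bar> \<le> \<delta> / (1 + u / d) * \<bar>a i\<bar>" by (intro mult_right_mono) (auto simp: \<epsilon>_def)
      also have "\<dots> \<le> N a" using rest[of i a] False that p by (simp add: pos_divide_le_eq mult.commute)
      finally show ?thesis .
    qed
    moreover have "\<epsilon> > 0" using d(1) \<delta>(1) p by (simp add: \<epsilon>_def)
    ultimately show ?case by blast
  qed
  then show thesis using that by blast
qed

lemma cnorm_onorm_bound: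
  assumes N: "is_cnorm n N" and M: "is_cnorm n M"
  shows "M a \<le> cnorm_onorm N M * N a" and "0 \<le> cnorm_onorm N M"
proof -
  obtain \<delta> where \<delta>: "0 < \<delta>" "\<And>a i. i < n \<Longrightarrow> \<delta> * \<bar>a i\<bar> \<le> N a"
    using cnorm_controls_coeffs[OF N] by blast
  define B where "B = (\<Sum>i<n. M (unit_coeff i)) / \<delta>"
  have MB: "M a \<le> B * N a" for a
  proof -
    have "M a \<le> (\<Sum>i<n. \<bar>a i\<bar> * M (unit_coeff i))" by (rule cnorm_le_sum_coeffs[OF M])
    also have "\<dots> \<le> (\<Sum>i<n. (N a / \<delta>) * M (unit_coeff i))"
      using \<delta> by (intro sum_mono mult_right_mono cnorm_nonneg[OF M]) (auto simp: field_simps)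
    finally show ?thesis by (simp add: B_def sum_distrib_left mult.commute sum_divide_distrib)
  qed
  have B0: "B \<ge> 0" unfolding B_def using \<delta>(1) by (intro divide_nonneg_pos sum_nonneg cnorm_nonneg[OF M]) auto
  have "M a / N a \<le> B" for a
    using MB[of a] B0 cnorm_nonneg[OF N, of a] by (cases "N a = 0") (auto simp: field_simps)
  then have bdd: "bdd_above (range (\<lambda>a. M a / N a))" by (intro bdd_aboveI2)
  have le: "M a / N a \<le> cnorm_onorm N M" for a
    unfolding cnorm_onorm_def by (rule cSUP_upper[OF _ bdd]) simp
  show "M a \<le> cnorm_onorm N M * N a"
  proof (cases "N a = 0")
    case True
    then show ?thesis using MB[of a] by simp
  next
    case False
    then have "N a > 0" using cnorm_nonneg[OF N, of a] by simp
    then show ?thesis using le[of a] by (simp add: field_simps)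
  qed
  have "0 \<le> M a / N a" using cnorm_nonneg[OF N] cnorm_nonneg[OF M] by simp
  then show "0 \<le> cnorm_onorm N M" using le order_trans by blast
qed

lemma cnorm_onorm_le:
  assumes "\<And>a. M a \<le> s * N a" "\<And>a. 0 \<le> N a" "0 \<le> s"
  shows "cnorm_onorm N M \<le> s"
  unfolding cnorm_onorm_def
proof (rule cSUP_least)
  fix a
  show "M a / N a \<le> s"
    using assms(1)[of a] assms(2)[of a] assms(3) by (cases "N a = 0") (auto simp: field_simps)
qed simp

lemma cnorm_onorm_nonneg:
  assumes "\<And>a. M a \<le> s * N a" "\<And>a. 0 \<le> N a" "\<And>a. 0 \<le> M a" "0 \<le> s"
  shows "0 \<le> cnorm_onorm N M"
proof -
  have "M a / N a \<le> s" for a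
    using assms(1)[of a] assms(2)[of a] assms(4) by (cases "N a = 0") (auto simp: field_simps)
  then have bdd: "bdd_above (range (\<lambda>a. M a / N a))" by (intro bdd_aboveI2)
  have "0 \<le> M (\<lambda>_. 0) / N (\<lambda>_. 0)" using assms(2,3) by simp
  also have "\<dots> \<le> cnorm_onorm N M" unfolding cnorm_onorm_def by (rule cSUP_upper[OF _ bdd]) simp
  finally show ?thesis .
qed

lemma d_b_le:
  assumes "\<And>a. M a \<le> s * N a" "\<And>a. N a \<le> t * M a" "\<And>a. 0 \<le> N a" "\<And>a. 0 \<le> M a" "0 \<le> s" "0 \<le> t"
  shows "d_b N M \<le> s * t"
  unfolding d_b_def
  by (intro mult_mono cnorm_onorm_le cnorm_onorm_nonneg[of N t M]) (use assms in auto)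

lemma independent_sum_eq_0:
  fixes x :: "nat \<Rightarrow> 'a::real_vector"
  assumes "inj_on x {..<n}" "independent (x ` {..<n})" "(\<Sum>i<n. a i *\<^sub>R x i) = 0" "i < n"
  shows "a i = 0"
proof -
  define g where "g v = a (the_inv_into {..<n} x v)" for v
  have g: "g (x i) = a i" if "i < n" for i
    using that assms(1) by (simp add: g_def the_inv_into_f_f)
  have "(\<Sum>v\<in>x ` {..<n}. g v *\<^sub>R v) = (\<Sum>i<n. a i *\<^sub>R x i)"
    using assms(1) by (simp add: sum.reindex g)
  then have "g (x i) = 0"
    using assms by (intro independentD[of "x ` {..<n}" "x ` {..<n}" g]) auto
  then show ?thesis using g assms(4) by simp
qed

lemma seq_cnorm_is_cnorm:
  assumes "inj_on x {..<n}" "independent (x ` {..<n})"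
  shows "is_cnorm n (seq_cnorm n x)"
  unfolding is_cnorm_def seq_cnorm_def
proof (intro conjI allI)
  fix a b :: "nat \<Rightarrow> real" and c :: real
  show "norm (\<Sum>i<n. a i *\<^sub>R x i) = 0 \<longleftrightarrow> (\<forall>i<n. a i = 0)"
    using independent_sum_eq_0[OF assms, of a] by auto
  have "(\<Sum>i<n. (c * a i) *\<^sub>R x i) = c *\<^sub>R (\<Sum>i<n. a i *\<^sub>R x i)"
    by (simp add: scaleR_sum_right)
  then show "norm (\<Sum>i<n. (c * a i) *\<^sub>R x i) = \<bar>c\<bar> * norm (\<Sum>i<n. a i *\<^sub>R x i)" by simp
  have "(\<Sum>i<n. (a i + b i) *\<^sub>R x i) = (\<Sum>i<n. a i *\<^sub>R x i) + (\<Sum>i<n. b i *\<^sub>R x i)"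
    by (simp add: scaleR_add_left sum.distrib)
  then show "norm (\<Sum>i<n. (a i + b i) *\<^sub>R x i) \<le> norm (\<Sum>i<n. a i *\<^sub>R x i) + norm (\<Sum>i<n. b i *\<^sub>R x i)"
    by (simp add: norm_triangle_ineq)
qed simp

text \<open>
  A separate bound for the two domination constants.  For normalized sequences it follows from
  \<open>d_b \<le> 2\<close>, since evaluation at the first unit vector shows that neither constant is below \<open>1\<close>.
\<close>

definition two_equivalent :: "nat \<Rightarrow> cnorm \<Rightarrow> (nat \<Rightarrow> 'a::real_normed_vector) \<Rightarrow> bool" where
  "two_equivalent n E x \<longleftrightarrow>
     (\<forall>a. E a \<le> 2 * norm (\<Sum>i<n. a i *\<^sub>R x i) \<and> norm (\<Sum>i<n. a i *\<^sub>R x i) \<le> 2 * E a)"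

lemma equivalent_to_basis_imp_two_equivalent:
  assumes E: "E \<in> M_space n" and n: "n \<ge> 1" and x: "inj_on x {..<n}" "independent (x ` {..<n})"
    "norm (x 0) = 1" and eq: "equivalent_to_basis 2 n x E"
  shows "two_equivalent n E x"
proof -
  have E1: "is_cnorm n E" and E0: "E (unit_coeff 0) = 1"
    using E n by (auto simp: M_space_def unit_coeff_def)
  note S = seq_cnorm_is_cnorm[OF x(1,2)]
  define s t where "s = cnorm_onorm (seq_cnorm n x) E" and "t = cnorm_onorm E (seq_cnorm n x)"
  have s: "E a \<le> s * seq_cnorm n x a" and t: "seq_cnorm n x a \<le> t * E a" for a
    unfolding s_def t_def by (rule cnorm_onorm_bound[OF S E1], rule cnorm_onorm_bound[OF E1 S])
  have st: "s * t \<le> 2" using eq by (simp add: equivalent_to_basis_def d_b_def s_def t_def)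
  have "(\<Sum>i<n. unit_coeff 0 i *\<^sub>R x i) = x 0"
    using n by (simp add: unit_coeff_def if_distrib[of "\<lambda>c. c *\<^sub>R _"] cong: if_cong)
  then have "seq_cnorm n x (unit_coeff 0) = 1" using x(3) by (simp add: seq_cnorm_def)
  then have s1: "1 \<le> s" and t1: "1 \<le> t" using s[of "unit_coeff 0"] t[of "unit_coeff 0"] E0 by auto
  have "s \<le> s * t" "t \<le> s * t" using s1 t1 by auto
  then have "s \<le> 2" "t \<le> 2" using st by linarith+
  then have 1: "s * seq_cnorm n x a \<le> 2 * seq_cnorm n x a" and 2: "t * E a \<le> 2 * E a" for a
    by (intro mult_right_mono cnorm_nonneg[OF S] cnorm_nonneg[OF E1]; simp)+
  have "E a \<le> 2 * seq_cnorm n x a \<and> seq_cnorm n x a \<le> 2 * E a" for a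
    using order_trans[OF s 1] order_trans[OF t 2] by blast
  then show ?thesis by (simp add: two_equivalent_def seq_cnorm_def)
qed

section \<open>Ramsey theory and suppressible differences\<close>

lemma ramsey_finite_palette:
  fixes r R :: nat and P :: "'c set"
  assumes "finite P"
  obtains N :: nat where
    "\<And>col. (\<And>X. X \<in> nsets {..<N} r \<Longrightarrow> col X \<in> P) \<Longrightarrow>
       \<exists>H \<in> nsets {..<N} R. \<forall>X\<in>nsets H r. \<forall>Y\<in>nsets H r. col X = col Y"
proof -
  obtain e where e: "bij_betw e P {..<card P}"
    using ex_bij_betw_finite_nat[OF assms] by (auto simp: atLeast0LessThan)
  obtain N :: nat where N: "partn_lst {..<N} (replicate (card P) R) r"
    using ramsey_full by blast
  have "\<exists>H \<in> nsets {..<N} R. \<forall>X\<in>nsets H r. \<forall>Y\<in>nsets H r. col X = col Y"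
    if col: "\<And>X. X \<in> nsets {..<N} r \<Longrightarrow> col X \<in> P" for col
  proof -
    have "e \<circ> col \<in> nsets {..<N} r \<rightarrow> {..<card P}"
      using col e by (auto simp: bij_betw_def)
    from partn_lstE[OF N this] obtain i H where i: "i < card P" and
      H: "H \<in> nsets {..<N} (replicate (card P) R ! i)" "(e \<circ> col) ` nsets H r \<subseteq> {i}"
      by auto
    have HN: "H \<in> nsets {..<N} R" using i H by simp
    have sub: "nsets H r \<subseteq> nsets {..<N} r"
      using HN by (auto simp: nsets_def)
    have "col X = col Y" if "X \<in> nsets H r" "Y \<in> nsets H r" for X Y
    proof -
      have "e (col X) = e (col Y)" using H(2) that by (force simp: image_subset_iff)
      moreover have "col X \<in> P" "col Y \<in> P" using that sub col by blast+
      ultimately show ?thesis using e by (meson bij_betw_imp_inj_on inj_on_eq_iff)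
    qed
    then show ?thesis using HN by blast
  qed
  then show thesis using that by blast
qed

lemma norm_sum_diff_le:
  fixes z :: "nat \<Rightarrow> 'a::real_normed_vector"
  assumes "\<And>i. i < k \<Longrightarrow> \<bar>c i - d i\<bar> \<le> e" "\<And>i. i < k \<Longrightarrow> norm (z i) \<le> B" "0 \<le> e"
  shows "\<bar>norm (\<Sum>i<k. c i *\<^sub>R z i) - norm (\<Sum>i<k. d i *\<^sub>R z i)\<bar> \<le> real k * (e * B)"
proof -
  have "norm ((\<Sum>i<k. c i *\<^sub>R z i) - (\<Sum>i<k. d i *\<^sub>R z i)) = norm (\<Sum>i<k. (c i - d i) *\<^sub>R z i)"
    by (simp add: sum_subtractf scaleR_left_diff_distrib)
  also have "\<dots> \<le> real (card {..<k}) * (e * B)"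
  proof (rule sum_norm_bound)
    fix i assume "i \<in> {..<k}"
    then show "norm ((c i - d i) *\<^sub>R z i) \<le> e * B"
      using assms by (auto intro!: mult_mono)
  qed
  finally show ?thesis using norm_triangle_ineq3 order_trans by fastforce
qed

text \<open>
  The colour of \<open>X\<close> records, for every coefficient vector on a fine grid in the cube \<open>[-1, 1]\<^sup>k\<close>, the norm
  of the corresponding combination of the \<open>z X i\<close>, rounded to a multiple of \<open>1/q\<close>.  There are
  finitely many colours, and all coefficient vectors in the cube are close to the grid.
\<close>

lemma ramsey_almost_constant_norms:
  fixes k r R :: nat and \<epsilon> :: real
  assumes "0 < \<epsilon>"
  obtains N :: nat where
    "\<And>z :: nat set \<Rightarrow> nat \<Rightarrow> 'a::real_normed_vector. (\<And>X i. norm (z X i) \<le> 2) \<Longrightarrow>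
      \<exists>H \<in> nsets {..<N} R. \<forall>X\<in>nsets H r. \<forall>Y\<in>nsets H r. \<forall>c. (\<forall>i<k. \<bar>c i\<bar> \<le> 1) \<longrightarrow>
        norm (\<Sum>i<k. c i *\<^sub>R z X i) \<le> norm (\<Sum>i<k. c i *\<^sub>R z Y i) + \<epsilon>"
proof -
  define q :: nat where "q = nat \<lceil>(4 * real k + 1) / \<epsilon>\<rceil> + 1"
  have q0: "q > 0" by (simp add: q_def)
  have q: "(4 * real k + 1) / real q \<le> \<epsilon>"
  proof -
    have "(4 * real k + 1) / \<epsilon> \<le> real q" unfolding q_def by linarith
    then show ?thesis using assms q0 by (simp add: field_simps)
  qed
  define G where "G = PiE {..<k} (\<lambda>_. {- int q..int q})"
  have finG: "finite G" unfolding G_def by (intro finite_PiE) auto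
  define P where "P = PiE G (\<lambda>_. {0..int (q * (2 * k))})"
  have finP: "finite P" unfolding P_def by (intro finite_PiE finG) auto
  obtain N :: nat where N: "\<And>col. (\<And>X. X \<in> nsets {..<N} r \<Longrightarrow> col X \<in> P) \<Longrightarrow>
       \<exists>H \<in> nsets {..<N} R. \<forall>X\<in>nsets H r. \<forall>Y\<in>nsets H r. col X = col Y"
    using ramsey_finite_palette[OF finP] by blast
  have "\<exists>H \<in> nsets {..<N} R. \<forall>X\<in>nsets H r. \<forall>Y\<in>nsets H r. \<forall>c. (\<forall>i<k. \<bar>c i\<bar> \<le> 1) \<longrightarrow>
        norm (\<Sum>i<k. c i *\<^sub>R z X i) \<le> norm (\<Sum>i<k. c i *\<^sub>R z Y i) + \<epsilon>"
    if z: "\<And>X i. norm (z X i) \<le> 2" for z :: "nat set \<Rightarrow> nat \<Rightarrow> 'a"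
  proof -
    define nn where "nn X g = norm (\<Sum>i<k. (real_of_int (g i) / real q) *\<^sub>R z X i)" for X g
    define col where "col X = restrict (\<lambda>g. \<lfloor>real q * nn X g\<rfloor>) G" for X
    have "col X \<in> P" for X
    proof -
      have "\<lfloor>real q * nn X g\<rfloor> \<in> {0..int (q * (2 * k))}" if "g \<in> G" for g
      proof -
        have "nn X g \<le> real (card {..<k}) * 2" unfolding nn_def
        proof (rule sum_norm_bound)
          fix i assume "i \<in> {..<k}"
          then have "\<bar>real_of_int (g i)\<bar> \<le> real q" using that by (force simp: G_def PiE_iff abs_le_iff)
          then have "\<bar>real_of_int (g i) / real q\<bar> * norm (z X i) \<le> 1 * 2"
            using z q0 by (intro mult_mono) (auto simp: field_simps)
          then show "norm ((real_of_int (g i) / real q) *\<^sub>R z X i) \<le> 2" by simp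
        qed
        then have "real q * nn X g \<le> real (q * (2 * k))"
          using q0 by (simp add: mult_left_mono mult.commute)
        moreover have "0 \<le> real q * nn X g" by (simp add: nn_def)
        ultimately show ?thesis by (auto simp: floor_le_iff)
      qed
      then show ?thesis by (auto simp: col_def P_def)
    qed
    from N[of col, OF this] obtain H where H: "H \<in> nsets {..<N} R"
      "\<And>X Y. X \<in> nsets H r \<Longrightarrow> Y \<in> nsets H r \<Longrightarrow> col X = col Y" by blast
    have "norm (\<Sum>i<k. c i *\<^sub>R z X i) \<le> norm (\<Sum>i<k. c i *\<^sub>R z Y i) + \<epsilon>"
      if X: "X \<in> nsets H r" and Y: "Y \<in> nsets H r" and c: "\<forall>i<k. \<bar>c i\<bar> \<le> 1" for X Y c
    proof -
      define g where "g = restrict (\<lambda>i. \<lfloor>real q * c i\<rfloor>) {..<k}"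
      have gG: "g \<in> G"
      proof -
        have "- int q \<le> \<lfloor>real q * c i\<rfloor> \<and> \<lfloor>real q * c i\<rfloor> \<le> int q" if "i < k" for i
        proof -
          have "\<bar>c i\<bar> \<le> 1" using c that by auto
          then have "\<bar>real q * c i\<bar> \<le> real q"
            by (simp add: abs_mult mult_left_le)
          then show ?thesis by (auto simp: le_floor_iff abs_le_iff) linarith
        qed
        then show ?thesis by (auto simp: g_def G_def)
      qed
      have approx: "\<bar>c i - real_of_int (g i) / real q\<bar> \<le> 1 / real q" if "i < k" for i
      proof -
        have "\<bar>real q * c i - real_of_int \<lfloor>real q * c i\<rfloor>\<bar> \<le> 1" by linarith
        then have "\<bar>real q * c i - real_of_int (g i)\<bar> / real q \<le> 1 / real q"
          using that q0 by (intro divide_right_mono) (auto simp: g_def)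
        moreover have "\<bar>c i - real_of_int (g i) / real q\<bar> = \<bar>real q * c i - real_of_int (g i)\<bar> / real q"
          proof -
          have "c i - real_of_int (g i) / real q = (real q * c i - real_of_int (g i)) / real q"
            using q0 by (simp add: field_simps)
          then show ?thesis using q0 by simp
        qed
        ultimately show ?thesis by simp
      qed
      have near: "\<bar>norm (\<Sum>i<k. c i *\<^sub>R z X i) - nn X g\<bar> \<le> real k * (1 / real q * 2)" for X
        unfolding nn_def by (rule norm_sum_diff_le) (use approx z in auto)
      have "col X g = col Y g" using H(2)[OF X Y] by simp
      then have "\<lfloor>real q * nn X g\<rfloor> = \<lfloor>real q * nn Y g\<rfloor>" using gG by (simp add: col_def)
      then have "real q * nn X g \<le> real q * nn Y g + 1" by linarith
      then have "nn X g \<le> nn Y g + 1 / real q" using q0 by (simp add: field_simps)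
      then have "norm (\<Sum>i<k. c i *\<^sub>R z X i) \<le> norm (\<Sum>i<k. c i *\<^sub>R z Y i) + (4 * real k + 1) / real q"
        using near[of X] near[of Y] by (simp add: add_divide_distrib abs_le_iff)
      then show ?thesis using q by linarith
    qed
    then show ?thesis using H(1) by blast
  qed
  then show thesis using that by blast
qed

lemma sum_lessThan_add_split:
  fixes g :: "nat \<Rightarrow> 'b::comm_monoid_add"
  shows "(\<Sum>i<m + n. g i) = (\<Sum>i<m. g i) + (\<Sum>j<n. g (m + j))"
  by (induction n) (auto simp: add.assoc)

text \<open>
  The norm is convex in \<open>\<theta>\<close>, so its maximum over the cube is attained at a vertex.
\<close>

lemma norm_add_scaled_sum_le:
  fixes x :: "'a::real_normed_vector" and n :: nat
  assumes "\<And>A. A \<subseteq> {..<n} \<Longrightarrow> norm (x + (\<Sum>j\<in>A. y j)) \<le> M"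
    and "\<And>j. j < n \<Longrightarrow> 0 \<le> \<theta> j \<and> \<theta> j \<le> 1"
  shows "norm (x + (\<Sum>j<n. \<theta> j *\<^sub>R y j)) \<le> M"
  using assms
proof (induction n arbitrary: x)
  case 0
  then show ?case by (metis empty_subsetI lessThan_0 sum.empty)
next
  case (Suc n)
  let ?S = "\<Sum>j<n. \<theta> j *\<^sub>R y j"
  have 1: "norm (x + ?S) \<le> M"
  proof (rule Suc.IH)
    fix A assume "A \<subseteq> {..<n}"
    then show "norm (x + sum y A) \<le> M" by (intro Suc.prems(1)) auto
  qed (use Suc.prems in auto)
  have 2: "norm ((x + y n) + ?S) \<le> M"
  proof (rule Suc.IH)
    fix A assume A: "A \<subseteq> {..<n}"
    then have "n \<notin> A" "finite A" using finite_subset by auto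
    moreover have "norm (x + (\<Sum>j\<in>insert n A. y j)) \<le> M"
      by (rule Suc.prems(1)) (use A in auto)
    ultimately show "norm (x + y n + sum y A) \<le> M" by (simp add: add.assoc)
  qed (use Suc.prems in auto)
  have t: "0 \<le> \<theta> n" "\<theta> n \<le> 1" using Suc.prems(2) by auto
  have "x + (\<Sum>j<Suc n. \<theta> j *\<^sub>R y j) = (1 - \<theta> n) *\<^sub>R (x + ?S) + \<theta> n *\<^sub>R ((x + y n) + ?S)"
    by (simp add: algebra_simps)
  then have "norm (x + (\<Sum>j<Suc n. \<theta> j *\<^sub>R y j))
      \<le> (1 - \<theta> n) * norm (x + ?S) + \<theta> n * norm ((x + y n) + ?S)"
    using t by (metis (no_types, lifting) abs_of_nonneg diff_ge_0_iff_ge norm_scaleR norm_triangle_ineq)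
  also have "\<dots> \<le> (1 - \<theta> n) * M + \<theta> n * M"
    using t 1 2 by (intro add_mono mult_left_mono) auto
  finally show ?case by (simp add: algebra_simps)
qed

text \<open>
  The general combination whose norm is studied: the \<open>f i\<close> are the vectors that have to survive, the
  differences are those that may be dropped.
\<close>

definition diff_comb :: "nat \<Rightarrow> nat \<Rightarrow> (nat \<Rightarrow> 'a::real_normed_vector) \<Rightarrow> (nat \<Rightarrow> nat \<Rightarrow> 'a) \<Rightarrow>
    (nat \<Rightarrow> nat) \<Rightarrow> (nat \<Rightarrow> nat) \<Rightarrow> (nat \<Rightarrow> real) \<Rightarrow> (nat \<Rightarrow> real) \<Rightarrow> 'a" where
  "diff_comb F L f v k l a b =
     (\<Sum>i<F. a i *\<^sub>R f i) + (\<Sum>j<L. b j *\<^sub>R (v j (k j) - v j (l j)))"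

lemma diff_comb_scale:
  "diff_comb F L f v k l (\<lambda>i. t * a i) (\<lambda>j. t * b j) = t *\<^sub>R diff_comb F L f v k l a b"
  by (simp add: diff_comb_def scaleR_add_right scaleR_sum_right)

text \<open>
  Choose a large index set \<open>H\<close> on which the norm of a combination hardly depends on the \<open>2 L\<close> indices
  used, and reserve \<open>m + 1\<close> consecutive elements of \<open>H\<close> for each family.  Sliding the pair of indices
  of all families outside \<open>A\<close> simultaneously through the \<open>m\<close> consecutive positions changes the norm by
  at most \<open>1/8\<close>; in the average of the resulting vectors, the differences of those families telescope
  and contribute at most \<open>2 L / m\<close>.
\<close>

lemma suppressing_differences_bounded_coefficients:
  fixes L F :: nat
  obtains N :: nat where
    "\<And>f v. (\<And>i. norm (f i :: 'a::real_normed_vector) \<le> 1) \<Longrightarrow> (\<And>j k. norm (v j k) \<le> 1) \<Longrightarrow>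
      \<exists>k l. (\<forall>j<L. k j < l j \<and> l j < N) \<and>
        (\<forall>A a b. (\<forall>i<F. \<bar>a i\<bar> \<le> 1) \<and> (\<forall>j<L. \<bar>b j\<bar> \<le> 1) \<longrightarrow>
          norm (diff_comb F L f v k l a (\<lambda>j. if j \<in> A then b j else 0))
            \<le> norm (diff_comb F L f v k l a b) + 1 / 4)"
proof -
  define m where "m = 16 * L + 1"
  define R where "R = L * (m + 1)"
  obtain N :: nat where N:
    "\<And>z :: nat set \<Rightarrow> nat \<Rightarrow> 'a. (\<And>X i. norm (z X i) \<le> 2) \<Longrightarrow>
      \<exists>H \<in> nsets {..<N} R. \<forall>X\<in>nsets H (2 * L). \<forall>Y\<in>nsets H (2 * L). \<forall>c. (\<forall>i<F + L. \<bar>c i\<bar> \<le> 1) \<longrightarrow>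
        norm (\<Sum>i<F + L. c i *\<^sub>R z X i) \<le> norm (\<Sum>i<F + L. c i *\<^sub>R z Y i) + 1 / 8"
    using ramsey_almost_constant_norms[where 'a='a and \<epsilon>="1/8" and R=R and r="2 * L" and k="F + L"]
    by (simp, blast)
  have "\<exists>k l. (\<forall>j<L. k j < l j \<and> l j < N) \<and>
        (\<forall>A a b. (\<forall>i<F. \<bar>a i\<bar> \<le> 1) \<and> (\<forall>j<L. \<bar>b j\<bar> \<le> 1) \<longrightarrow>
          norm (diff_comb F L f v k l a (\<lambda>j. if j \<in> A then b j else 0))
            \<le> norm (diff_comb F L f v k l a b) + 1 / 4)"
    if f: "\<And>i. norm (f i) \<le> 1" and v: "\<And>j k. norm (v j k) \<le> 1" for f :: "nat \<Rightarrow> 'a" and v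
  proof -
    define z where "z X i = (if i < F then f i else
        v (i - F) (sorted_list_of_set X ! (2 * (i - F))) -
        v (i - F) (sorted_list_of_set X ! (2 * (i - F) + 1)))" for X i
    have "norm (z X i) \<le> 2" for X i
    proof (cases "i < F")
      case True
      then show ?thesis using f[of i] by (simp add: z_def)
    next
      case False
      then show ?thesis unfolding z_def
        by (simp, intro norm_triangle_le_diff) (metis add_mono one_add_one v)
    qed
    from N[of z, OF this] obtain H where HN: "H \<in> nsets {..<N} R" and
      H: "\<And>X Y c. X \<in> nsets H (2 * L) \<Longrightarrow> Y \<in> nsets H (2 * L) \<Longrightarrow> (\<forall>i<F + L. \<bar>c i\<bar> \<le> 1) \<Longrightarrow>
        norm (\<Sum>i<F + L. c i *\<^sub>R z X i) \<le> norm (\<Sum>i<F + L. c i *\<^sub>R z Y i) + 1 / 8"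
      by blast
    have finH: "finite H" and cardH: "card H = R" and HsubN: "H \<subseteq> {..<N}"
      using HN by (auto simp: nsets_def)
    define h where "h i = sorted_list_of_set H ! i" for i
    have hmono: "h i < h i'" if "i < i'" "i' < R" for i i'
      using that finH cardH unfolding h_def
      by (intro sorted_wrt_nth_less[where P="(<)"]) auto
    have hH: "h i \<in> H" if "i < R" for i
      using that finH cardH unfolding h_def by (metis nth_mem length_sorted_list_of_set set_sorted_list_of_set)
    define hh where "hh j s = h (j * (m + 1) + s)" for j s
    have inR: "j * (m + 1) + s < R" if "j < L" "s \<le> m" for j s
    proof -
      have "j * (m + 1) + s < (j + 1) * (m + 1)" using that by (simp add: algebra_simps)
      also have "\<dots> \<le> R" unfolding R_def using that by (intro mult_right_mono) auto
      finally show ?thesis .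
    qed
    have hhH: "hh j s \<in> H" if "j < L" "s \<le> m" for j s
      unfolding hh_def by (intro hH inR that)
    have hhmono: "hh j s < hh j' s'" if "j < j' \<or> j = j' \<and> s < s'" "j' < L" "s \<le> m" "s' \<le> m" for j j' s s'
    proof -
      have "j * (m + 1) + s < j' * (m + 1) + s'"
      proof (cases "j = j'")
        case True then show ?thesis using that by auto
      next
        case False
        then have "Suc j \<le> j'" using that by auto
        then have "Suc j * (m + 1) \<le> j' * (m + 1)" by (intro mult_right_mono) auto
        then show ?thesis using that by simp
      qed
      then show ?thesis unfolding hh_def using inR that by (intro hmono) auto
    qed
    define k l where "k j = hh j 0" and "l j = hh j 1" for j
    have m1: "1 \<le> m" by (simp add: m_def)
    have kl: "\<forall>j<L. k j < l j \<and> l j < N"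
      using hhmono m1 hhH HsubN unfolding k_def l_def by (fastforce simp: subset_iff)
    have "norm (diff_comb F L f v k l a (\<lambda>j. if j \<in> A then b j else 0))
            \<le> norm (diff_comb F L f v k l a b) + 1 / 4"
      if a: "\<forall>i<F. \<bar>a i\<bar> \<le> 1" and b: "\<forall>j<L. \<bar>b j\<bar> \<le> 1" for A a b
    proof -
      define e where "e j s = (if j \<in> A then 0 else s)" for j and s :: nat
      define c where "c i = (if i < F then a i else b (i - F))" for i
      define D where "D s = diff_comb F L f v (\<lambda>j. hh j (e j s)) (\<lambda>j. hh j (e j s + 1)) a b" for s
      have c1: "\<forall>i<F + L. \<bar>c i\<bar> \<le> 1" using a b by (auto simp: c_def)
      define idx where "idx s t = hh (t div 2) (e (t div 2) s + t mod 2)" for s t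
      define X where "X s = set (map (idx s) [0..<2 * L])" for s
      have sortedX: "sorted_list_of_set (X s) = map (idx s) [0..<2 * L] \<and> X s \<in> nsets H (2 * L)"
        if s: "s < m" for s
      proof -
        have em: "e j s + t mod 2 \<le> m" for j t
        proof -
          have "t mod 2 < 2" by simp
          moreover have "e j s \<le> s" by (simp add: e_def)
          ultimately show ?thesis using s by linarith
        qed
        have im: "idx s t < idx s t'" if "t < t'" "t' < 2 * L" for t t'
        proof -
          have "t div 2 < t' div 2 \<or> t div 2 = t' div 2 \<and> e (t div 2) s + t mod 2 < e (t' div 2) s + t' mod 2"
          proof (cases "t div 2 = t' div 2")
            case True
            then have "t mod 2 < t' mod 2" using that(1)
              by (metis div_mult_mod_eq nat_add_left_cancel_less)
            then show ?thesis using True by simp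
          next
            case False
            then show ?thesis using that(1) div_le_mono[of t t' 2] by simp
          qed
          then show ?thesis unfolding idx_def using that em by (intro hhmono) auto
        qed
        then have sw: "sorted_wrt (<) (map (idx s) [0..<2 * L])"
          by (auto simp: sorted_wrt_iff_nth_less)
        then have 1: "sorted (map (idx s) [0..<2 * L])" "distinct (map (idx s) [0..<2 * L])"
          using strict_sorted_iff by blast+
        have "sorted_list_of_set (X s) = map (idx s) [0..<2 * L]"
          unfolding X_def using 1 by (rule sorted_list_of_set.idem_if_sorted_distinct)
        moreover have "X s \<subseteq> H" unfolding X_def idx_def using hhH em by auto
        moreover have "card (X s) = 2 * L" unfolding X_def
          using distinct_card[OF 1(2)] by simp
        ultimately show ?thesis unfolding nsets_def X_def by auto
      qed
      have DX: "(\<Sum>i<F + L. c i *\<^sub>R z (X s) i) = D s" if s: "s < m" for s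
      proof -
        have "c (F + j) *\<^sub>R z (X s) (F + j) = b j *\<^sub>R (v j (hh j (e j s)) - v j (hh j (e j s + 1)))"
          if "j < L" for j
        proof -
          have "(2 * j + 1) div 2 = j" "(2 * j + 1) mod 2 = 1" by auto
          then have "idx s (2 * j) = hh j (e j s)" "idx s (2 * j + 1) = hh j (e j s + 1)"
            unfolding idx_def by simp_all
          then show ?thesis
            unfolding z_def c_def using that sortedX[OF s] by (simp del: upt_Suc)
        qed
        then have "(\<Sum>j<L. c (F + j) *\<^sub>R z (X s) (F + j)) =
            (\<Sum>j<L. b j *\<^sub>R (v j (hh j (e j s)) - v j (hh j (e j s + 1))))" by simp
        moreover have "(\<Sum>i<F. c i *\<^sub>R z (X s) i) = (\<Sum>i<F. a i *\<^sub>R f i)"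
          by (simp add: c_def z_def)
        ultimately show ?thesis unfolding sum_lessThan_add_split D_def diff_comb_def by simp
      qed
      have D0: "D 0 = diff_comb F L f v k l a b"
        by (simp add: D_def k_def[abs_def] l_def[abs_def] e_def)
      have Ds: "norm (D s) \<le> norm (D 0) + 1 / 8" if s: "s < m" for s
        using H[of "X s" "X 0" c] sortedX[OF s] sortedX[of 0] DX[OF s] DX[of 0] c1 m1 by simp
      define W where "W = diff_comb F L f v k l a (\<lambda>j. if j \<in> A then b j else 0)"
      \<comment> \<open>What telescoping leaves of the families outside \<open>A\<close>, summed over all \<open>m\<close> positions.\<close>
      define T where "T = (\<Sum>j<L. if j \<in> A then 0 else b j *\<^sub>R (v j (hh j 0) - v j (hh j m)))"
      have avg: "(\<Sum>s<m. D s) = real m *\<^sub>R W + T"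
      proof -
        have "(\<Sum>s<m. D s) = (\<Sum>s<m. \<Sum>i<F. a i *\<^sub>R f i) +
            (\<Sum>j<L. \<Sum>s<m. b j *\<^sub>R (v j (hh j (e j s)) - v j (hh j (e j s + 1))))"
          unfolding D_def diff_comb_def sum.distrib by (simp add: sum.swap[of _ "{..<m}" "{..<L}"])
        also have "(\<Sum>s<m. \<Sum>i<F. a i *\<^sub>R f i) = real m *\<^sub>R (\<Sum>i<F. a i *\<^sub>R f i)"
          by (simp add: sum_constant_scaleR)
        also have "(\<Sum>j<L. \<Sum>s<m. b j *\<^sub>R (v j (hh j (e j s)) - v j (hh j (e j s + 1)))) =
          (\<Sum>j<L. real m *\<^sub>R ((if j \<in> A then b j else 0) *\<^sub>R (v j (k j) - v j (l j))) +
             (if j \<in> A then 0 else b j *\<^sub>R (v j (hh j 0) - v j (hh j m))))"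
        proof (rule sum.cong[OF refl])
          fix j assume "j \<in> {..<L}"
          show "(\<Sum>s<m. b j *\<^sub>R (v j (hh j (e j s)) - v j (hh j (e j s + 1)))) =
            real m *\<^sub>R ((if j \<in> A then b j else 0) *\<^sub>R (v j (k j) - v j (l j))) +
             (if j \<in> A then 0 else b j *\<^sub>R (v j (hh j 0) - v j (hh j m)))"
          proof (cases "j \<in> A")
            case True
            then show ?thesis by (simp add: e_def k_def l_def sum_constant_scaleR)
          next
            case False
            have "(\<Sum>s<m. v j (hh j s) - v j (hh j (Suc s))) = v j (hh j 0) - v j (hh j m)"
              by (rule sum_lessThan_telescope')
            then show ?thesis using False by (simp add: e_def scaleR_sum_right[symmetric])
          qed
        qed
        finally show ?thesis
          unfolding W_def T_def diff_comb_def by (simp add: sum.distrib scaleR_add_right scaleR_sum_right)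
      qed
      have nT: "norm T \<le> 2 * real L"
      proof -
        have "norm T \<le> real (card {..<L}) * 2" unfolding T_def
        proof (rule sum_norm_bound)
          fix j assume "j \<in> {..<L}"
          then have "\<bar>b j\<bar> \<le> 1" using b by auto
          moreover have "norm (v j (hh j 0) - v j (hh j m)) \<le> 2"
            by (intro norm_triangle_le_diff) (metis add_mono one_add_one v)
          ultimately have "\<bar>b j\<bar> * norm (v j (hh j 0) - v j (hh j m)) \<le> 1 * 2"
            by (intro mult_mono) auto
          then show "norm (if j \<in> A then 0 else b j *\<^sub>R (v j (hh j 0) - v j (hh j m))) \<le> 2" by simp
        qed
        then show ?thesis by simp
      qed
      have "real m * norm W = norm ((\<Sum>s<m. D s) - T)" using avg by simp
      also have "\<dots> \<le> norm (\<Sum>s<m. D s) + norm T" by (rule norm_triangle_ineq4)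
      also have "norm (\<Sum>s<m. D s) \<le> real (card {..<m}) * (norm (D 0) + 1 / 8)"
        by (rule sum_norm_bound) (use Ds in auto)
      finally have "real m * norm W \<le> real m * (norm (D 0) + 1 / 8) + 2 * real L"
        using nT by simp
      also have "\<dots> \<le> real m * (norm (D 0) + 1 / 4)" by (simp add: m_def algebra_simps)
      finally have "norm W \<le> norm (D 0) + 1 / 4" using m1 by (simp add: mult_le_cancel_left)
      then show ?thesis by (simp add: W_def D0)
    qed
    then show ?thesis using kl by blast
  qed
  then show thesis using that by blast
qed

text \<open>
  If the norm controls the coefficients up to a factor \<open>4\<close>, then scaling to norm \<open>1/4\<close> puts all
  coefficients into \<open>[-1, 1]\<close>, and the additive error \<open>1/4\<close> becomes a factor \<open>2\<close>.
\<close>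

lemma suppressing_differences:
  fixes L F :: nat
  obtains N :: nat where
    "\<And>f v. (\<And>i. norm (f i :: 'a::real_normed_vector) \<le> 1) \<Longrightarrow> (\<And>j k. norm (v j k) \<le> 1) \<Longrightarrow>
      (\<And>k l a b. \<forall>j<L. k j < l j \<and> l j < N \<Longrightarrow>
         (\<forall>i<F. \<bar>a i\<bar> \<le> 4 * norm (diff_comb F L f v k l a b)) \<and>
         (\<forall>j<L. \<bar>b j\<bar> \<le> 4 * norm (diff_comb F L f v k l a b))) \<Longrightarrow>
      \<exists>k l. (\<forall>j<L. k j < l j \<and> l j < N) \<and>
        (\<forall>A a b. norm (diff_comb F L f v k l a (\<lambda>j. if j \<in> A then b j else 0))
            \<le> 2 * norm (diff_comb F L f v k l a b))"
proof -
  obtain N :: nat where N: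
    "\<And>f v. (\<And>i. norm (f i :: 'a::real_normed_vector) \<le> 1) \<Longrightarrow> (\<And>j k. norm (v j k) \<le> 1) \<Longrightarrow>
      \<exists>k l. (\<forall>j<L. k j < l j \<and> l j < N) \<and>
        (\<forall>A a b. (\<forall>i<F. \<bar>a i\<bar> \<le> 1) \<and> (\<forall>j<L. \<bar>b j\<bar> \<le> 1) \<longrightarrow>
          norm (diff_comb F L f v k l a (\<lambda>j. if j \<in> A then b j else 0))
            \<le> norm (diff_comb F L f v k l a b) + 1 / 4)"
    using suppressing_differences_bounded_coefficients[where 'a='a and L=L and F=F] by blast
  have "\<exists>k l. (\<forall>j<L. k j < l j \<and> l j < N) \<and>
        (\<forall>A a b. norm (diff_comb F L f v k l a (\<lambda>j. if j \<in> A then b j else 0))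
            \<le> 2 * norm (diff_comb F L f v k l a b))"
    if f: "\<And>i. norm (f i) \<le> 1" and v: "\<And>j k. norm (v j k) \<le> 1" and
      coord: "\<And>k l a b. \<forall>j<L. k j < l j \<and> l j < N \<Longrightarrow>
         (\<forall>i<F. \<bar>a i\<bar> \<le> 4 * norm (diff_comb F L f v k l a b)) \<and>
         (\<forall>j<L. \<bar>b j\<bar> \<le> 4 * norm (diff_comb F L f v k l a b))" for f :: "nat \<Rightarrow> 'a" and v
  proof -
    obtain k l where kl: "\<forall>j<L. k j < l j \<and> l j < N" and
      *: "\<And>A a b. (\<forall>i<F. \<bar>a i\<bar> \<le> 1) \<Longrightarrow> (\<forall>j<L. \<bar>b j\<bar> \<le> 1) \<Longrightarrow>
          norm (diff_comb F L f v k l a (\<lambda>j. if j \<in> A then b j else 0))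
            \<le> norm (diff_comb F L f v k l a b) + 1 / 4"
      using N[of f v, OF f v] by blast
    have "norm (diff_comb F L f v k l a (\<lambda>j. if j \<in> A then b j else 0))
            \<le> 2 * norm (diff_comb F L f v k l a b)" for A a b
    proof (cases "norm (diff_comb F L f v k l a b) = 0")
      case True
      then have "\<forall>i<F. a i = 0" "\<forall>j<L. b j = 0" using coord[OF kl, of a b] by auto
      then have "diff_comb F L f v k l a (\<lambda>j. if j \<in> A then b j else 0) = 0"
        by (auto simp: diff_comb_def intro!: sum.neutral)
      then show ?thesis by simp
    next
      case False
      define t where "t = 1 / (4 * norm (diff_comb F L f v k l a b))"
      have t0: "t > 0" using False by (simp add: t_def)
      have 1: "\<forall>i<F. \<bar>t * a i\<bar> \<le> 1" "\<forall>j<L. \<bar>t * b j\<bar> \<le> 1"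
        using coord[OF kl, of a b] False t0 by (auto simp: abs_mult t_def field_simps)
      have "(\<lambda>j. if j \<in> A then t * b j else 0) = (\<lambda>j. t * (if j \<in> A then b j else 0))" by auto
      then have "t * norm (diff_comb F L f v k l a (\<lambda>j. if j \<in> A then b j else 0))
            \<le> t * norm (diff_comb F L f v k l a b) + 1 / 4"
        using *[OF 1, of A] t0 by (simp add: diff_comb_scale)
      also have "\<dots> = t * (2 * norm (diff_comb F L f v k l a b))"
        using False by (simp add: t_def)
      finally show ?thesis using t0 by (simp add: mult_le_cancel_left)
    qed
    then show ?thesis using kl by blast
  qed
  then show thesis using that by blast
qed

section \<open>What the vector player can force\<close>

text \<open>
  A winning strategy of the vector player with its quantifiers unfolded, for the remaining \<open>k\<close> moves
  after the history \<open>xs\<close>.  In this form it is easy to run several strategies inside one game, and to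
  pass from a strategy to its blocks.
\<close>

primrec forces ::
    "'a::real_normed_vector set set \<Rightarrow> nat \<Rightarrow> ('a list \<Rightarrow> bool) \<Rightarrow> 'a list \<Rightarrow> bool" where
  "forces B 0 Q xs \<longleftrightarrow> Q xs"
| "forces B (Suc k) Q xs \<longleftrightarrow> (\<forall>Z\<in>B. \<exists>x\<in>Z \<inter> sphere 0 1. forces B k Q (xs @ [x]))"

lemma forces_mono:
  assumes "forces B k Q xs" "\<And>zs. length zs = k \<Longrightarrow> Q (xs @ zs) \<Longrightarrow> Q' (xs @ zs)"
  shows "forces B k Q' xs"
  using assms
proof (induction k arbitrary: xs)
  case 0
  then show ?case using "0.prems"(2)[of "[]"] by simp
next
  case (Suc k)
  show ?case unfolding forces.simps
  proof
    fix Z assume "Z \<in> B"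
    then obtain x where x: "x \<in> Z \<inter> sphere 0 1" "forces B k Q (xs @ [x])" using Suc.prems(1) by auto
    have "forces B k Q' (xs @ [x])"
    proof (rule Suc.IH[OF x(2)])
      fix zs assume "length zs = k" "Q ((xs @ [x]) @ zs)"
      then show "Q' ((xs @ [x]) @ zs)" using Suc.prems(2)[of "x # zs"] by simp
    qed
    then show "\<exists>x\<in>Z \<inter> sphere 0 1. forces B k Q' (xs @ [x])" using x(1) by blast
  qed
qed

lemma forces_play:
  assumes "forces B k Q xs" "\<And>h. \<zeta> h \<in> B"
  shows "\<exists>zs. length zs = k \<and> Q (xs @ zs) \<and>
           (\<forall>t<k. zs ! t \<in> \<zeta> (xs @ take t zs) \<and> norm (zs ! t) = 1)"
  using assms(1)
proof (induction k arbitrary: xs)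
  case 0
  then show ?case by simp
next
  case (Suc k)
  then obtain x where x: "x \<in> \<zeta> xs \<inter> sphere 0 1" "forces B k Q (xs @ [x])"
    using assms(2)[of xs] by auto
  from Suc.IH[OF x(2)] obtain zs where zs: "length zs = k" "Q ((xs @ [x]) @ zs)"
    "\<forall>t<k. zs ! t \<in> \<zeta> ((xs @ [x]) @ take t zs) \<and> norm (zs ! t) = 1" by blast
  show ?case
  proof (intro exI[of _ "x # zs"] conjI allI impI)
    fix t assume t: "t < Suc k"
    show "(x # zs) ! t \<in> \<zeta> (xs @ take t (x # zs))" "norm ((x # zs) ! t) = 1"
      using x(1) zs(3) t by (cases t; simp)+
  qed (use zs in simp_all)
qed

lemma forces_imp_outcome:
  assumes "forces B k Q xs" "B \<noteq> {}"
  shows "\<exists>zs. length zs = k \<and> Q (xs @ zs)"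
proof -
  obtain Z where "Z \<in> B" using assms(2) by blast
  then show ?thesis using forces_play[OF assms(1), of "\<lambda>_. Z"] by blast
qed

lemma forces_segment:
  assumes "forces B (k + m) Q xs" "Z \<in> B"
  shows "\<exists>zs. length zs = k \<and> set zs \<subseteq> Z \<inter> sphere 0 1 \<and> forces B m Q (xs @ zs)"
  using assms(1)
proof (induction k arbitrary: xs)
  case 0
  then show ?case by simp
next
  case (Suc k)
  then obtain x where x: "x \<in> Z \<inter> sphere 0 1" "forces B (k + m) Q (xs @ [x])"
    using assms(2) by auto
  from Suc.IH[OF x(2)] obtain zs where "length zs = k" "set zs \<subseteq> Z \<inter> sphere 0 1"
    "forces B m Q ((xs @ [x]) @ zs)" by blast
  then show ?case using x(1) by (intro exI[of _ "x # zs"]) auto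
qed

text \<open>
  For the \<open>j\<close>-th move of the shorter game, the subspace \<open>Z\<close> offered is used for all moves
  \<open>s j, \<dots>, s (j + 1) - 1\<close> of the longer game; the combination of the answers lies again in \<open>Z\<close>.
  It is nonzero because the longer game can always be completed.
\<close>

lemma forces_blocks:
  fixes B :: "'a::real_normed_vector set set"
  assumes Q: "forces B N Q []" and s: "\<And>j. j < m \<Longrightarrow> s j \<le> s (Suc j)" "s m \<le> N"
    and nz: "\<And>xs j. length xs = N \<Longrightarrow> Q xs \<Longrightarrow> j < m \<Longrightarrow> (\<Sum>i\<in>{s j..<s (Suc j)}. c i *\<^sub>R xs ! i) \<noteq> 0"
    and sub: "\<And>Z. Z \<in> B \<Longrightarrow> subspace Z" and ne: "B \<noteq> {}"
  shows "forces B m (\<lambda>ys. \<exists>xs. length xs = N \<and> Q xs \<and>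
            (\<forall>j<m. ys ! j = sgn (\<Sum>i\<in>{s j..<s (Suc j)}. c i *\<^sub>R xs ! i))) []"
proof -
  define b where "b xs j = (\<Sum>i\<in>{s j..<s (Suc j)}. c i *\<^sub>R xs ! i)" for xs :: "'a list" and j
  have sle: "s i \<le> s j" if "i \<le> j" "j \<le> m" for i j
    using that by (induction j rule: dec_induct) (auto intro: order_trans[OF _ s(1)])
  have b_append: "b (xs @ zs) j = b xs j" if "s (Suc j) \<le> length xs" for xs zs j
    unfolding b_def using that by (intro sum.cong) (auto simp: nth_append)
  let ?Q = "\<lambda>ys. \<exists>xs. length xs = N \<and> Q xs \<and> (\<forall>j<m. ys ! j = sgn (b xs j))"
  have main: "forces B d ?Q ys"
    if "d = m - j" "j \<le> m" "length xs = s j" "length ys = j" "\<forall>i<j. ys ! i = sgn (b xs i)"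
      "forces B (N - s j) Q xs" for d j xs ys
    using that
  proof (induction d arbitrary: j xs ys)
    case 0
    then have jm: "j = m" by simp
    obtain zs where zs: "length zs = N - s j" "Q (xs @ zs)"
      using forces_imp_outcome[OF 0(6) ne] by blast
    have "s (Suc i) \<le> length xs" if "i < m" for i
      using that 0(3) jm sle[of "Suc i" m] by simp
    then have "\<forall>i<m. ys ! i = sgn (b (xs @ zs) i)" using 0(5) jm b_append by auto
    moreover have "length (xs @ zs) = N" using zs 0(3) s(2) jm by simp
    ultimately have "?Q ys" using zs(2) by (intro exI[of _ "xs @ zs"]) auto
    then show ?case by simp
  next
    case (Suc d)
    then have jm: "j < m" by simp
    have d: "d = m - Suc j" using Suc.prems(1) by simp
    have ssj: "s (Suc j) \<le> N" using sle[of "Suc j" m] jm s(2) by simp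
    have e: "N - s j = (s (Suc j) - s j) + (N - s (Suc j))"
      using s(1)[OF jm] ssj by simp
    show ?case unfolding forces.simps
    proof
      fix Z assume Z: "Z \<in> B"
      from forces_segment[OF Suc.prems(6)[unfolded e] Z] obtain zs where zs:
        "length zs = s (Suc j) - s j" "set zs \<subseteq> Z \<inter> sphere 0 1" "forces B (N - s (Suc j)) Q (xs @ zs)" by blast
      have len: "length (xs @ zs) = s (Suc j)" using zs(1) Suc.prems(3) s(1)[OF jm] by simp
      let ?b = "b (xs @ zs) j"
      obtain ws where ws: "length ws = N - s (Suc j)" "Q ((xs @ zs) @ ws)"
        using forces_imp_outcome[OF zs(3) ne] by blast
      have "b ((xs @ zs) @ ws) j \<noteq> 0" unfolding b_def
        by (rule nz) (use ws len ssj jm in auto)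
      then have b0: "?b \<noteq> 0" using b_append[of j "xs @ zs" ws] len by simp
      have "(xs @ zs) ! i \<in> Z" if "i \<in> {s j..<s (Suc j)}" for i
        using that zs(1,2) Suc.prems(3) by (auto simp: nth_append subset_iff)
      then have "?b \<in> Z" unfolding b_def
        by (intro subspace_sum[OF sub[OF Z]] subspace_scale[OF sub[OF Z]])
      then have 1: "sgn ?b \<in> Z \<inter> sphere 0 1"
        using b0 by (simp add: sgn_div_norm subspace_scale[OF sub[OF Z]])
      have "forces B d ?Q (ys @ [sgn ?b])"
      proof (rule Suc.IH[OF d _ len])
        show "Suc j \<le> m" using jm by simp
        show "length (ys @ [sgn ?b]) = Suc j" using Suc.prems(4) by simp
        have "s (Suc i) \<le> length xs" if "i < j" for i
          using that Suc.prems(3) jm sle[of "Suc i" j] by simp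
        then show "\<forall>i<Suc j. (ys @ [sgn ?b]) ! i = sgn (b (xs @ zs) i)"
          using Suc.prems(4,5) b_append by (auto simp: less_Suc_eq nth_append)
        show "forces B (N - s (Suc j)) Q (xs @ zs)" by (rule zs(3))
      qed
      then show "\<exists>x\<in>Z \<inter> sphere 0 1. forces B d ?Q (ys @ [x])" using 1 by blast
    qed
  qed
  obtain Z where Z: "Z \<in> B" using ne by blast
  have "s 0 \<le> N" using sle[of 0 m] s(2) by simp
  then have "forces B (s 0 + (N - s 0)) Q []" using Q by simp
  from forces_segment[OF this Z] obtain zs where "length zs = s 0" "forces B (N - s 0) Q zs" by auto
  then have "forces B m ?Q []" by (intro main[of m 0 zs]) auto
  then show ?thesis by (simp add: b_def)
qed

lemma nths_append_single:
  "nths (ys @ [x]) A = nths ys A @ (if length ys \<in> A then [x] else [])"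
  by (simp add: nths_append nths_singleton)

lemma nths_image_strict_mono:
  assumes "\<And>i j. i < j \<Longrightarrow> j < n \<Longrightarrow> p i < p j" "\<And>i. i < n \<Longrightarrow> p i < length ys"
  shows "nths ys (p ` {..<n}) = map (\<lambda>i. ys ! p i) [0..<n]"
proof -
  have 1: "nths ys I = map ((!) ys) (filter (\<lambda>i. i \<in> I) [0..<length ys])" for I
  proof (induction ys rule: rev_induct)
    case Nil
    then show ?case by simp
  next
    case (snoc y ys)
    have "map ((!) (ys @ [y])) (filter (\<lambda>i. i \<in> I) [0..<length ys]) = map ((!) ys) (filter (\<lambda>i. i \<in> I) [0..<length ys])"
      by (auto simp: nth_append)
    then show ?case using snoc by (simp add: nths_append_single)
  qed
  have "filter (\<lambda>i. i \<in> p ` {..<n}) [0..<length ys] = map p [0..<n]"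
  proof (rule sorted_distinct_set_unique)
    have "sorted_wrt (<) (map p [0..<n])" using assms(1) by (auto simp: sorted_wrt_iff_nth_less)
    then show "sorted (map p [0..<n])" "distinct (map p [0..<n])" using strict_sorted_iff by blast+
    show "set (filter (\<lambda>i. i \<in> p ` {..<n}) [0..<length ys]) = set (map p [0..<n])"
      using assms(2) by auto
  qed (simp_all add: sorted_wrt_filter)
  then show ?thesis by (simp add: 1)
qed

text \<open>
  The positions in \<open>A1\<close> and \<open>A2\<close> are played by two independent strategies, each of which sees only the
  subspaces offered at its own positions; arbitrary unit vectors are played elsewhere.
\<close>

lemma forces_interleave_aux:
  assumes "A1 \<inter> A2 = {}" "\<And>Z. Z \<in> B \<Longrightarrow> Z \<inter> sphere 0 1 \<noteq> {}"
    and "length ys \<le> T"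
    and "forces B (card (A1 \<inter> {length ys..<T})) Q1 (nths ys A1)"
    and "forces B (card (A2 \<inter> {length ys..<T})) Q2 (nths ys A2)"
  shows "forces B (T - length ys) (\<lambda>ys. Q1 (nths ys A1) \<and> Q2 (nths ys A2)) ys"
  using assms(3-5)
proof (induction "T - length ys" arbitrary: ys)
  case 0
  then show ?case by simp
next
  case (Suc d)
  let ?n = "length ys"
  have n: "?n < T" using Suc.hyps(2) by simp
  have card_in: "card (A \<inter> {?n..<T}) = Suc (card (A \<inter> {Suc ?n..<T}))" if "?n \<in> A" for A
  proof -
    have "A \<inter> {?n..<T} = insert ?n (A \<inter> {Suc ?n..<T})" using that n by auto
    then show ?thesis by simp
  qed
  have card_out: "card (A \<inter> {?n..<T}) = card (A \<inter> {Suc ?n..<T})" if "?n \<notin> A" for A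
  proof -
    have "A \<inter> {?n..<T} = A \<inter> {Suc ?n..<T}" using that n by (auto simp: Suc_le_eq order_le_less)
    then show ?thesis by simp
  qed
  have step: "forces B (T - Suc ?n) (\<lambda>ys. Q1 (nths ys A1) \<and> Q2 (nths ys A2)) (ys @ [x])"
    if "forces B (card (A1 \<inter> {Suc ?n..<T})) Q1 (nths (ys @ [x]) A1)"
       "forces B (card (A2 \<inter> {Suc ?n..<T})) Q2 (nths (ys @ [x]) A2)" for x
    using Suc.hyps(1)[of "ys @ [x]"] Suc.hyps(2) that n by simp
  have "forces B (Suc (T - Suc ?n)) (\<lambda>ys. Q1 (nths ys A1) \<and> Q2 (nths ys A2)) ys"
    unfolding forces.simps
  proof
    fix Z assume Z: "Z \<in> B"
    consider "?n \<in> A1" "?n \<notin> A2" | "?n \<in> A2" "?n \<notin> A1" | "?n \<notin> A1" "?n \<notin> A2" using assms(1) by blast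
    then show "\<exists>x\<in>Z \<inter> sphere 0 1. forces B (T - Suc ?n) (\<lambda>ys. Q1 (nths ys A1) \<and> Q2 (nths ys A2)) (ys @ [x])"
    proof cases
      case 1
      then obtain x where "x \<in> Z \<inter> sphere 0 1" "forces B (card (A1 \<inter> {Suc ?n..<T})) Q1 (nths ys A1 @ [x])"
        using Suc.prems(2) Z card_in[of A1] by auto
      then show ?thesis using Suc.prems(3) card_out[of A2] 1
        by (intro bexI[of _ x] step) (auto simp: nths_append_single)
    next
      case 2
      then obtain x where "x \<in> Z \<inter> sphere 0 1" "forces B (card (A2 \<inter> {Suc ?n..<T})) Q2 (nths ys A2 @ [x])"
        using Suc.prems(3) Z card_in[of A2] by auto
      then show ?thesis using Suc.prems(2) card_out[of A1] 2
        by (intro bexI[of _ x] step) (auto simp: nths_append_single)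
    next
      case 3
      obtain x where "x \<in> Z \<inter> sphere 0 1" using assms(2)[OF Z] by blast
      then show ?thesis using Suc.prems(2,3) card_out 3
        by (intro bexI[of _ x] step) (auto simp: nths_append_single)
    qed
  qed
  then show ?case using n by (simp add: Suc_diff_Suc)
qed

lemma forces_interleave:
  fixes B :: "'a::real_normed_vector set set"
  assumes Q1: "forces B n1 Q1 []" and Q2: "forces B n2 Q2 []"
    and ne: "\<And>Z. Z \<in> B \<Longrightarrow> Z \<inter> sphere 0 1 \<noteq> {}"
    and p1: "\<And>i j. i < j \<Longrightarrow> j < n1 \<Longrightarrow> p1 i < p1 j" "\<And>i. i < n1 \<Longrightarrow> p1 i < T"
    and p2: "\<And>i j. i < j \<Longrightarrow> j < n2 \<Longrightarrow> p2 i < p2 j" "\<And>i. i < n2 \<Longrightarrow> p2 i < T"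
    and disj: "p1 ` {..<n1} \<inter> p2 ` {..<n2} = {}"
  shows "forces B T (\<lambda>ys. Q1 (map (\<lambda>i. ys ! p1 i) [0..<n1]) \<and> Q2 (map (\<lambda>i. ys ! p2 i) [0..<n2])) []"
proof -
  have card: "card (p ` {..<n} \<inter> {0..<T}) = n"
    if "\<And>i j. i < j \<Longrightarrow> j < n \<Longrightarrow> p i < p j" "\<And>i. i < n \<Longrightarrow> p i < T" for p :: "nat \<Rightarrow> nat" and n
  proof -
    have "p ` {..<n} \<inter> {0..<T} = p ` {..<n}" using that by auto
    moreover have "inj_on p {..<n}"
      by (rule inj_onI) (metis lessThan_iff linorder_neqE_nat order_less_irrefl that(1))
    ultimately show ?thesis by (simp add: card_image)
  qed
  have "forces B T (\<lambda>ys. Q1 (nths ys (p1 ` {..<n1})) \<and> Q2 (nths ys (p2 ` {..<n2}))) []"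
    using forces_interleave_aux[OF disj ne, where ys="[]" and T=T and B=B and ?Q1.0=Q1 and ?Q2.0=Q2]
      Q1 Q2 card[OF p1] card[OF p2] by auto
  then show ?thesis
  proof (rule forces_mono)
    fix zs :: "'a list"
    assume zs: "length zs = T" "Q1 (nths ([] @ zs) (p1 ` {..<n1})) \<and> Q2 (nths ([] @ zs) (p2 ` {..<n2}))"
    have "nths zs (p1 ` {..<n1}) = map (\<lambda>i. zs ! p1 i) [0..<n1]"
      by (rule nths_image_strict_mono) (use p1 zs(1) in auto)
    moreover have "nths zs (p2 ` {..<n2}) = map (\<lambda>i. zs ! p2 i) [0..<n2]"
      by (rule nths_image_strict_mono) (use p2 zs(1) in auto)
    ultimately show "Q1 (map (\<lambda>i. ([] @ zs) ! p1 i) [0..<n1]) \<and> Q2 (map (\<lambda>i. ([] @ zs) ! p2 i) [0..<n2])"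
      using zs(2) by simp
  qed
qed

lemma two_equivalent_cong:
  "(\<And>i. i < n \<Longrightarrow> x i = y i) \<Longrightarrow> two_equivalent n E x = two_equivalent n E y"
  by (simp add: two_equivalent_def)

text \<open>
  Any partial play of a winning strategy can be completed, so each single answer is a unit vector of
  the subspace offered.  For \<open>\<epsilon> = 1\<close> the outcome has distance at most \<open>2\<close> from \<open>E\<close>.
\<close>

lemma asymptotic_space_forces:
  assumes E: "E \<in> asymptotic_spaces B n" and n: "n \<ge> 1"
  shows "forces B n (\<lambda>xs. two_equivalent n E ((!) xs)) []"
proof -
  have EM: "E \<in> M_space n" using E by (simp add: asymptotic_spaces_def)
  obtain \<tau> where \<tau>: "V_winning_strategy B n E 1 \<tau>"
    proof -
    have "\<forall>\<epsilon>>0. \<exists>\<tau>. V_winning_strategy B n E \<epsilon> \<tau>"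
      using E by (simp add: asymptotic_spaces_def)
    then have "\<exists>\<tau>. V_winning_strategy B n E 1 \<tau>" by simp
    then show thesis using that by blast
  qed
  define xx where "xx Z k = \<tau> (map Z [0..<Suc k])" for Z :: "nat \<Rightarrow> 'a set" and k
  have adm: "admissible_move (Z k) (xx Z) k" and eqv: "equivalent_to_basis 2 n (xx Z) E"
    if "\<forall>k<n. Z k \<in> B" "k < n" for Z k
    using \<tau> that unfolding V_winning_strategy_def xx_def by (auto simp: Let_def)
  let ?Q = "\<lambda>xs. two_equivalent n E ((!) xs)"
  have main: "forces B d ?Q (map (\<lambda>i. \<tau> (take (Suc i) Zs)) [0..<length Zs])"
    if "d = n - length Zs" "length Zs \<le> n" "set Zs \<subseteq> B" for d Zs
    using that
  proof (induction d arbitrary: Zs)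
    case 0
    then have len: "length Zs = n" by simp
    have Z: "\<forall>k<n. Zs ! k \<in> B" using 0 len by (auto simp: subset_iff)
    have xx: "xx ((!) Zs) k = \<tau> (take (Suc k) Zs)" if "k < n" for k
      proof -
      have "map ((!) Zs) [0..<Suc k] = take (Suc k) Zs"
        using that len by (intro nth_equalityI) (auto simp del: upt_Suc)
      then show ?thesis unfolding xx_def by simp
    qed
    have a: "admissible_move (Zs ! (n - 1)) (xx ((!) Zs)) (n - 1)"
      by (rule adm[OF Z]) (use n in auto)
    have "two_equivalent n E (xx ((!) Zs))"
    proof (rule equivalent_to_basis_imp_two_equivalent[OF EM n])
      show "inj_on (xx ((!) Zs)) {..<n}" "independent (xx ((!) Zs) ` {..<n})"
        using a n by (auto simp: admissible_move_def basic_seq_le_def)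
      show "norm (xx ((!) Zs) 0) = 1" using adm[OF Z, of 0] n by (auto simp: admissible_move_def)
      show "equivalent_to_basis 2 n (xx ((!) Zs)) E" using eqv[OF Z, of 0] n by auto
    qed
    then have "?Q (map (\<lambda>i. \<tau> (take (Suc i) Zs)) [0..<length Zs])"
      by (subst two_equivalent_cong[where y="xx ((!) Zs)"]) (simp_all add: xx len)
    then show ?case by simp
  next
    case (Suc d)
    show ?case unfolding forces.simps
    proof
      fix Z assume Z: "Z \<in> B"
      let ?Zs = "Zs @ [Z]"
      have len: "length Zs < n" using Suc.prems(1) by simp
      define Z' where "Z' k = (if k < length ?Zs then ?Zs ! k else Z)" for k
      have Z'B: "\<forall>k<n. Z' k \<in> B" using Z Suc.prems(3) by (auto simp: Z'_def nth_append subset_iff)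
      have "map Z' [0..<Suc (length Zs)] = ?Zs"
        by (rule nth_equalityI) (auto simp: Z'_def nth_append simp del: upt_Suc)
      then have "xx Z' (length Zs) = \<tau> ?Zs" by (simp add: xx_def)
      moreover have "Z' (length Zs) = Z" by (simp add: Z'_def)
      ultimately have mem: "\<tau> ?Zs \<in> Z \<inter> sphere 0 1"
        using adm[OF Z'B len] by (simp add: admissible_move_def)
      have 1: "forces B d ?Q (map (\<lambda>i. \<tau> (take (Suc i) ?Zs)) [0..<length ?Zs])"
        by (rule Suc.IH) (use Suc.prems len Z in auto)
      have 2: "map (\<lambda>i. \<tau> (take (Suc i) ?Zs)) [0..<length ?Zs] =
          map (\<lambda>i. \<tau> (take (Suc i) Zs)) [0..<length Zs] @ [\<tau> ?Zs]" by simp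
      show "\<exists>x\<in>Z \<inter> sphere 0 1. forces B d ?Q (map (\<lambda>i. \<tau> (take (Suc i) Zs)) [0..<length Zs] @ [x])"
        using 1[unfolded 2] mem by (rule bexI)
    qed
  qed
  show ?thesis using main[of n "[]"] by simp
qed

section \<open>Bases, tails and finite codimension\<close>

lemma subspace_closure:
  fixes S :: "'a::real_normed_vector set"
  assumes S: "subspace S"
  shows "subspace (closure S)"
  unfolding subspace_def
proof (intro conjI ballI allI)
  show "0 \<in> closure S" using S closure_subset subspace_0 by blast
next
  fix x y assume "x \<in> closure S" "y \<in> closure S"
  then obtain f g where fg: "\<And>n. f n \<in> S" "f \<longlonglongrightarrow> x" "\<And>n. g n \<in> S" "g \<longlonglongrightarrow> y"
    unfolding closure_sequential by blast
  have "(\<lambda>n. f n + g n) \<longlonglongrightarrow> x + y" by (intro tendsto_add fg)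
  then show "x + y \<in> closure S"
    unfolding closure_sequential using fg subspace_add[OF S] by (intro exI[of _ "\<lambda>n. f n + g n"]) auto
next
  fix c :: real and x assume "x \<in> closure S"
  then obtain f where f: "\<And>n. f n \<in> S" "f \<longlonglongrightarrow> x"
    unfolding closure_sequential by blast
  have "(\<lambda>n. c *\<^sub>R f n) \<longlonglongrightarrow> c *\<^sub>R x" by (intro tendsto_intros f)
  then show "c *\<^sub>R x \<in> closure S"
    unfolding closure_sequential using f subspace_scale[OF S] by (intro exI[of _ "\<lambda>n. c *\<^sub>R f n"]) auto
qed

locale biorthogonal_basis =
  fixes u :: "nat \<Rightarrow> 'a::banach" and us :: "nat \<Rightarrow> 'a \<Rightarrow>\<^sub>L real"
  assumes basis: "schauder_basis u" and biorth: "biorthogonal u us"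
begin

definition part :: "nat \<Rightarrow> 'a \<Rightarrow> 'a" where
  "part m y = (\<Sum>i<m. blinfun_apply (us i) y *\<^sub>R u i)"

definition tail :: "nat \<Rightarrow> 'a set" where
  "tail m = closure (span (u ` {m..}))"

lemma us_u: "blinfun_apply (us i) (u j) = (if i = j then 1 else 0)"
  using biorth by (simp add: biorthogonal_def)

lemma part_tendsto: "(\<lambda>m. part m y) \<longlonglongrightarrow> y"
proof -
  obtain a where a: "(\<lambda>i. a i *\<^sub>R u i) sums y" using basis unfolding schauder_basis_def by metis
  have "blinfun_apply (us i) y = a i" for i
  proof -
    have "(\<lambda>k. blinfun_apply (us i) (a k *\<^sub>R u k)) sums blinfun_apply (us i) y"
      by (rule bounded_linear.sums[OF blinfun.bounded_linear_right a])
    moreover have "(\<lambda>k. blinfun_apply (us i) (a k *\<^sub>R u k)) = (\<lambda>k. if k = i then a k else 0)"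
      by (auto simp: blinfun.scaleR_right us_u)
    ultimately show ?thesis using sums_single[of i a] sums_unique2 by metis
  qed
  then show ?thesis using a by (simp add: part_def sums_def)
qed

lemma part_sum: "part m (\<Sum>i\<in>I. c i *\<^sub>R y i) = (\<Sum>i\<in>I. c i *\<^sub>R part m (y i))"
  unfolding part_def
  by (simp add: blinfun.sum_right blinfun.scaleR_right scaleR_sum_left scaleR_sum_right sum.swap[of _ "{..<m}"])

lemma tail_subspace: "subspace (tail m)"
  unfolding tail_def by (intro subspace_closure subspace_span)

lemma tail_closed: "closed (tail m)"
  by (simp add: tail_def)

lemma tail_antimono: "m \<le> m' \<Longrightarrow> tail m' \<subseteq> tail m"
  unfolding tail_def by (intro closure_mono span_mono) auto

lemma us_tail:
  assumes "y \<in> tail m" "i < m"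
  shows "blinfun_apply (us i) y = 0"
proof -
  let ?K = "{y. blinfun_apply (us i) y = 0}"
  have sub: "subspace ?K"
    by (auto simp: subspace_def blinfun.add_right blinfun.scaleR_right)
  have "closed ?K"
    by (intro closed_Collect_eq continuous_intros)
  moreover have "span (u ` {m..}) \<subseteq> ?K"
    by (rule span_minimal[OF _ sub]) (use assms(2) us_u in auto)
  ultimately have "tail m \<subseteq> ?K" unfolding tail_def by (rule closure_minimal[rotated])
  then show ?thesis using assms(1) by auto
qed

lemma diff_part_in_tail: "y - part m y \<in> tail m"
proof -
  have "(\<lambda>k. part k y - part m y) \<longlonglongrightarrow> y - part m y"
    by (intro tendsto_intros part_tendsto)
  moreover have "part k y - part m y \<in> tail m" if "k \<ge> m" for k
  proof -
    have "part k y - part m y = (\<Sum>i\<in>{m..<k}. blinfun_apply (us i) y *\<^sub>R u i)"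
      unfolding part_def using that
      by (simp add: sum_diff_nat_ivl lessThan_atLeast0)
    also have "\<dots> \<in> span (u ` {m..})"
      by (intro span_sum span_scale span_base) auto
    finally show ?thesis unfolding tail_def using closure_subset by blast
  qed
  then have "\<forall>\<^sub>F k in sequentially. part k y - part m y \<in> tail m"
    using eventually_sequentially by blast
  ultimately show ?thesis
    by (rule Lim_in_closed_set[OF tail_closed _ sequentially_bot, rotated])
qed

text \<open>
  By biorthogonality, the coefficient of \<open>g\<close> at \<open>us j\<close> is the value of \<open>g\<close> at \<open>u j\<close>.
\<close>

lemma finitely_supported_functional:
  assumes g: "g \<in> span (range us)"
  shows "functional_supp us g = {j. blinfun_apply g (u j) \<noteq> 0}"
    and "finite {j. blinfun_apply g (u j) \<noteq> 0}"
    and "blinfun_apply g y = (\<Sum>j | blinfun_apply g (u j) \<noteq> 0. blinfun_apply g (u j) * blinfun_apply (us j) y)"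
proof -
  have inj: "inj us"
  proof (rule injI)
    fix i j assume "us i = us j"
    then have "blinfun_apply (us i) (u i) = blinfun_apply (us j) (u i)" by simp
    then show "i = j" by (simp add: us_u split: if_splits)
  qed
  have ind: "independent (range us)"
  proof
    assume "dependent (range us)"
    then obtain t r v where t: "finite t" "t \<subseteq> range us" "(\<Sum>a\<in>t. r a *\<^sub>R a) = 0" "v \<in> t" "r v \<noteq> 0"
      unfolding dependent_explicit by blast
    then obtain i where i: "v = us i" by auto
    have "0 = blinfun_apply (\<Sum>a\<in>t. r a *\<^sub>R a) (u i)" using t(3) by simp
    also have "\<dots> = (\<Sum>a\<in>t. r a * blinfun_apply a (u i))"
      by (simp add: blinfun.sum_left blinfun.scaleR_left)
    also have "\<dots> = (\<Sum>a\<in>t. if a = v then r v else 0)"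
    proof (rule sum.cong[OF refl])
      fix a assume "a \<in> t"
      then obtain j where j: "a = us j" using t(2) by auto
      show "r a * blinfun_apply a (u i) = (if a = v then r v else 0)"
        using j i inj by (auto simp: us_u inj_eq)
    qed
    also have "\<dots> = r v" using t by simp
    finally show False using t(5) by simp
  qed
  define r where "r = representation (range us) g"
  define J where "J = {j. r (us j) \<noteq> 0}"
  have bset: "{b. r b \<noteq> 0} = us ` J"
    unfolding J_def r_def using representation_ne_zero by fastforce
  have "finite {b. r b \<noteq> 0}" unfolding r_def by (rule finite_representation)
  then have finJ: "finite J" unfolding bset using inj finite_imageD inj_on_subset by blast
  have "g = (\<Sum>b | r b \<noteq> 0. r b *\<^sub>R b)"
    unfolding r_def using sum_nonzero_representation_eq[OF ind g] by simp
  also have "\<dots> = (\<Sum>j\<in>J. r (us j) *\<^sub>R us j)"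
    unfolding bset using inj by (subst sum.reindex) (auto intro: inj_on_subset)
  finally have geq: "g = (\<Sum>j\<in>J. r (us j) *\<^sub>R us j)" .
  have gy: "blinfun_apply g y = (\<Sum>j\<in>J. r (us j) * blinfun_apply (us j) y)" for y
    by (subst geq) (simp add: blinfun.sum_left blinfun.scaleR_left)
  have gu: "blinfun_apply g (u k) = r (us k)" for k
  proof -
    have "blinfun_apply g (u k) = (\<Sum>j\<in>J. if j = k then r (us k) else 0)"
      unfolding gy by (intro sum.cong) (auto simp: us_u)
    also have "\<dots> = r (us k)" using finJ by (auto simp: J_def)
    finally show ?thesis .
  qed
  have J: "J = {j. blinfun_apply g (u j) \<noteq> 0}" by (simp add: J_def gu)
  show "functional_supp us g = {j. blinfun_apply g (u j) \<noteq> 0}"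
    unfolding functional_supp_def gu r_def by simp
  show "finite {j. blinfun_apply g (u j) \<noteq> 0}" using finJ J by simp
  show "blinfun_apply g y = (\<Sum>j | blinfun_apply g (u j) \<noteq> 0. blinfun_apply g (u j) * blinfun_apply (us j) y)"
    proof -
    have "(\<Sum>j | blinfun_apply g (u j) \<noteq> 0. blinfun_apply g (u j) * blinfun_apply (us j) y)
        = (\<Sum>j\<in>J. blinfun_apply g (u j) * blinfun_apply (us j) y)" by (simp only: J)
    then show ?thesis by (simp only: gu gy[of y])
  qed
qed

end

text \<open>
  If \<open>Z'\<close> has finite codimension in the whole space, then \<open>Z \<inter> Z'\<close> has finite codimension in \<open>Z\<close>.  In
  the induction, one more vector \<open>f\<close> enlarges \<open>Z \<inter> Z'\<close> by at most one dimension.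
\<close>

lemma finite_codim_inter_relative:
  assumes "finite F" "subspace Z" "subspace Z'" "span (Z' \<union> F) = UNIV"
  shows "\<exists>G. finite G \<and> Z \<subseteq> span ((Z \<inter> Z') \<union> G)"
  using assms(1,3,4)
proof (induction F arbitrary: Z' rule: finite_induct)
  case empty
  then have "Z' = UNIV" using span_eq_iff by (metis sup_bot_right)
  then show ?case by (intro exI[of _ "{}"]) (auto intro: span_base)
next
  case (insert f F)
  let ?W = "span (insert f Z')"
  have "Z' \<union> insert f F \<subseteq> ?W \<union> F" by (auto intro: span_base)
  then have "span (?W \<union> F) = UNIV" using insert.prems(2) span_mono by blast
  from insert.IH[OF subspace_span this] obtain G where G: "finite G" "Z \<subseteq> span ((Z \<inter> ?W) \<union> G)" by blast
  have W: "w \<in> ?W \<longleftrightarrow> (\<exists>k. w - k *\<^sub>R f \<in> Z')" for w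
    using span_breakdown_eq[of w f Z'] span_eq_iff[THEN iffD2, OF insert.prems(1)] by simp
  obtain g where g: "Z \<inter> ?W \<subseteq> span (insert g (Z \<inter> Z'))"
  proof (cases "Z \<inter> ?W \<subseteq> Z'")
    case True
    then show ?thesis using that[of 0] by (auto intro: span_base)
  next
    case False
    then obtain g where "g \<in> Z" "g \<in> ?W" "g \<notin> Z'" by blast
    then obtain k where g: "g \<in> Z" "g - k *\<^sub>R f \<in> Z'" "g \<notin> Z'" using W by blast
    have k: "k \<noteq> 0" using g by auto
    have "h \<in> span (insert g (Z \<inter> Z'))" if h: "h \<in> Z" "h \<in> ?W" for h
    proof -
      obtain l where l: "h - l *\<^sub>R f \<in> Z'" using h(2) W by auto
      have 1: "h - (l / k) *\<^sub>R g \<in> Z" using h(1) g(1) assms(2) by (simp add: subspace_diff subspace_scale)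
      have eq: "h - (l / k) *\<^sub>R g = (h - l *\<^sub>R f) - (l / k) *\<^sub>R (g - k *\<^sub>R f)"
        using k by (simp add: scaleR_diff_right)
      have 2: "h - (l / k) *\<^sub>R g \<in> Z'"
        unfolding eq by (intro subspace_diff subspace_scale insert.prems(1) l g(2))
      have "h - (l / k) *\<^sub>R g \<in> span (Z \<inter> Z')" by (intro span_base IntI 1 2)
      then show ?thesis unfolding span_breakdown_eq by blast
    qed
    then show ?thesis using that by blast
  qed
  have "(Z \<inter> ?W) \<union> G \<subseteq> span ((Z \<inter> Z') \<union> insert g G)"
  proof -
    have "span (insert g (Z \<inter> Z')) \<subseteq> span ((Z \<inter> Z') \<union> insert g G)" by (intro span_mono) auto
    moreover have "G \<subseteq> span ((Z \<inter> Z') \<union> insert g G)" by (auto intro: span_base)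
    ultimately show ?thesis using g by blast
  qed
  then have "span ((Z \<inter> ?W) \<union> G) \<subseteq> span ((Z \<inter> Z') \<union> insert g G)"
    by (rule span_minimal) (rule subspace_span)
  then show ?case using G by (intro exI[of _ "insert g G"]) auto
qed

lemma finite_codim_inter:
  assumes "Z \<in> finite_codim_subspaces" "Z' \<in> finite_codim_subspaces"
  shows "Z \<inter> Z' \<in> finite_codim_subspaces"
proof -
  obtain F F' where F: "finite F" "span (Z \<union> F) = UNIV" and F': "finite F'" "span (Z' \<union> F') = UNIV"
    and Z: "subspace Z" "subspace Z'" "closed Z" "closed Z'"
    using assms by (auto simp: finite_codim_subspaces_def)
  obtain G where G: "finite G" "Z \<subseteq> span ((Z \<inter> Z') \<union> G)"
    using finite_codim_inter_relative[OF F'(1) Z(1,2) F'(2)] by blast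
  have "Z \<union> F \<subseteq> span ((Z \<inter> Z') \<union> (G \<union> F))"
  proof -
    have "span ((Z \<inter> Z') \<union> G) \<subseteq> span ((Z \<inter> Z') \<union> (G \<union> F))" by (intro span_mono) auto
    then show ?thesis using G(2) by (auto intro: span_base)
  qed
  then have "span (Z \<union> F) \<subseteq> span ((Z \<inter> Z') \<union> (G \<union> F))" by (rule span_minimal) (rule subspace_span)
  then have "span ((Z \<inter> Z') \<union> (G \<union> F)) = UNIV" using F(2) by auto
  then show ?thesis
    unfolding finite_codim_subspaces_def using Z F(1) G(1)
    by (auto intro!: subspace_inter closed_Int exI[of _ "G \<union> F"])
qed

text \<open>
  The properties shared by the two families of subspaces.  Directedness allows the subspace player
  to meet finitely many requirements at once; since the tails belong to the family, the vectors can
  be kept successive, up to small errors, with respect to the basis.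
\<close>

locale permissible_family = biorthogonal_basis u us
  for u :: "nat \<Rightarrow> 'a::banach" and us +
  fixes B :: "'a set set"
  assumes subspaces: "Z \<in> B \<Longrightarrow> subspace Z"
    and unit_vectors: "Z \<in> B \<Longrightarrow> Z \<inter> sphere 0 1 \<noteq> {}"
    and directed: "Z \<in> B \<Longrightarrow> Z' \<in> B \<Longrightarrow> \<exists>W\<in>B. W \<subseteq> Z \<inter> Z'"
    and tails: "tail m \<in> B"
    and almost_monotone: "almost_monotone_family B"
begin

lemma finite_directed:
  assumes "finite \<Z>" "\<Z> \<subseteq> B"
  shows "\<exists>W\<in>B. \<forall>Z\<in>\<Z>. W \<subseteq> Z"
  using assms
proof (induction rule: finite_induct)
  case empty
  then show ?case using tails by auto
next
  case (insert Z \<Z>)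
  then obtain W where "W \<in> B" "\<forall>Z\<in>\<Z>. W \<subseteq> Z" by auto
  moreover obtain W' where "W' \<in> B" "W' \<subseteq> W \<inter> Z" using directed[of W Z] calculation insert.prems by auto
  ultimately show ?case by (intro bexI[of _ W']) auto
qed

end

lemma (in biorthogonal_basis) u_nonzero: "u i \<noteq> 0"
proof
  assume "u i = 0"
  then have "blinfun_apply (us i) (u i) = 0" by simp
  then show False by (simp add: us_u)
qed

lemma (in biorthogonal_basis) permissible_family_finite_codim_or_tails:
  assumes inf: "\<And>F::'a set. finite F \<Longrightarrow> span F \<noteq> UNIV"
    and family: "B = finite_codim_subspaces \<or> B = tail_subspaces u"
    and standing: "almost_monotone_family B"
  shows "permissible_family u us B"
proof unfold_locales
  fix Z assume Z: "Z \<in> B"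
  show "subspace Z"
    using Z family tail_subspace by (auto simp: finite_codim_subspaces_def tail_subspaces_def tail_def)
  then have sgn_mem: "z \<in> Z \<Longrightarrow> z \<noteq> 0 \<Longrightarrow> sgn z \<in> Z \<inter> sphere 0 1" for z
    by (simp add: sgn_div_norm subspace_scale)
  have "\<exists>z\<in>Z. z \<noteq> 0"
    using family
  proof
    assume "B = finite_codim_subspaces"
    then obtain F where F: "finite F" "span (Z \<union> F) = UNIV"
      using Z by (auto simp: finite_codim_subspaces_def)
    have "\<not> Z \<subseteq> span F"
    proof
      assume "Z \<subseteq> span F"
      then have "Z \<union> F \<subseteq> span F" by (auto intro: span_base)
      then have "span (Z \<union> F) \<subseteq> span F" by (rule span_minimal) (rule subspace_span)
      then show False using F inf by auto
    qed
    then obtain z where z: "z \<in> Z" "z \<notin> span F" by auto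
    then have "z \<noteq> 0" using span_zero[of F] by metis
    then show ?thesis using z(1) by auto
  next
    assume "B = tail_subspaces u"
    then obtain m where "Z = closure (span (u ` {m..}))" using Z by (auto simp: tail_subspaces_def)
    moreover have "u m \<in> span (u ` {m..})" by (intro span_base) auto
    ultimately have "u m \<in> Z" using closure_subset by blast
    then show ?thesis using u_nonzero by blast
  qed
  then show "Z \<inter> sphere 0 1 \<noteq> {}" using sgn_mem by blast
next
  fix Z Z' assume Z: "Z \<in> B" "Z' \<in> B"
  show "\<exists>W\<in>B. W \<subseteq> Z \<inter> Z'"
    using family
  proof
    assume "B = finite_codim_subspaces"
    then show ?thesis using Z finite_codim_inter by blast
  next
    assume B: "B = tail_subspaces u"
    then obtain m m' where m: "Z = tail m" "Z' = tail m'" using Z by (auto simp: tail_subspaces_def tail_def)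
    have "tail (max m m') \<in> B" using B by (auto simp: tail_subspaces_def tail_def)
    moreover have "tail (max m m') \<subseteq> Z \<inter> Z'" using m tail_antimono by simp
    ultimately show ?thesis by blast
  qed
next
  fix m
  show "tail m \<in> B"
    using family
  proof
    assume B: "B = finite_codim_subspaces"
    have "y \<in> span (tail m \<union> u ` {..<m})" for y
    proof -
      have "y - part m y \<in> span (tail m \<union> u ` {..<m})"
        using diff_part_in_tail by (auto intro: span_base)
      moreover have "part m y \<in> span (tail m \<union> u ` {..<m})"
        unfolding part_def by (intro span_sum span_scale span_base) auto
      ultimately have "(y - part m y) + part m y \<in> span (tail m \<union> u ` {..<m})" by (rule span_add)
      then show ?thesis by simp
    qed
    then show ?thesis unfolding B finite_codim_subspaces_def
      using tail_subspace tail_closed by (auto intro!: exI[of _ "u ` {..<m}"])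
  qed (auto simp: tail_subspaces_def tail_def)
qed (rule standing)

section \<open>Playing far enough out\<close>

context permissible_family
begin

text \<open>
  Being the least possible choice, this index is monotone in \<open>Y\<close>.
\<close>

definition rem_index :: "real \<Rightarrow> 'a set \<Rightarrow> nat" where
  "rem_index \<eta> Y = (LEAST m. \<forall>m'\<ge>m. \<forall>y\<in>Y. norm (y - part m' y) \<le> \<eta>)"

lemma rem_index:
  assumes "finite Y" "0 < \<eta>" "m \<ge> rem_index \<eta> Y" "y \<in> Y"
  shows "norm (y - part m y) \<le> \<eta>"
proof -
  have "\<forall>\<^sub>F m in sequentially. \<forall>y\<in>Y. norm (y - part m y) \<le> \<eta>"
    unfolding eventually_ball_finite_distrib[OF assms(1)]
  proof
    fix y assume "y \<in> Y"
    have "\<forall>\<^sub>F m in sequentially. dist (part m y) y < \<eta>"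
      using part_tendsto assms(2) by (rule tendstoD)
    then show "\<forall>\<^sub>F m in sequentially. norm (y - part m y) \<le> \<eta>"
      by eventually_elim (simp add: dist_norm norm_minus_commute)
  qed
  then have "\<exists>m. \<forall>m'\<ge>m. \<forall>y\<in>Y. norm (y - part m' y) \<le> \<eta>" by (simp add: eventually_sequentially)
  then have "\<forall>m'\<ge>rem_index \<eta> Y. \<forall>y\<in>Y. norm (y - part m' y) \<le> \<eta>"
    unfolding rem_index_def by (rule LeastI_ex)
  then show ?thesis using assms(3,4) by blast
qed

lemma rem_index_mono:
  assumes "finite Y'" "0 < \<eta>" "Y \<subseteq> Y'"
  shows "rem_index \<eta> Y \<le> rem_index \<eta> Y'"
  unfolding rem_index_def[of \<eta> Y]
  by (rule Least_le) (use rem_index[OF assms(1,2)] assms(3) in blast)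

text \<open>
  The subspace player answers a history with a subspace that is almost monotone over the span of the
  history, lies in the tail beyond \<open>rem_index\<close>, and is contained in every move prescribed by \<open>\<sigma>\<close> for a
  list of candidates formed from the history.  As there are finitely many such lists, one subspace of
  the family meets all these requirements.  Consequently any later choice of successive candidates is
  a play against \<open>\<sigma>\<close>, although the choice is made only when the long game is over.
\<close>

lemma long_game:
  fixes cand :: "'a set \<Rightarrow> 'a set" and \<sigma> :: "'a list \<Rightarrow> 'a set"
  assumes Q: "forces B T Q []" and \<eta>: "0 < \<eta>"
    and \<sigma>: "\<And>xs. \<sigma> xs \<in> B" and cand: "\<And>Y. finite Y \<Longrightarrow> finite (cand Y)"
  obtains ys and m :: "nat \<Rightarrow> nat" where
    "length ys = T" "Q ys" "\<And>t. t < T \<Longrightarrow> norm (ys ! t) = 1"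
    "\<And>a s t. s \<le> t \<Longrightarrow> t \<le> T \<Longrightarrow>
       norm (\<Sum>i<s. a i *\<^sub>R ys ! i) \<le> 2 * norm (\<Sum>i<t. a i *\<^sub>R ys ! i)"
    "\<And>s t. s \<le> t \<Longrightarrow> m s \<le> m t"
    "\<And>t i. t < T \<Longrightarrow> i < m t \<Longrightarrow> blinfun_apply (us i) (ys ! t) = 0"
    "\<And>t t'. t < t' \<Longrightarrow> t < T \<Longrightarrow> norm (ys ! t - part (m t') (ys ! t)) \<le> \<eta>"
    "\<And>t xs. t < T \<Longrightarrow> set xs \<subseteq> cand (set (take t ys)) \<Longrightarrow> length xs \<le> T \<Longrightarrow> ys ! t \<in> \<sigma> xs"
proof -
  \<comment> \<open>Then \<open>(1 + \<delta>) ^ T \<le> 2\<close>, so the almost monotone steps compose to a basis constant of at most \<open>2\<close>.\<close>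
  define \<delta> where "\<delta> = ln 2 / real (Suc T)"
  have \<delta>: "\<delta> > 0" by (simp add: \<delta>_def)
  have \<delta>T: "(1 + \<delta>) ^ n \<le> 2" if "n \<le> T" for n
  proof -
    have "(1 + \<delta>) ^ n \<le> (1 + \<delta>) ^ Suc T" using that \<delta> by (intro power_increasing) auto
    also have "\<dots> \<le> exp \<delta> ^ Suc T" using \<delta> exp_ge_add_one_self by (intro power_mono) auto
    also have "\<dots> = exp (real (Suc T) * \<delta>)" by (simp only: exp_of_nat_mult)
    also have "\<dots> = 2" by (simp add: \<delta>_def)
    finally show ?thesis .
  qed
  define good where "good Y Z \<longleftrightarrow> Z \<in> B \<and>
      (\<forall>xs. set xs \<subseteq> cand Y \<and> length xs \<le> T \<longrightarrow> Z \<subseteq> \<sigma> xs) \<and> Z \<subseteq> tail (rem_index \<eta> Y) \<and>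
      (\<forall>f\<in>span Y. \<forall>z\<in>Z. norm f \<le> (1 + \<delta>) * norm (f + z))" for Y Z
  have ex: "\<exists>Z. good Y Z" if fin: "finite Y" for Y
  proof -
    obtain Z0 where Z0: "Z0 \<in> B" "\<forall>f\<in>span Y. \<forall>z\<in>Z0. norm f \<le> (1 + \<delta>) * norm (f + z)"
    proof -
      have "\<exists>Z\<in>B. \<forall>f\<in>span Y. \<forall>z\<in>Z. norm f \<le> (1 + \<delta>) * norm (f + z)"
        using almost_monotone \<delta> fin by (simp add: almost_monotone_family_def)
      then show thesis using that by blast
    qed
    let ?X = "{xs. set xs \<subseteq> cand Y \<and> length xs \<le> T}"
    define \<Z> where "\<Z> = insert Z0 (insert (tail (rem_index \<eta> Y)) (\<sigma> ` ?X))"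
    have "finite \<Z>" unfolding \<Z>_def
      using finite_lists_length_le[OF cand[OF fin]] by simp
    moreover have "\<Z> \<subseteq> B"
      using Z0 tails \<sigma> by (auto simp: \<Z>_def)
    ultimately obtain W where W: "W \<in> B" "\<forall>Z\<in>\<Z>. W \<subseteq> Z"
      using finite_directed by meson
    have "W \<subseteq> Z0" "W \<subseteq> tail (rem_index \<eta> Y)" using W(2) by (simp_all add: \<Z>_def)
    moreover have "W \<subseteq> \<sigma> xs" if "set xs \<subseteq> cand Y \<and> length xs \<le> T" for xs
      using W(2) that by (simp add: \<Z>_def)
    ultimately have "good Y W" unfolding good_def using W(1) Z0(2) by (simp add: subset_iff)
    then show ?thesis by (rule exI)
  qed
  define \<zeta> where "\<zeta> h = (SOME Z. good (set h) Z)" for h :: "'a list"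
  have \<zeta>: "good (set h) (\<zeta> h)" for h
    unfolding \<zeta>_def by (rule someI_ex[OF ex]) simp
  have "\<zeta> h \<in> B" for h using \<zeta>[of h] by (simp add: good_def)
  from forces_play[of B T Q "[]" \<zeta>, OF Q this] obtain ys where ys: "length ys = T" "Q ys"
    "\<And>t. t < T \<Longrightarrow> ys ! t \<in> \<zeta> (take t ys)" "\<And>t. t < T \<Longrightarrow> norm (ys ! t) = 1"
    by auto
  define m where "m t = rem_index \<eta> (set (take t ys))" for t
  have mem_take: "ys ! i \<in> set (take t ys)" if "i < t" "t \<le> T" for i t
    using that ys(1) by (metis in_set_conv_nth length_take min.absorb2 nth_take)
  have step: "norm (\<Sum>i<t. a i *\<^sub>R ys ! i) \<le> (1 + \<delta>) * norm (\<Sum>i<Suc t. a i *\<^sub>R ys ! i)" if t: "t < T" for a t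
  proof -
    have "(\<Sum>i<t. a i *\<^sub>R ys ! i) \<in> span (set (take t ys))"
      using t mem_take by (intro span_sum span_scale span_base) auto
    moreover have "a t *\<^sub>R ys ! t \<in> \<zeta> (take t ys)"
      using ys(3)[OF t] \<zeta>[of "take t ys"] subspaces subspace_scale by (auto simp: good_def)
    ultimately show ?thesis using \<zeta>[of "take t ys"] by (simp add: good_def)
  qed
  have iter: "norm (\<Sum>i<s. a i *\<^sub>R ys ! i) \<le> (1 + \<delta>) ^ d * norm (\<Sum>i<s + d. a i *\<^sub>R ys ! i)" if "s + d \<le> T" for a s d
    using that
  proof (induction d)
    case 0
    then show ?case by simp
  next
    case (Suc d)
    then have "norm (\<Sum>i<s. a i *\<^sub>R ys ! i) \<le> (1 + \<delta>) ^ d * norm (\<Sum>i<s + d. a i *\<^sub>R ys ! i)" by simp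
    also have "\<dots> \<le> (1 + \<delta>) ^ d * ((1 + \<delta>) * norm (\<Sum>i<Suc (s + d). a i *\<^sub>R ys ! i))"
      using \<delta> Suc.prems by (intro mult_left_mono step) auto
    finally show ?case by (simp add: mult.assoc mult.left_commute)
  qed
  show thesis
  proof (rule that[of ys m])
    fix a :: "nat \<Rightarrow> real" and s t :: nat assume st: "s \<le> t" "t \<le> T"
    have "norm (\<Sum>i<s. a i *\<^sub>R ys ! i) \<le> (1 + \<delta>) ^ (t - s) * norm (\<Sum>i<t. a i *\<^sub>R ys ! i)"
      using iter[of s "t - s" a] st by simp
    also have "\<dots> \<le> 2 * norm (\<Sum>i<t. a i *\<^sub>R ys ! i)"
      using st by (intro mult_right_mono \<delta>T) auto
    finally show "norm (\<Sum>i<s. a i *\<^sub>R ys ! i) \<le> 2 * norm (\<Sum>i<t. a i *\<^sub>R ys ! i)" .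
  next
    fix s t :: nat assume "s \<le> t"
    then show "m s \<le> m t"
      unfolding m_def using \<eta> set_take_subset_set_take[of s t ys] by (intro rem_index_mono) auto
  next
    fix t i assume t: "t < T" "i < m t"
    have "ys ! t \<in> tail (m t)" using ys(3)[OF t(1)] \<zeta>[of "take t ys"] by (auto simp: good_def m_def)
    then show "blinfun_apply (us i) (ys ! t) = 0" using t(2) by (rule us_tail)
  next
    fix t t' :: nat assume t: "t < t'" "t < T"
    have "ys ! t \<in> set (take t' ys)"
      using t ys(1) by (metis in_set_conv_nth length_take min_less_iff_conj nth_take)
    then show "norm (ys ! t - part (m t') (ys ! t)) \<le> \<eta>"
      unfolding m_def using \<eta> by (intro rem_index) auto
  next
    fix t xs assume t: "t < T" "set xs \<subseteq> cand (set (take t ys))" "length xs \<le> T"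
    then show "ys ! t \<in> \<sigma> xs" using ys(3)[OF t(1)] \<zeta>[of "take t ys"] by (auto simp: good_def)
  qed (use ys in auto)
qed

end

section \<open>Permissible projections onto twisted blocks\<close>

lemma sum_groups:
  fixes g :: "nat \<Rightarrow> 'b::comm_monoid_add"
  shows "(\<Sum>t<m * W. g t) = (\<Sum>j<m. \<Sum>r<W. g (j * W + r))"
proof (induction m)
  case (Suc m)
  have "(\<Sum>t<Suc m * W. g t) = (\<Sum>t<m * W + W. g t)" by (simp add: add.commute)
  then show ?case using Suc by (simp add: sum_lessThan_add_split)
qed simp

lemma norm_term_le_of_prefix_sums:
  fixes x :: "nat \<Rightarrow> 'a::real_normed_vector"
  assumes "\<And>m. m \<le> n \<Longrightarrow> norm (\<Sum>i<m. x i) \<le> K" "j < n"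
  shows "norm (x j) \<le> 2 * K"
proof -
  have "x j = (\<Sum>i<Suc j. x i) - (\<Sum>i<j. x i)" by simp
  then have "norm (x j) \<le> norm (\<Sum>i<Suc j. x i) + norm (\<Sum>i<j. x i)"
    using norm_triangle_ineq4[of "\<Sum>i<Suc j. x i" "\<Sum>i<j. x i"] by simp
  then show ?thesis using assms(1)[of "Suc j"] assms(1)[of j] assms(2) by simp
qed

context biorthogonal_basis
begin

text \<open>
  The second and third clauses are the estimates that a basis constant of at most \<open>2\<close> gives for sums over
  initial groups and for single coefficients.  By the last two, the \<open>j\<close>-th group lives, up to \<open>\<eta>\<close>, on the
  indices from \<open>M j\<close> to \<open>M (j + 1) - 1\<close> of the basis.
\<close>

definition spread_system ::
    "nat \<Rightarrow> nat \<Rightarrow> (nat \<Rightarrow> nat) \<Rightarrow> real \<Rightarrow> (nat \<Rightarrow> nat \<Rightarrow> 'a) \<Rightarrow> bool" where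
  "spread_system L W M \<eta> Y \<longleftrightarrow>
     (\<forall>j<L. \<forall>r<W. norm (Y j r) = 1) \<and>
     (\<forall>\<Gamma> m. m \<le> L \<longrightarrow> norm (\<Sum>j<m. \<Sum>r<W. \<Gamma> j r *\<^sub>R Y j r) \<le> 2 * norm (\<Sum>j<L. \<Sum>r<W. \<Gamma> j r *\<^sub>R Y j r)) \<and>
     (\<forall>\<Gamma>. \<forall>j<L. \<forall>r<W. \<bar>\<Gamma> j r\<bar> \<le> 4 * norm (\<Sum>j<L. \<Sum>r<W. \<Gamma> j r *\<^sub>R Y j r)) \<and>
     (\<forall>i j. i \<le> j \<longrightarrow> M i \<le> M j) \<and>
     (\<forall>j<L. \<forall>r<W. \<forall>i<M j. blinfun_apply (us i) (Y j r) = 0) \<and>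
     (\<forall>j<L. \<forall>r<W. \<forall>j'>j. norm (Y j r - part (M j') (Y j r)) \<le> \<eta>)"

lemma spread_system_prefix:
  assumes "spread_system L W M \<eta> Y" "m \<le> L"
  shows "norm (\<Sum>j<m. \<Sum>r<W. \<Gamma> j r *\<^sub>R Y j r) \<le> 2 * norm (\<Sum>j<L. \<Sum>r<W. \<Gamma> j r *\<^sub>R Y j r)"
proof -
  have "\<forall>\<Gamma> m. m \<le> L \<longrightarrow> norm (\<Sum>j<m. \<Sum>r<W. \<Gamma> j r *\<^sub>R Y j r) \<le> 2 * norm (\<Sum>j<L. \<Sum>r<W. \<Gamma> j r *\<^sub>R Y j r)"
    using assms(1) unfolding spread_system_def by (elim conjE)
  then show ?thesis using assms(2) by simp
qed

lemma spread_system_coeff: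
  assumes "spread_system L W M \<eta> Y" "j < L" "r < W"
  shows "\<bar>\<Gamma> j r\<bar> \<le> 4 * norm (\<Sum>j<L. \<Sum>r<W. \<Gamma> j r *\<^sub>R Y j r)"
proof -
  have "\<forall>\<Gamma>. \<forall>j<L. \<forall>r<W. \<bar>\<Gamma> j r\<bar> \<le> 4 * norm (\<Sum>j<L. \<Sum>r<W. \<Gamma> j r *\<^sub>R Y j r)"
    using assms(1) unfolding spread_system_def by (elim conjE)
  then show ?thesis using assms(2,3) by simp
qed

lemma spread_system_block_us:
  assumes "spread_system L W M \<eta> Y" "j < L" "i < M j"
  shows "blinfun_apply (us i) (\<Sum>r<W. c r *\<^sub>R Y j r) = 0"
  using assms by (auto simp: spread_system_def blinfun.sum_right blinfun.scaleR_right)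

lemma spread_system_block_remainder:
  assumes S: "spread_system L W M \<eta> Y" and j: "j < L" "j < j'"
  shows "norm ((\<Sum>r<W. c r *\<^sub>R Y j r) - part (M j') (\<Sum>r<W. c r *\<^sub>R Y j r)) \<le> (\<Sum>r<W. \<bar>c r\<bar>) * \<eta>"
proof -
  have "(\<Sum>r<W. c r *\<^sub>R Y j r) - part (M j') (\<Sum>r<W. c r *\<^sub>R Y j r)
      = (\<Sum>r<W. c r *\<^sub>R (Y j r - part (M j') (Y j r)))"
    by (simp add: part_sum sum_subtractf scaleR_diff_right)
  also have "norm \<dots> \<le> (\<Sum>r<W. \<bar>c r\<bar> * \<eta>)"
    using S j by (intro sum_norm_le) (auto simp: spread_system_def intro!: mult_left_mono)
  finally show ?thesis by (simp add: sum_distrib_right)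
qed

lemma spread_system_single_block:
  assumes S: "spread_system L W M \<eta> Y" and j: "j < L" "r < W"
  shows "\<bar>c r\<bar> \<le> 4 * norm (\<Sum>r<W. c r *\<^sub>R Y j r)"
proof -
  have "(\<Sum>i<L. \<Sum>r<W. (if i = j then c r else 0) *\<^sub>R Y i r) = (\<Sum>i<L. if i = j then \<Sum>r<W. c r *\<^sub>R Y i r else 0)"
    by (intro sum.cong) auto
  also have "\<dots> = (\<Sum>r<W. c r *\<^sub>R Y j r)" using j by simp
  finally show ?thesis
    using spread_system_coeff[OF S j, of "\<lambda>i r. if i = j then c r else 0"] by simp
qed

text \<open>
  Groups with even index carry the vectors of interest, groups with odd index the dummies.

  The projection has \<open>\<bar>g\<^sub>j(v)\<bar> \<le> 4 C \<parallel>v\<parallel>\<close>, because the \<open>x j\<close> have basis constant at most \<open>2\<close>.  As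
  \<open>g\<^sub>j(x\<^sub>j) = 1\<close>, the support of \<open>g\<^sub>j\<close> must meet the index range of group \<open>j\<close>.  Since supports are
  successive, the support of \<open>g\<^sub>j\<close> lies strictly between points of the ranges of groups \<open>j - 1\<close> and
  \<open>j + 1\<close>, so \<open>g\<^sub>j\<close> almost vanishes on every group at distance at least \<open>2\<close>.  Two distinct even groups
  do have this distance; therefore the coefficient of \<open>x j\<close> in the image of \<open>\<Sum> c\<^sub>i main\<^sub>i\<close> is
  \<open>c\<^sub>j g\<^sub>j(main\<^sub>j)\<close> for even \<open>j\<close>, up to an error that \<open>\<eta>\<close> makes negligible, while the coefficients at odd \<open>j\<close>
  remain unknown.
\<close>

lemma twisted_projection:
  fixes \<zeta> \<mu> :: "nat \<Rightarrow> nat \<Rightarrow> real" and sec :: "nat \<Rightarrow> 'a"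
    and Y :: "nat \<Rightarrow> nat \<Rightarrow> 'a" and W :: nat
  defines "Z \<equiv> \<lambda>j. \<Sum>r<W. \<zeta> j r *\<^sub>R Y j r" and "main \<equiv> \<lambda>j. \<Sum>r<W. \<mu> j r *\<^sub>R Y j r"
  assumes S: "spread_system L W M \<eta> Y" and L: "L \<ge> 1" and C: "1 \<le> C"
    and \<eta>: "0 < \<eta>" "\<eta> * (100 * C * real L * real L) \<le> 1"
    and \<zeta>1: "\<And>j. j < L \<Longrightarrow> \<exists>r<W. \<bar>\<zeta> j r\<bar> = 1" and \<zeta>3: "\<And>j. j < L \<Longrightarrow> (\<Sum>r<W. \<bar>\<zeta> j r\<bar>) \<le> 3"
    and \<mu>1: "\<And>j. j < L \<Longrightarrow> \<exists>r<W. \<bar>\<mu> j r\<bar> = 1" and \<mu>2: "\<And>j. j < L \<Longrightarrow> (\<Sum>r<W. \<bar>\<mu> j r\<bar>) \<le> 2"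
    and sec: "\<And>j. j < L \<Longrightarrow> norm (sec j) \<le> 2"
    and Zsplit: "\<And>j. j < L \<Longrightarrow> even j \<Longrightarrow> Z j = main j + (1 / (64 * C)) *\<^sub>R sec j"
    and P: "permissible_projection us L (\<lambda>j. sgn (Z j)) g P" "norm P \<le> C"
  shows "\<exists>a. (\<forall>j<L. even j \<longrightarrow> 1/2 \<le> a j \<and> a j \<le> 3/2) \<and>
    (\<forall>c. (\<forall>j<L. odd j \<longrightarrow> c j = 0) \<longrightarrow>
      (\<exists>b. norm (\<Sum>j<L. (if even j then c j * a j else b j) *\<^sub>R Z j) \<le> (C + 1) * norm (\<Sum>j<L. c j *\<^sub>R main j)))"
proof -
  define x where "x j = sgn (Z j)" for j
  define \<nu> where "\<nu> j = norm (Z j)" for j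
  have \<nu>: "1 / 4 \<le> \<nu> j" if j: "j < L" for j
  proof -
    obtain r where r: "r < W" "\<bar>\<zeta> j r\<bar> = 1" using \<zeta>1[OF j] by blast
    show ?thesis using spread_system_single_block[OF S j r(1), of "\<zeta> j"] r(2) by (simp add: \<nu>_def Z_def)
  qed
  have \<nu>0: "\<nu> j > 0" if "j < L" for j using \<nu>[OF that] by simp
  have Zx: "Z j = \<nu> j *\<^sub>R x j" if "j < L" for j
    using \<nu>0[OF that] by (simp add: x_def \<nu>_def sgn_div_norm)
  have nx: "norm (x j) = 1" if "j < L" for j
    using \<nu>0[OF that] by (simp add: x_def \<nu>_def norm_sgn)
  define \<gamma> where "\<gamma> j r = \<zeta> j r / \<nu> j" for j r
  have x\<gamma>: "x j = (\<Sum>r<W. \<gamma> j r *\<^sub>R Y j r)" for j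
    by (simp add: x_def sgn_div_norm \<gamma>_def Z_def \<nu>_def scaleR_sum_right divide_inverse mult.commute)
  have \<gamma>12: "(\<Sum>r<W. \<bar>\<gamma> j r\<bar>) \<le> 12" if j: "j < L" for j
  proof -
    have "(\<Sum>r<W. \<bar>\<gamma> j r\<bar>) = (\<Sum>r<W. \<bar>\<zeta> j r\<bar>) / \<nu> j"
      using \<nu>0[OF j] by (simp add: \<gamma>_def sum_divide_distrib)
    also have "\<dots> \<le> 3 / (1 / 4)" by (rule frac_le) (use \<zeta>3[OF j] \<nu>[OF j] in auto)
    finally show ?thesis by simp
  qed
  have prefix: "norm (\<Sum>j<m. d j *\<^sub>R x j) \<le> 2 * norm (\<Sum>j<L. d j *\<^sub>R x j)" if "m \<le> L" for d m
  proof -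
    have "(\<Sum>j<m. d j *\<^sub>R x j) = (\<Sum>j<m. \<Sum>r<W. (d j * \<gamma> j r) *\<^sub>R Y j r)" for m
      by (simp add: x\<gamma> scaleR_sum_right)
    then show ?thesis using spread_system_prefix[OF S that, of "\<lambda>j r. d j * \<gamma> j r"] by simp
  qed
  have coeff: "\<bar>d j\<bar> \<le> 4 * norm (\<Sum>j<L. d j *\<^sub>R x j)" if j: "j < L" for d j
  proof -
    have "norm (d j *\<^sub>R x j) \<le> 2 * (2 * norm (\<Sum>j<L. d j *\<^sub>R x j))"
      by (rule norm_term_le_of_prefix_sums[of L "\<lambda>j. d j *\<^sub>R x j"]) (use prefix j in auto)
    then show ?thesis using nx[OF j] by simp
  qed
  have PP: "blinfun_apply P (blinfun_apply P v) = blinfun_apply P v" for v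
    using P(1) unfolding permissible_projection_def by (metis blinfun_apply_blinfun_compose)
  have ran: "range (blinfun_apply P) = span (x ` {..<L})"
    and Pg: "blinfun_apply P v = (\<Sum>i<L. blinfun_apply (g i) v *\<^sub>R x i)" for v
    using P(1) by (auto simp: permissible_projection_def x_def)
  have gspan: "g i \<in> span (range us)" if "i < L" for i
    using P(1) that by (auto simp: permissible_projection_def)
  have nP: "norm (blinfun_apply P v) \<le> C * norm v" for v
    using norm_blinfun[of P v] P(2) by (meson mult_right_mono norm_ge_zero order_trans)
  have gb: "\<bar>blinfun_apply (g j) v\<bar> \<le> 4 * C * norm v" if "j < L" for j v
    using coeff[OF that, of "\<lambda>i. blinfun_apply (g i) v"] nP[of v] by (simp add: Pg)
  have gx: "blinfun_apply (g i) (x j) = (if i = j then 1 else 0)" if ij: "i < L" "j < L" for i j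
  proof -
    have "x j \<in> range (blinfun_apply P)" unfolding ran using ij by (intro span_base) auto
    then have "blinfun_apply P (x j) = x j" using PP by auto
    then have "(\<Sum>i<L. (blinfun_apply (g i) (x j) - (if i = j then 1 else 0)) *\<^sub>R x i) = 0"
      using ij by (simp add: Pg scaleR_diff_left sum_subtractf if_distrib[of "\<lambda>c. c *\<^sub>R _"] cong: if_cong)
    then show ?thesis
      using coeff[OF ij(1), of "\<lambda>i. blinfun_apply (g i) (x j) - (if i = j then 1 else 0)"] by simp
  qed
  define supp where "supp j = {s. blinfun_apply (g j) (u s) \<noteq> 0}" for j
  have supp_eq: "functional_supp us (g j) = supp j" if "j < L" for j
    unfolding supp_def by (rule finitely_supported_functional(1)[OF gspan[OF that]])
  have fin_supp: "finite (supp j)" if "j < L" for j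
    unfolding supp_def by (rule finitely_supported_functional(2)[OF gspan[OF that]])
  have g_expand: "blinfun_apply (g j) y = (\<Sum>s\<in>supp j. blinfun_apply (g j) (u s) * blinfun_apply (us s) y)"
    if "j < L" for j y
    unfolding supp_def by (rule finitely_supported_functional(3)[OF gspan[OF that]])
  have g_part: "blinfun_apply (g j) (part m y) = 0"
    if "\<And>s. s < m \<Longrightarrow> s \<in> supp j \<Longrightarrow> blinfun_apply (us s) y = 0" for j m y
    unfolding part_def using that
    by (auto simp: blinfun.sum_right blinfun.scaleR_right supp_def intro!: sum.neutral)
  have Mmono: "M i \<le> M j" if "i \<le> j" for i j
    using S that by (simp add: spread_system_def)
  have L1: "1 \<le> real L * real L" using L by (metis mult_ge1_I of_nat_1 of_nat_le_iff)
  have \<eta>C: "100 * C * \<eta> \<le> 1"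
  proof -
    have "(100 * C * \<eta>) * 1 \<le> (100 * C * \<eta>) * (real L * real L)"
      using L1 C \<eta>(1) by (intro mult_left_mono) auto
    then show ?thesis using \<eta>(2) by (simp add: mult_ac)
  qed
  have meets: "\<exists>p\<in>supp j. M j \<le> p \<and> p < M (Suc j)" if j: "j < L" for j
  proof (rule ccontr)
    assume no: "\<not> ?thesis"
    have "blinfun_apply (g j) (part (M (Suc j)) (x j)) = 0"
    proof (rule g_part)
      fix s assume "s < M (Suc j)" "s \<in> supp j"
      then have "s < M j" using no by force
      then show "blinfun_apply (us s) (x j) = 0"
        unfolding x\<gamma> by (rule spread_system_block_us[OF S j])
    qed
    then have "1 = \<bar>blinfun_apply (g j) (x j - part (M (Suc j)) (x j))\<bar>"
      using gx[OF j j] by (simp add: blinfun.diff_right)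
    also have "\<dots> \<le> 4 * C * norm (x j - part (M (Suc j)) (x j))" by (rule gb[OF j])
    also have "\<dots> \<le> 4 * C * (12 * \<eta>)"
    proof -
      have "norm (x j - part (M (Suc j)) (x j)) \<le> (\<Sum>r<W. \<bar>\<gamma> j r\<bar>) * \<eta>"
        unfolding x\<gamma> by (rule spread_system_block_remainder[OF S j]) simp
      also have "\<dots> \<le> 12 * \<eta>" using \<gamma>12[OF j] \<eta>(1) by (intro mult_right_mono) auto
      finally show ?thesis using C by (intro mult_left_mono) auto
    qed
    also have "\<dots> < 1" using \<eta>C \<eta>(1) C by (simp add: mult_ac)
    finally show False by simp
  qed
  have order: "s < t" if "s \<in> supp j" "t \<in> supp (Suc j)" "Suc j < L" for s t j
  proof -
    have "Max (supp j) < Min (supp (Suc j))"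
      using P(1) that supp_eq[of j] supp_eq[of "Suc j"] by (auto simp: permissible_projection_def)
    moreover have "s \<le> Max (supp j)" "Min (supp (Suc j)) \<le> t"
      using that fin_supp[of j] fin_supp[of "Suc j"] by auto
    ultimately show ?thesis by linarith
  qed
  have supp_below: "s < M (j + 2)" if s: "s \<in> supp j" and j: "Suc j < L" for s j
  proof -
    obtain p where "p \<in> supp (Suc j)" "p < M (Suc (Suc j))" using meets[OF j] by blast
    then show ?thesis using order[OF s _ j] by fastforce
  qed
  have supp_above: "M j \<le> s" if s: "s \<in> supp (Suc j)" and j: "Suc j < L" for s j
  proof -
    obtain p where "p \<in> supp j" "M j \<le> p" using meets[of j] j by auto
    then show ?thesis using order[OF _ s j] by fastforce
  qed
  have far: "\<bar>blinfun_apply (g j) (main i)\<bar> \<le> 8 * C * \<eta>" if ij: "i < L" "j < L" "j + 2 \<le> i \<or> i + 2 \<le> j" for i j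
    using ij(3)
  proof
    assume "j + 2 \<le> i"
    then have "s < M i" if "s \<in> supp j" for s
      using supp_below[OF that] Mmono[of "j + 2" i] ij by fastforce
    then have "blinfun_apply (us s) (main i) = 0" if "s \<in> supp j" for s
      unfolding main_def using spread_system_block_us[OF S ij(1)] that by blast
    then have "blinfun_apply (g j) (main i) = 0" using g_expand[OF ij(2), of "main i"] by simp
    then show ?thesis using C \<eta>(1) by simp
  next
    assume i: "i + 2 \<le> j"
    then obtain j' where j': "j = Suc j'" "Suc i \<le> j'" by (cases j) auto
    have "blinfun_apply (g j) (part (M (Suc i)) (main i)) = 0"
    proof (rule g_part)
      fix s assume "s < M (Suc i)" "s \<in> supp j"
      then show "blinfun_apply (us s) (main i) = 0"
        using supp_above[of s j'] j' ij(2) Mmono[of "Suc i" j'] by fastforce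
    qed
    then have "\<bar>blinfun_apply (g j) (main i)\<bar> = \<bar>blinfun_apply (g j) (main i - part (M (Suc i)) (main i))\<bar>"
      by (simp add: blinfun.diff_right)
    also have "\<dots> \<le> 4 * C * norm (main i - part (M (Suc i)) (main i))" by (rule gb[OF ij(2)])
    also have "\<dots> \<le> 4 * C * (2 * \<eta>)"
    proof -
      have "norm (main i - part (M (Suc i)) (main i)) \<le> (\<Sum>r<W. \<bar>\<mu> i r\<bar>) * \<eta>"
        unfolding main_def by (rule spread_system_block_remainder[OF S ij(1)]) simp
      also have "\<dots> \<le> 2 * \<eta>" using \<mu>2[OF ij(1)] \<eta>(1) by (intro mult_right_mono) auto
      finally show ?thesis using C by (intro mult_left_mono) auto
    qed
    finally show ?thesis by simp
  qed
  define a where "a j = blinfun_apply (g j) (main j) / \<nu> j" for j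
  have a: "1/2 \<le> a j \<and> a j \<le> 3/2" if j: "j < L" "even j" for j
  proof -
    have "blinfun_apply (g j) (Z j) = \<nu> j"
      using gx[OF j(1) j(1)] by (simp add: Zx[OF j(1)] blinfun.scaleR_right)
    then have eq: "blinfun_apply (g j) (main j) = \<nu> j - blinfun_apply (g j) (sec j) / (64 * C)"
      using Zsplit[OF j] by (simp add: blinfun.add_right blinfun.scaleR_right)
    define X where "X = (blinfun_apply (g j) (sec j) / (64 * C)) / \<nu> j"
    have 1: "a j = 1 - X"
      using \<nu>0[OF j(1)] eq by (simp add: a_def X_def diff_divide_distrib)
    have "\<bar>blinfun_apply (g j) (sec j)\<bar> \<le> 4 * C * 2"
      using gb[OF j(1), of "sec j"] sec[OF j(1)] C by (meson mult_left_mono order_trans zero_le_mult_iff zero_le_numeral zero_le_one)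
    then have "\<bar>blinfun_apply (g j) (sec j) / (64 * C)\<bar> \<le> 1 / 8"
      using C by (simp add: field_simps)
    then have "\<bar>blinfun_apply (g j) (sec j) / (64 * C)\<bar> / \<nu> j \<le> (1 / 8) / (1 / 4)"
      by (rule frac_le[rotated]) (use \<nu>[OF j(1)] in auto)
    then have "\<bar>X\<bar> \<le> 1 / 2" using \<nu>0[OF j(1)] unfolding X_def abs_divide[of _ "\<nu> j"] by simp
    then show ?thesis using 1 by linarith
  qed
  have "\<exists>b. norm (\<Sum>j<L. (if even j then c j * a j else b j) *\<^sub>R Z j) \<le> (C + 1) * norm (\<Sum>j<L. c j *\<^sub>R main j)"
    if c: "\<forall>j<L. odd j \<longrightarrow> c j = 0" for c
  proof -
    define v where "v = (\<Sum>j<L. c j *\<^sub>R main j)"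
    have cK: "\<bar>c j\<bar> \<le> 4 * norm v" if j: "j < L" for j
    proof -
      obtain r where r: "r < W" "\<bar>\<mu> j r\<bar> = 1" using \<mu>1[OF j] by blast
      have "v = (\<Sum>j<L. \<Sum>r<W. (c j * \<mu> j r) *\<^sub>R Y j r)"
        by (simp add: v_def main_def scaleR_sum_right)
      then show ?thesis
        using spread_system_coeff[OF S j r(1), of "\<lambda>j r. c j * \<mu> j r"] r(2) by (simp add: abs_mult)
    qed
    \<comment> \<open>The contribution of the other even groups to the coefficient at \<open>x j\<close>.\<close>
    define e where "e j = blinfun_apply (g j) v - c j * blinfun_apply (g j) (main j)" for j
    have e: "\<bar>e j\<bar> \<le> real L * (4 * norm v * (8 * C * \<eta>))" if j: "j < L" "even j" for j
    proof -
      have "e j = (\<Sum>i<L. if i = j then 0 else c i * blinfun_apply (g j) (main i))"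
      proof -
        have "blinfun_apply (g j) v = (\<Sum>i<L. c i * blinfun_apply (g j) (main i))"
          by (simp add: v_def blinfun.sum_right blinfun.scaleR_right)
        also have "\<dots> = (\<Sum>i<L. (if i = j then c j * blinfun_apply (g j) (main j) else 0) +
            (if i = j then 0 else c i * blinfun_apply (g j) (main i)))"
          by (intro sum.cong) auto
        also have "\<dots> = c j * blinfun_apply (g j) (main j) +
            (\<Sum>i<L. if i = j then 0 else c i * blinfun_apply (g j) (main i))"
          using j(1) by (simp add: sum.distrib)
        finally show ?thesis by (simp add: e_def)
      qed
      also have "\<bar>\<dots>\<bar> \<le> real (card {..<L}) * (4 * norm v * (8 * C * \<eta>))"
        unfolding real_norm_def[symmetric]
      proof (rule sum_norm_bound)
        fix i assume i: "i \<in> {..<L}"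
        have B0: "0 \<le> 4 * norm v * (8 * C * \<eta>)" using C \<eta>(1) by simp
        show "norm (if i = j then 0 else c i * blinfun_apply (g j) (main i)) \<le> 4 * norm v * (8 * C * \<eta>)"
        proof (cases "i = j \<or> odd i")
          case True
          then show ?thesis using B0 c i by auto
        next
          case False
          then have "j + 2 \<le> i \<or> i + 2 \<le> j" using j(2) by presburger
          then have "\<bar>c i\<bar> * \<bar>blinfun_apply (g j) (main i)\<bar> \<le> (4 * norm v) * (8 * C * \<eta>)"
            using cK far i j(1) by (intro mult_mono) auto
          then show ?thesis using False by (simp add: abs_mult)
        qed
      qed
      finally show ?thesis by simp
    qed
    define b where "b j = blinfun_apply (g j) v / \<nu> j" for j
    have "blinfun_apply P v = (\<Sum>j<L. (if even j then c j * a j else b j) *\<^sub>R Z j) + (\<Sum>j<L. (if even j then e j else 0) *\<^sub>R x j)"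
      unfolding Pg sum.distrib[symmetric]
    proof (intro sum.cong refl)
      fix j assume "j \<in> {..<L}"
      then have j: "j < L" by simp
      show "blinfun_apply (g j) v *\<^sub>R x j =
        (if even j then c j * a j else b j) *\<^sub>R Z j + (if even j then e j else 0) *\<^sub>R x j"
        using \<nu>0[OF j] by (simp add: Zx[OF j] a_def b_def e_def scaleR_add_left[symmetric])
    qed
    then have "norm (\<Sum>j<L. (if even j then c j * a j else b j) *\<^sub>R Z j)
        \<le> norm (blinfun_apply P v) + norm (\<Sum>j<L. (if even j then e j else 0) *\<^sub>R x j)"
      using norm_triangle_ineq4[of "blinfun_apply P v" "\<Sum>j<L. (if even j then e j else 0) *\<^sub>R x j"]
      by (simp only: add_diff_cancel)
    also have "norm (\<Sum>j<L. (if even j then e j else 0) *\<^sub>R x j) \<le> real (card {..<L}) * (real L * (4 * norm v * (8 * C * \<eta>)))"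
    proof (rule sum_norm_bound)
      fix j assume "j \<in> {..<L}"
      then show "norm ((if even j then e j else 0) *\<^sub>R x j) \<le> real L * (4 * norm v * (8 * C * \<eta>))"
        using e[of j] nx[of j] C \<eta>(1) by auto
    qed
    also have "\<dots> \<le> norm v"
    proof -
      have "real (card {..<L}) * (real L * (4 * norm v * (8 * C * \<eta>))) = norm v * (32 * (\<eta> * (C * real L * real L)))"
        by simp
      also have "\<dots> \<le> norm v * 1"
      proof (rule mult_left_mono)
        have "0 \<le> \<eta> * (C * real L * real L)" using C \<eta>(1) by simp
        then show "32 * (\<eta> * (C * real L * real L)) \<le> 1" using \<eta>(2) by simp
      qed simp
      finally show ?thesis by simp
    qed
    finally have "norm (\<Sum>j<L. (if even j then c j * a j else b j) *\<^sub>R Z j) \<le> (C + 1) * norm v"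
      using nP[of v] by (simp add: algebra_simps)
    then show ?thesis unfolding v_def by blast
  qed
  then show ?thesis using a by blast
qed

end

section \<open>Games whose outcomes are twisted blocks\<close>

lemma prefix_bound_imp_basic_seq:
  fixes x :: "nat \<Rightarrow> 'a::real_normed_vector"
  assumes prefix: "\<And>d m. m \<le> n \<Longrightarrow> norm (\<Sum>j<m. d j *\<^sub>R x j) \<le> 2 * norm (\<Sum>j<n. d j *\<^sub>R x j)"
    and unit: "\<And>j. j < n \<Longrightarrow> norm (x j) = 1"
  shows "basic_seq_le 2 n x"
proof -
  have zero: "d j = 0" if "(\<Sum>j<n. d j *\<^sub>R x j) = 0" "j < n" for d j
  proof -
    have "(\<Sum>j<m. d j *\<^sub>R x j) = 0" if "m \<le> n" for m
      using prefix[OF that, of d] \<open>(\<Sum>j<n. d j *\<^sub>R x j) = 0\<close> by simp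
    from this[of j] this[of "Suc j"] have "d j *\<^sub>R x j = 0" using that(2) by simp
    then show ?thesis using unit[OF that(2)] by auto
  qed
  have inj: "inj_on x {..<n}"
  proof (rule inj_onI, rule ccontr)
    fix i j assume ij: "i \<in> {..<n}" "j \<in> {..<n}" "x i = x j" "i \<noteq> j"
    let ?d = "\<lambda>k. (if k = i then 1 else 0) - (if k = j then 1 else 0 :: real)"
    have "(\<Sum>k<n. ?d k *\<^sub>R x k) = x i - x j"
      using ij by (simp add: scaleR_diff_left sum_subtractf if_distrib[of "\<lambda>c. c *\<^sub>R _"] cong: if_cong)
    then have "?d i = 0" using ij by (intro zero) auto
    then show False using ij by simp
  qed
  have "independent (x ` {..<n})"
  proof
    assume "dependent (x ` {..<n})"
    then obtain w v where w: "v \<in> x ` {..<n}" "w v \<noteq> 0" "(\<Sum>v\<in>x ` {..<n}. w v *\<^sub>R v) = 0"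
      by (auto simp: dependent_finite)
    have "(\<Sum>j<n. w (x j) *\<^sub>R x j) = 0" using w(3) inj by (simp add: sum.reindex)
    then have "w (x j) = 0" if "j < n" for j using zero[of "\<lambda>j. w (x j)"] that by simp
    then show False using w by auto
  qed
  moreover have "basis_constant n (seq_cnorm n x) \<le> 2"
    unfolding basis_constant_def
  proof (rule cSUP_least)
    fix m assume m: "m \<in> {..n}"
    show "cnorm_onorm (seq_cnorm n x) (\<lambda>a. seq_cnorm n x (\<lambda>i. if i < m then a i else 0)) \<le> 2"
    proof (rule cnorm_onorm_le)
      fix a
      have "(\<Sum>i<n. (if i < m then a i else 0) *\<^sub>R x i) = (\<Sum>i<m. a i *\<^sub>R x i)"
        by (rule sum.mono_neutral_cong_right) (use m in auto)
      then show "seq_cnorm n x (\<lambda>i. if i < m then a i else 0) \<le> 2 * seq_cnorm n x a"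
        using prefix[of m a] m by (simp add: seq_cnorm_def)
    qed (auto simp: seq_cnorm_def)
  qed simp
  ultimately show ?thesis using inj by (simp add: basic_seq_le_def)
qed

text \<open>
  Coefficients, on a group of \<open>N + 2\<close> vectors, of \<open>p\<close> times the first, \<open>q\<close> times the second, and \<open>b\<close> times
  the difference of those with indices \<open>k\<close> and \<open>l\<close> among the remaining \<open>N\<close>.
\<close>

definition quad :: "real \<Rightarrow> real \<Rightarrow> real \<Rightarrow> nat \<Rightarrow> nat \<Rightarrow> nat \<Rightarrow> real" where
  "quad p q b k l r =
     (if r = 0 then p else if r = 1 then q else if r = k + 2 then b else if r = l + 2 then - b else 0)"

lemma sum_quad:
  fixes y :: "nat \<Rightarrow> 'b::real_vector"
  assumes "k < l" "l < N"
  shows "(\<Sum>r<N + 2. quad p q b k l r *\<^sub>R y r) = p *\<^sub>R y 0 + q *\<^sub>R y 1 + b *\<^sub>R (y (k + 2) - y (l + 2))"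
proof -
  have "(\<Sum>r<N + 2. quad p q b k l r *\<^sub>R y r) = (\<Sum>r\<in>{0, 1, k + 2, l + 2}. quad p q b k l r *\<^sub>R y r)"
    by (rule sum.mono_neutral_right) (use assms in \<open>auto simp: quad_def\<close>)
  also have "\<dots> = p *\<^sub>R y 0 + q *\<^sub>R y 1 + b *\<^sub>R (y (k + 2) - y (l + 2))"
    using assms by (simp add: quad_def scaleR_diff_right)
  finally show ?thesis .
qed

lemma sum_abs_quad:
  assumes "k < l" "l < N"
  shows "(\<Sum>r<N + 2. \<bar>quad p q b k l r\<bar>) = \<bar>p\<bar> + \<bar>q\<bar> + 2 * \<bar>b\<bar>"
proof -
  have "(\<Sum>r<N + 2. \<bar>quad p q b k l r\<bar>) = (\<Sum>r\<in>{0, 1, k + 2, l + 2}. \<bar>quad p q b k l r\<bar>)"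
    by (rule sum.mono_neutral_right) (use assms in \<open>auto simp: quad_def\<close>)
  also have "\<dots> = \<bar>p\<bar> + \<bar>q\<bar> + 2 * \<bar>b\<bar>"
    using assms by (simp add: quad_def)
  finally show ?thesis .
qed

context permissible_family
begin

text \<open>
  The long game, cut into \<open>L\<close> groups of \<open>W\<close> moves.  A sequence of candidates, one from each group, is an
  outcome of the strategy \<open>\<sigma>\<close>: the candidate of group \<open>k\<close> is a combination of vectors that all lie in the
  subspace which \<open>\<sigma>\<close> prescribes after the earlier candidates.
\<close>

lemma spread_game:
  fixes cand :: "'a set \<Rightarrow> 'a set" and \<sigma> :: "'a list \<Rightarrow> 'a set"
  assumes Q: "forces B (L * W) Q []" and \<eta>: "0 < \<eta>" and W: "0 < W"
    and \<sigma>: "\<And>xs. \<sigma> xs \<in> B" and cand: "\<And>Y. finite Y \<Longrightarrow> finite (cand Y)"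
    and cand_mono: "\<And>Y Y'. Y \<subseteq> Y' \<Longrightarrow> cand Y \<subseteq> cand Y'"
  obtains ys M where
    "Q ys" "spread_system L W M \<eta> (\<lambda>j r. ys ! (j * W + r))"
    "\<And>\<zeta>. (\<And>j. j < L \<Longrightarrow> \<exists>r<W. \<zeta> j r \<noteq> 0) \<Longrightarrow>
      (\<And>j. j < L \<Longrightarrow> sgn (\<Sum>r<W. \<zeta> j r *\<^sub>R ys ! (j * W + r)) \<in> cand ((\<lambda>r. ys ! (j * W + r)) ` {..<W})) \<Longrightarrow>
      S_outcome L \<sigma> (\<lambda>j. sgn (\<Sum>r<W. \<zeta> j r *\<^sub>R ys ! (j * W + r)))"
proof (rule long_game[OF Q \<eta>, where \<sigma>=\<sigma> and cand=cand])
  show "\<sigma> xs \<in> B" for xs by (rule \<sigma>)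
  show "finite (cand Y)" if "finite Y" for Y by (rule cand[OF that])
  fix ys and m :: "nat \<Rightarrow> nat"
  assume ys: "length ys = L * W" "Q ys" "\<And>t. t < L * W \<Longrightarrow> norm (ys ! t) = 1"
    and prefix: "\<And>a s t. s \<le> t \<Longrightarrow> t \<le> L * W \<Longrightarrow>
       norm (\<Sum>i<s. a i *\<^sub>R ys ! i) \<le> 2 * norm (\<Sum>i<t. a i *\<^sub>R ys ! i)"
    and m: "\<And>s t. s \<le> t \<Longrightarrow> m s \<le> m t"
    "\<And>t i. t < L * W \<Longrightarrow> i < m t \<Longrightarrow> blinfun_apply (us i) (ys ! t) = 0"
    "\<And>t t'. t < t' \<Longrightarrow> t < L * W \<Longrightarrow> norm (ys ! t - part (m t') (ys ! t)) \<le> \<eta>"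
    and in_\<sigma>: "\<And>t xs. t < L * W \<Longrightarrow> set xs \<subseteq> cand (set (take t ys)) \<Longrightarrow> length xs \<le> L * W \<Longrightarrow> ys ! t \<in> \<sigma> xs"
  define Y where "Y j r = ys ! (j * W + r)" for j r
  define M where "M j = m (j * W)" for j
  have pos: "j * W + r < j' * W" if "j < j'" "r < W" for j j' r
  proof -
    have "Suc j * W \<le> j' * W" using that by (intro mult_right_mono) auto
    then show ?thesis using that by simp
  qed
  have blocks: "(\<Sum>j<m. \<Sum>r<W. \<Gamma> j r *\<^sub>R Y j r) = (\<Sum>t<m * W. \<Gamma> (t div W) (t mod W) *\<^sub>R ys ! t)" for \<Gamma> m
    unfolding sum_groups Y_def by (intro sum.cong refl) (simp add: W)
  have prefixY: "norm (\<Sum>j<m. \<Sum>r<W. \<Gamma> j r *\<^sub>R Y j r) \<le> 2 * norm (\<Sum>j<m'. \<Sum>r<W. \<Gamma> j r *\<^sub>R Y j r)"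
    if "m \<le> m'" "m' \<le> L" for \<Gamma> m m'
    unfolding blocks by (rule prefix) (use that in \<open>auto intro: mult_right_mono\<close>)
  have coeffY: "\<bar>\<Gamma> j r\<bar> \<le> 4 * norm (\<Sum>j<L. \<Sum>r<W. \<Gamma> j r *\<^sub>R Y j r)" if jr: "j < L" "r < W" for \<Gamma> j r
  proof -
    let ?a = "\<lambda>t. \<Gamma> (t div W) (t mod W)"
    let ?t = "j * W + r"
    have t: "?t < L * W" using pos jr by simp
    have "norm (?a ?t *\<^sub>R ys ! ?t) \<le> 2 * (2 * norm (\<Sum>i<L * W. ?a i *\<^sub>R ys ! i))"
      by (rule norm_term_le_of_prefix_sums[of "L * W" "\<lambda>i. ?a i *\<^sub>R ys ! i"]) (use prefix t in auto)
    then show ?thesis unfolding blocks using ys(3)[OF t] jr W by simp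
  qed
  have system: "spread_system L W M \<eta> Y"
    unfolding spread_system_def
  proof (intro conjI allI impI)
    fix j r assume jr: "j < L" "r < W"
    show "norm (Y j r) = 1" unfolding Y_def by (rule ys(3)) (use pos jr in auto)
    fix i assume "i < M j"
    then have "i < m (j * W + r)" unfolding M_def using m(1)[of "j * W" "j * W + r"] by simp
    then show "blinfun_apply (us i) (Y j r) = 0" unfolding Y_def using pos jr by (intro m(2)) auto
  next
    fix j r j' assume "j < L" "r < W" "j < j'"
    then show "norm (Y j r - part (M j') (Y j r)) \<le> \<eta>" unfolding Y_def M_def by (intro m(3) pos) auto
  next
    fix i j :: nat assume "i \<le> j"
    then show "M i \<le> M j" unfolding M_def by (intro m(1) mult_right_mono) auto
  qed (use prefixY coeffY in auto)
  show thesis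
  proof (rule that[OF ys(2) system[unfolded Y_def]])
    fix \<zeta> :: "nat \<Rightarrow> nat \<Rightarrow> real"
    assume nz: "\<And>j. j < L \<Longrightarrow> \<exists>r<W. \<zeta> j r \<noteq> 0"
      and cnd: "\<And>j. j < L \<Longrightarrow> sgn (\<Sum>r<W. \<zeta> j r *\<^sub>R ys ! (j * W + r)) \<in> cand ((\<lambda>r. ys ! (j * W + r)) ` {..<W})"
    define z where "z j = (\<Sum>r<W. \<zeta> j r *\<^sub>R Y j r)" for j
    define x where "x j = sgn (z j)" for j
    have z0: "z j \<noteq> 0" if j: "j < L" for j
    proof -
      obtain r where "r < W" "\<zeta> j r \<noteq> 0" using nz[OF j] by blast
      then show ?thesis using spread_system_single_block[OF system j, of r "\<zeta> j"] by (auto simp: z_def)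
    qed
    have nx: "norm (x j) = 1" if "j < L" for j using z0[OF that] by (simp add: x_def norm_sgn)
    have cnd': "x j \<in> cand (Y j ` {..<W})" if "j < L" for j
      using cnd[OF that] by (simp add: x_def z_def Y_def)
    have "S_outcome L \<sigma> x"
      unfolding S_outcome_def admissible_move_def
    proof (intro allI impI conjI)
      fix k assume k: "k < L"
      have \<sigma>k: "Y k r \<in> \<sigma> (map x [0..<k])" if r: "r < W" for r
        unfolding Y_def
      proof (rule in_\<sigma>)
        show "k * W + r < L * W" using pos[OF k r] .
        have sub: "Y i ` {..<W} \<subseteq> set (take (k * W + r) ys)" if "i < k" for i
        proof
          fix y assume "y \<in> Y i ` {..<W}"
          then obtain s where s: "s < W" "y = ys ! (i * W + s)" by (auto simp: Y_def)
          have 1: "i * W + s < k * W + r" using pos[OF that s(1)] by simp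
          moreover have "i * W + s < length ys" using 1 pos[OF k r] ys(1) by simp
          ultimately show "y \<in> set (take (k * W + r) ys)"
            unfolding s(2) in_set_conv_nth by (intro exI[of _ "i * W + s"]) auto
        qed
        show "set (map x [0..<k]) \<subseteq> cand (set (take (k * W + r) ys))"
        proof
          fix y assume "y \<in> set (map x [0..<k])"
          then obtain i where "i < k" "y = x i" by auto
          then show "y \<in> cand (set (take (k * W + r) ys))"
            using cnd'[of i] cand_mono[OF sub[of i]] k by auto
        qed
        have "k \<le> L * W" using k W mult_le_mono[of k L 1 W] by simp
        then show "length (map x [0..<k]) \<le> L * W" by simp
      qed
      have "x k \<in> \<sigma> (map x [0..<k])"
        unfolding x_def[of k] sgn_div_norm z_def using \<sigma>k
        by (intro subspace_scale subspace_sum subspaces \<sigma>) auto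
      then show "x k \<in> \<sigma> (map x [0..<k]) \<inter> sphere 0 1" using nx[OF k] by simp
      show "basic_seq_le 2 (Suc k) x"
      proof (rule prefix_bound_imp_basic_seq)
        fix d :: "nat \<Rightarrow> real" and m assume m: "m \<le> Suc k"
        have "(\<Sum>j<m. d j *\<^sub>R x j) = (\<Sum>j<m. \<Sum>r<W. (d j * \<zeta> j r / norm (z j)) *\<^sub>R Y j r)" for m
          by (simp add: x_def sgn_div_norm z_def scaleR_sum_right divide_inverse mult_ac)
        then show "norm (\<Sum>j<m. d j *\<^sub>R x j) \<le> 2 * norm (\<Sum>j<Suc k. d j *\<^sub>R x j)"
          using prefixY[OF m, of "\<lambda>j r. d j * \<zeta> j r / norm (z j)"] k by simp
      qed (use nx k in auto)
    qed
    then show "S_outcome L \<sigma> (\<lambda>j. sgn (\<Sum>r<W. \<zeta> j r *\<^sub>R ys ! (j * W + r)))"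
      by (simp add: x_def[abs_def] z_def Y_def)
  qed
qed

end

section \<open>Uniform comparison of asymptotic spaces\<close>

locale complemented_family = permissible_family u us B
  for u :: "nat \<Rightarrow> 'a::banach" and us and B +
  fixes C :: real
  assumes C: "1 \<le> C"
    and complemented: "permissible_far_enough B (permissibly_complemented us C)"
begin

text \<open>
  The factor \<open>\<lambda>\<close> of the twist: small enough that \<open>\<lambda> \<bar>g\<^sub>j(y)\<bar> / \<parallel>z\<parallel> \<le> 1/2\<close> whenever \<open>\<bar>g\<^sub>j(y)\<bar> \<le> 4 C \<parallel>y\<parallel>\<close>,
  \<open>\<parallel>y\<parallel> \<le> 2\<close> and \<open>\<parallel>z\<parallel> \<ge> 1/4\<close>.
\<close>

definition weight :: real where "weight = 1 / (64 * C)"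

text \<open>
  The three kinds of vectors played: \<open>v + \<lambda> u\<close>, \<open>w + \<lambda> v\<close> and the dummies \<open>v\<close>.
\<close>

definition coeff_triples :: "(real \<times> real \<times> real) set" where
  "coeff_triples = {(weight, 0, 1), (0, 1, weight), (0, 0, 1)}"

text \<open>
  Which two vectors are subtracted is decided by Ramsey's theorem after the game, so all pairs have
  to be provided for; there are still finitely many candidates.
\<close>

definition candidates :: "'a set \<Rightarrow> 'a set" where
  "candidates Y = (\<lambda>((p, q, b), y0, y1, y2, y3). sgn (p *\<^sub>R y0 + q *\<^sub>R y1 + b *\<^sub>R (y2 - y3))) `
     (coeff_triples \<times> Y \<times> Y \<times> Y \<times> Y)"

lemma finite_candidates: "finite Y \<Longrightarrow> finite (candidates Y)"
  unfolding candidates_def coeff_triples_def by (intro finite_imageI finite_cartesian_product) auto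

lemma candidates_mono: "Y \<subseteq> Y' \<Longrightarrow> candidates Y \<subseteq> candidates Y'"
  unfolding candidates_def by (intro image_mono Sigma_mono) auto

lemma quad_candidate:
  assumes "(p, q, b) \<in> coeff_triples" "k < l" "l < N"
  shows "sgn (\<Sum>r<N + 2. quad p q b k l r *\<^sub>R y r) \<in> candidates (y ` {..<N + 2})"
  unfolding sum_quad[OF assms(2,3)] candidates_def
  by (rule image_eqI[of _ _ "((p, q, b), y 0, y 1, y (k + 2), y (l + 2))"]) (use assms in auto)

definition dominance :: real where
  "dominance = (8 * (C + 1) / weight) * (16 * (C + 1) / weight)"

text \<open>
  Group \<open>j\<close> consists of one vector \<open>Y j 0\<close>, one vector \<open>Y j 1\<close> and \<open>N\<close> free vectors, whose chosen
  difference is \<open>d j\<close>.  In the groups with even index, the first two vectors are played by the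
  strategies for \<open>Q1\<close> and \<open>Q2\<close>.  The sequence \<open>d\<close> dominates the first vectors (\<open>dom1\<close>) and is dominated
  by the second ones (\<open>dom2\<close>).
\<close>

lemma comparison:
  assumes n: "n \<ge> 1" and Q1: "forces B n Q1 []" and Q2: "forces B n Q2 []"
  shows "\<exists>xs ys. Q1 xs \<and> Q2 ys \<and> length xs = n \<and> length ys = n \<and>
    (\<forall>c. norm (\<Sum>i<n. c i *\<^sub>R xs ! i) \<le> dominance * norm (\<Sum>i<n. c i *\<^sub>R ys ! i))"
proof -
  have wt: "0 < weight" "weight \<le> 1 / 64" using C by (auto simp: weight_def field_simps)
  define L where "L = 2 * n"
  have L: "L \<ge> 1" using n by (simp add: L_def)
  show ?thesis
  proof (rule suppressing_differences[where 'a='a and L=L and F="L * 2"])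
    fix N :: nat
    assume N:
      "\<And>f v. (\<And>i. norm (f i :: 'a) \<le> 1) \<Longrightarrow> (\<And>j k. norm (v j k) \<le> 1) \<Longrightarrow>
        (\<And>k l a b. \<forall>j<L. k j < l j \<and> l j < N \<Longrightarrow>
           (\<forall>i<L * 2. \<bar>a i\<bar> \<le> 4 * norm (diff_comb (L * 2) L f v k l a b)) \<and>
           (\<forall>j<L. \<bar>b j\<bar> \<le> 4 * norm (diff_comb (L * 2) L f v k l a b))) \<Longrightarrow>
        \<exists>k l. (\<forall>j<L. k j < l j \<and> l j < N) \<and>
          (\<forall>A a b. norm (diff_comb (L * 2) L f v k l a (\<lambda>j. if j \<in> A then b j else 0))
              \<le> 2 * norm (diff_comb (L * 2) L f v k l a b))"
    define W where "W = N + 2"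
    have W: "0 < W" by (simp add: W_def)
    obtain \<sigma> where \<sigma>: "S_winning_strategy B L (asymptotic_spaces B L) 1 \<sigma>"
      "\<And>x. S_outcome L \<sigma> x \<Longrightarrow> permissibly_complemented us C L x"
      using complemented L unfolding permissible_far_enough_def by (meson zero_less_one)
    \<comment> \<open>Small against the at most \<open>L\<^sup>2\<close> error terms of size \<open>32 C \<eta>\<close> in \<open>twisted_projection\<close>.\<close>
    define \<eta> where "\<eta> = 1 / (100 * C * real L * real L)"
    have \<eta>: "0 < \<eta>" "\<eta> * (100 * C * real L * real L) \<le> 1" using C L by (auto simp: \<eta>_def)
    have game: "forces B (L * W)
        (\<lambda>ys. Q1 (map (\<lambda>i. ys ! (2 * i * W)) [0..<n]) \<and> Q2 (map (\<lambda>i. ys ! (2 * i * W + 1)) [0..<n])) []"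
    proof (rule forces_interleave[OF Q1 Q2 unit_vectors])
      have le: "2 * i * W + 1 < 2 * j * W" if "i < j" for i j
      proof -
        have "(2 * i + 1) * W \<le> (2 * j - 1) * W" using that by (intro mult_right_mono) auto
        then have "2 * i * W + W + W \<le> 2 * j * W"
          using that by (cases j) (auto simp: algebra_simps)
        then show ?thesis using W_def by linarith
      qed
      show "2 * i * W < 2 * j * W" "2 * i * W + 1 < 2 * j * W + 1" if "i < j" for i j
        using le[OF that] by linarith+
      show "2 * i * W < L * W" "2 * i * W + 1 < L * W" if "i < n" for i
        using le[OF that] unfolding L_def by linarith+
      show "(\<lambda>i. 2 * i * W) ` {..<n} \<inter> (\<lambda>i. 2 * i * W + 1) ` {..<n} = {}"
      proof -
        have "2 * i * W \<noteq> 2 * j * W + 1" for i j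
          using le[of j i] le[of i j] by (cases i j rule: linorder_cases) auto
        then show ?thesis by blast
      qed
    qed
    obtain ys M where ys:
      "Q1 (map (\<lambda>i. ys ! (2 * i * W)) [0..<n]) \<and> Q2 (map (\<lambda>i. ys ! (2 * i * W + 1)) [0..<n])"
      and S: "spread_system L W M \<eta> (\<lambda>j r. ys ! (j * W + r))"
      and outcome: "\<And>\<zeta>. (\<And>j. j < L \<Longrightarrow> \<exists>r<W. \<zeta> j r \<noteq> 0) \<Longrightarrow>
        (\<And>j. j < L \<Longrightarrow> sgn (\<Sum>r<W. \<zeta> j r *\<^sub>R ys ! (j * W + r)) \<in> candidates ((\<lambda>r. ys ! (j * W + r)) ` {..<W})) \<Longrightarrow>
        S_outcome L \<sigma> (\<lambda>j. sgn (\<Sum>r<W. \<zeta> j r *\<^sub>R ys ! (j * W + r)))"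
    proof (rule spread_game[OF game \<eta>(1) W, where \<sigma>=\<sigma> and cand=candidates])
      show "\<sigma> xs \<in> B" for xs using \<sigma>(1) by (simp add: S_winning_strategy_def)
    qed (use finite_candidates candidates_mono in auto)
    define Y where "Y j r = ys ! (j * W + r)" for j r
    have S: "spread_system L W M \<eta> Y" using S by (simp add: Y_def[abs_def])
    have outcome: "S_outcome L \<sigma> (\<lambda>j. sgn (\<Sum>r<W. \<zeta> j r *\<^sub>R Y j r))"
      if "\<And>j. j < L \<Longrightarrow> \<exists>r<W. \<zeta> j r \<noteq> 0"
        "\<And>j. j < L \<Longrightarrow> sgn (\<Sum>r<W. \<zeta> j r *\<^sub>R Y j r) \<in> candidates (Y j ` {..<W})" for \<zeta>
      using outcome[of \<zeta>] that by (simp add: Y_def[abs_def])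
    have nY: "norm (Y j r) = 1" if "j < L" "r < W" for j r
      using S that by (simp add: spread_system_def)
    define f where "f i = (if i < L * 2 then Y (i div 2) (i mod 2) else 0)" for i
    define v where "v j k = (if j < L \<and> k < N then Y j (k + 2) else 0)" for j k
    have dc: "diff_comb (L * 2) L f v k l a b = (\<Sum>j<L. \<Sum>r<W. quad (a (2 * j)) (a (2 * j + 1)) (b j) (k j) (l j) r *\<^sub>R Y j r)"
      if kl: "\<forall>j<L. k j < l j \<and> l j < N" for k l a b
    proof -
      have "(\<Sum>i<L * 2. a i *\<^sub>R f i) = (\<Sum>j<L. a (2 * j) *\<^sub>R Y j 0 + a (2 * j + 1) *\<^sub>R Y j 1)"
        unfolding sum_groups
      proof (intro sum.cong refl)
        fix j assume "j \<in> {..<L}"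
        then have j: "j < L" by simp
        have "(\<Sum>r<2. a (j * 2 + r) *\<^sub>R f (j * 2 + r)) = a (j * 2) *\<^sub>R f (j * 2) + a (j * 2 + 1) *\<^sub>R f (j * 2 + 1)"
          by (simp add: numeral_2_eq_2)
        moreover have "f (j * 2) = Y j 0" using j by (simp add: f_def)
        moreover have "f (j * 2 + 1) = Y j 1"
        proof -
          have "(j * 2 + 1) div 2 = j" "(j * 2 + 1) mod 2 = 1" by presburger+
          then show ?thesis using j by (simp add: f_def)
        qed
        ultimately show "(\<Sum>r<2. a (j * 2 + r) *\<^sub>R f (j * 2 + r)) = a (2 * j) *\<^sub>R Y j 0 + a (2 * j + 1) *\<^sub>R Y j 1"
          by (simp add: mult.commute)
      qed
      moreover have "(\<Sum>j<L. b j *\<^sub>R (v j (k j) - v j (l j))) = (\<Sum>j<L. b j *\<^sub>R (Y j (k j + 2) - Y j (l j + 2)))"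
        using kl by (intro sum.cong) (auto simp: v_def)
      moreover have "(\<Sum>j<L. \<Sum>r<W. quad (a (2 * j)) (a (2 * j + 1)) (b j) (k j) (l j) r *\<^sub>R Y j r) =
        (\<Sum>j<L. a (2 * j) *\<^sub>R Y j 0 + a (2 * j + 1) *\<^sub>R Y j 1 + b j *\<^sub>R (Y j (k j + 2) - Y j (l j + 2)))"
        unfolding W_def using kl by (intro sum.cong refl sum_quad) auto
      ultimately show ?thesis by (simp add: diff_comb_def sum.distrib)
    qed
    have "\<exists>k l. (\<forall>j<L. k j < l j \<and> l j < N) \<and>
          (\<forall>A a b. norm (diff_comb (L * 2) L f v k l a (\<lambda>j. if j \<in> A then b j else 0))
              \<le> 2 * norm (diff_comb (L * 2) L f v k l a b))"
    proof (rule N)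
      show "norm (f i) \<le> 1" for i
        using nY[of "i div 2" "i mod 2"] W_def by (auto simp: f_def)
      show "norm (v j k) \<le> 1" for j k
        using nY[of j "k + 2"] W_def by (auto simp: v_def)
      fix k l a b assume kl: "\<forall>j<L. k j < l j \<and> l j < N"
      let ?\<Gamma> = "\<lambda>j. quad (a (2 * j)) (a (2 * j + 1)) (b j) (k j) (l j)"
      have co: "\<bar>?\<Gamma> j r\<bar> \<le> 4 * norm (diff_comb (L * 2) L f v k l a b)" if "j < L" "r < W" for j r
        unfolding dc[OF kl] by (rule spread_system_coeff[OF S that])
      show "(\<forall>i<L * 2. \<bar>a i\<bar> \<le> 4 * norm (diff_comb (L * 2) L f v k l a b)) \<and>
           (\<forall>j<L. \<bar>b j\<bar> \<le> 4 * norm (diff_comb (L * 2) L f v k l a b))"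
      proof (intro conjI allI impI)
        fix i assume i: "i < L * 2"
        then have j: "i div 2 < L" by simp
        show "\<bar>a i\<bar> \<le> 4 * norm (diff_comb (L * 2) L f v k l a b)"
        proof (cases "even i")
          case True
          then show ?thesis using co[OF j, of 0] W by (simp add: quad_def)
        next
          case False
          then have "2 * (i div 2) + 1 = i" by simp
          then show ?thesis using co[OF j, of 1] W_def by (simp add: quad_def)
        qed
      next
        fix j assume j: "j < L"
        then show "\<bar>b j\<bar> \<le> 4 * norm (diff_comb (L * 2) L f v k l a b)"
          using co[OF j, of "k j + 2"] kl W_def by (simp add: quad_def) (metis less_trans)
      qed
    qed
    then obtain k l where kl: "\<forall>j<L. k j < l j \<and> l j < N" and
      suppress: "\<And>A a b. norm (diff_comb (L * 2) L f v k l a (\<lambda>j. if j \<in> A then b j else 0))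
              \<le> 2 * norm (diff_comb (L * 2) L f v k l a b)" by blast
    define d where "d j = Y j (k j + 2) - Y j (l j + 2)" for j
    define comb where "comb p q b = (\<Sum>j<L. p j *\<^sub>R Y j 0 + q j *\<^sub>R Y j 1 + b j *\<^sub>R d j)" for p q b :: "nat \<Rightarrow> real"
    have quadj: "(\<Sum>r<W. quad p q b (k j) (l j) r *\<^sub>R Y j r) = p *\<^sub>R Y j 0 + q *\<^sub>R Y j 1 + b *\<^sub>R d j"
      if "j < L" for p q b j
      unfolding W_def d_def using kl that by (intro sum_quad) auto
    have suppress: "norm (comb p q (\<lambda>j. if j \<in> A then b j else 0)) \<le> 2 * norm (comb p q b)" for A p q b
    proof -
      have "diff_comb (L * 2) L f v k l (\<lambda>i. if even i then p (i div 2) else q (i div 2)) b = comb p q b" for b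
        unfolding dc[OF kl] comb_def
      proof (intro sum.cong refl)
        fix j assume "j \<in> {..<L}"
        then show "(\<Sum>r<W. quad (if even (2 * j) then p (2 * j div 2) else q (2 * j div 2))
               (if even (2 * j + 1) then p ((2 * j + 1) div 2) else q ((2 * j + 1) div 2)) (b j) (k j) (l j) r *\<^sub>R Y j r) =
           p j *\<^sub>R Y j 0 + q j *\<^sub>R Y j 1 + b j *\<^sub>R d j"
          using quadj[of j "p j" "q j" "b j"] by simp
      qed
      then show ?thesis using suppress[of "\<lambda>i. if even i then p (i div 2) else q (i div 2)" A b] by simp
    qed
    have multiplier: "norm (\<Sum>j<L. \<theta> j *\<^sub>R (b j *\<^sub>R d j)) \<le> 2 * norm (\<Sum>j<L. b j *\<^sub>R d j)"
      if \<theta>: "\<And>j. j < L \<Longrightarrow> 0 \<le> \<theta> j \<and> \<theta> j \<le> 1" for \<theta> b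
    proof -
      have "norm (0 + (\<Sum>j<L. \<theta> j *\<^sub>R (b j *\<^sub>R d j))) \<le> 2 * norm (\<Sum>j<L. b j *\<^sub>R d j)"
      proof (rule norm_add_scaled_sum_le)
        fix A assume A: "A \<subseteq> {..<L}"
        have "(\<Sum>j<L. (if j \<in> A then b j else 0) *\<^sub>R d j) = (\<Sum>j\<in>A. b j *\<^sub>R d j)"
          by (rule sum.mono_neutral_cong_right) (use A in auto)
        then show "norm (0 + (\<Sum>j\<in>A. b j *\<^sub>R d j)) \<le> 2 * norm (\<Sum>j<L. b j *\<^sub>R d j)"
          using suppress[of "\<lambda>_. 0" "\<lambda>_. 0" A b] by (simp add: comb_def)
      qed (rule \<theta>)
      then show ?thesis by simp
    qed
    have nd: "norm (d j) \<le> 2" if "j < L" for j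
      unfolding d_def
      by (rule norm_triangle_le_diff) (use nY[OF that, of "k j + 2"] nY[OF that, of "l j + 2"] kl that W_def in fastforce)
    have projection: "\<exists>a. (\<forall>j<L. even j \<longrightarrow> 1/2 \<le> a j \<and> a j \<le> 3/2) \<and>
        (\<forall>c. (\<forall>j<L. odd j \<longrightarrow> c j = 0) \<longrightarrow>
          (\<exists>b. norm (\<Sum>j<L. (if even j then c j * a j else b j) *\<^sub>R
              (if even j then p1 *\<^sub>R Y j 0 + q1 *\<^sub>R Y j 1 + b1 *\<^sub>R d j else d j))
            \<le> (C + 1) * norm (\<Sum>j<L. c j *\<^sub>R (q2 *\<^sub>R Y j 1 + b2 *\<^sub>R d j))))"
      if cases: "(p1, q1, b1, q2, b2) \<in> {(weight, 0, 1, 0, 1), (0, 1, weight, 1, 0)}" for p1 q1 b1 q2 b2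
    proof -
      define \<zeta> where "\<zeta> j = (if even j then quad p1 q1 b1 (k j) (l j) else quad 0 0 1 (k j) (l j))" for j
      define \<mu> where "\<mu> j = quad 0 q2 b2 (k j) (l j)" for j
      define sec where "sec j = (if q2 = 0 then Y j 0 else d j)" for j
      have Zj: "(\<Sum>r<W. \<zeta> j r *\<^sub>R Y j r) = (if even j then p1 *\<^sub>R Y j 0 + q1 *\<^sub>R Y j 1 + b1 *\<^sub>R d j else d j)"
        and mainj: "(\<Sum>r<W. \<mu> j r *\<^sub>R Y j r) = q2 *\<^sub>R Y j 1 + b2 *\<^sub>R d j" if "j < L" for j
        using quadj[OF that] by (simp_all add: \<zeta>_def \<mu>_def)
      have \<zeta>1: "\<exists>r<W. \<bar>\<zeta> j r\<bar> = 1" if j: "j < L" for j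
      proof (cases "even j \<and> b1 \<noteq> 1")
        case True
        then show ?thesis using cases W_def by (intro exI[of _ 1]) (auto simp: \<zeta>_def quad_def)
      next
        case False
        then show ?thesis using cases W_def kl j by (intro exI[of _ "k j + 2"]) (fastforce simp: \<zeta>_def quad_def)
      qed
      have \<mu>1: "\<exists>r<W. \<bar>\<mu> j r\<bar> = 1" if j: "j < L" for j
      proof (cases "q2 = 1")
        case True
        then show ?thesis using W_def by (intro exI[of _ 1]) (auto simp: \<mu>_def quad_def)
      next
        case False
        then show ?thesis using cases W_def kl j by (intro exI[of _ "k j + 2"]) (fastforce simp: \<mu>_def quad_def)
      qed
      have sums: "(\<Sum>r<W. \<bar>quad p q b (k j) (l j) r\<bar>) = \<bar>p\<bar> + \<bar>q\<bar> + 2 * \<bar>b\<bar>" if "j < L" for p q b j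
        unfolding W_def using kl that by (intro sum_abs_quad) auto
      have \<zeta>3: "(\<Sum>r<W. \<bar>\<zeta> j r\<bar>) \<le> 3" and \<mu>2: "(\<Sum>r<W. \<bar>\<mu> j r\<bar>) \<le> 2" if "j < L" for j
        using sums[OF that] cases wt by (auto simp: \<zeta>_def \<mu>_def)
      have "S_outcome L \<sigma> (\<lambda>j. sgn (\<Sum>r<W. \<zeta> j r *\<^sub>R Y j r))"
      proof (rule outcome)
        fix j assume j: "j < L"
        show "\<exists>r<W. \<zeta> j r \<noteq> 0" using \<zeta>1[OF j] by fastforce
        have kj: "k j < l j" "l j < N" using kl j by auto
        have "(p1, q1, b1) \<in> coeff_triples" "(0, 0, 1) \<in> coeff_triples" using cases by (auto simp: coeff_triples_def)
        then show "sgn (\<Sum>r<W. \<zeta> j r *\<^sub>R Y j r) \<in> candidates (Y j ` {..<W})"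
          using quad_candidate[OF _ kj] by (simp add: \<zeta>_def W_def)
      qed
      then obtain g P where P: "permissible_projection us L (\<lambda>j. sgn (\<Sum>r<W. \<zeta> j r *\<^sub>R Y j r)) g P" "norm P \<le> C"
        using \<sigma>(2) unfolding permissibly_complemented_def by blast
      have "\<exists>a. (\<forall>j<L. even j \<longrightarrow> 1/2 \<le> a j \<and> a j \<le> 3/2) \<and>
        (\<forall>c. (\<forall>j<L. odd j \<longrightarrow> c j = 0) \<longrightarrow>
          (\<exists>b. norm (\<Sum>j<L. (if even j then c j * a j else b j) *\<^sub>R (\<Sum>r<W. \<zeta> j r *\<^sub>R Y j r))
            \<le> (C + 1) * norm (\<Sum>j<L. c j *\<^sub>R (\<Sum>r<W. \<mu> j r *\<^sub>R Y j r))))"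
      proof (rule twisted_projection[OF S L C \<eta> \<zeta>1 \<zeta>3 \<mu>1 \<mu>2 _ _ P])
        show "norm (sec j) \<le> 2" if "j < L" for j
          using nd[OF that] nY[OF that W] by (simp add: sec_def)
        show "(\<Sum>r<W. \<zeta> j r *\<^sub>R Y j r) = (\<Sum>r<W. \<mu> j r *\<^sub>R Y j r) + (1 / (64 * C)) *\<^sub>R sec j"
          if "j < L" "even j" for j
          using that cases by (auto simp: Zj mainj sec_def weight_def)
      qed
      moreover have "(\<Sum>j<L. h j *\<^sub>R (\<Sum>r<W. \<zeta> j r *\<^sub>R Y j r)) =
          (\<Sum>j<L. h j *\<^sub>R (if even j then p1 *\<^sub>R Y j 0 + q1 *\<^sub>R Y j 1 + b1 *\<^sub>R d j else d j))" for h
        by (intro sum.cong) (auto simp: Zj)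
      moreover have "(\<Sum>j<L. c j *\<^sub>R (\<Sum>r<W. \<mu> j r *\<^sub>R Y j r)) = (\<Sum>j<L. c j *\<^sub>R (q2 *\<^sub>R Y j 1 + b2 *\<^sub>R d j))" for c
        by (intro sum.cong) (auto simp: mainj)
      ultimately show ?thesis by simp
    qed
    have dom1: "weight * norm (\<Sum>j<L. c j *\<^sub>R Y j 0) \<le> 8 * (C + 1) * norm (\<Sum>j<L. c j *\<^sub>R d j)"
      if c: "\<forall>j<L. odd j \<longrightarrow> c j = 0" for c
    proof -
      obtain a where a: "\<And>j. j < L \<Longrightarrow> even j \<Longrightarrow> 1/2 \<le> a j \<and> a j \<le> 3/2" and
        *: "\<And>c. \<forall>j<L. odd j \<longrightarrow> c j = 0 \<Longrightarrow>
          (\<exists>b. norm (\<Sum>j<L. (if even j then c j * a j else b j) *\<^sub>R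
              (if even j then weight *\<^sub>R Y j 0 + 0 *\<^sub>R Y j 1 + 1 *\<^sub>R d j else d j))
            \<le> (C + 1) * norm (\<Sum>j<L. c j *\<^sub>R (0 *\<^sub>R Y j 1 + 1 *\<^sub>R d j)))"
        using projection[of weight 0 1 0 1] by auto
      define c' where "c' j = c j / a j" for j
      have "\<forall>j<L. odd j \<longrightarrow> c' j = 0" using c by (simp add: c'_def)
      from *[OF this] obtain b where b: "norm (\<Sum>j<L. (if even j then c' j * a j else b j) *\<^sub>R
              (if even j then weight *\<^sub>R Y j 0 + d j else d j)) \<le> (C + 1) * norm (\<Sum>j<L. c' j *\<^sub>R d j)"
        by (auto cong: if_cong)
      have "(\<Sum>j<L. (if even j then c' j * a j else b j) *\<^sub>R (if even j then weight *\<^sub>R Y j 0 + d j else d j))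
          = comb (\<lambda>j. weight * c j) (\<lambda>_. 0) (\<lambda>j. if even j then c j else b j)"
        unfolding comb_def
      proof (intro sum.cong refl)
        fix j assume "j \<in> {..<L}"
        then have j: "j < L" by simp
        show "(if even j then c' j * a j else b j) *\<^sub>R (if even j then weight *\<^sub>R Y j 0 + d j else d j) =
          (weight * c j) *\<^sub>R Y j 0 + 0 *\<^sub>R Y j 1 + (if even j then c j else b j) *\<^sub>R d j"
        proof (cases "even j")
          case True
          then have "c' j * a j = c j" using a[OF j] by (auto simp: c'_def)
          then show ?thesis using True by (simp add: scaleR_add_right mult.commute)
        next
          case False
          then show ?thesis using c j by simp
        qed
      qed
      then have h1: "norm (comb (\<lambda>j. weight * c j) (\<lambda>_. 0) (\<lambda>j. if j \<in> {} then (if even j then c j else b j) else 0))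
          \<le> 2 * ((C + 1) * norm (\<Sum>j<L. c' j *\<^sub>R d j))"
        using b suppress[of "\<lambda>j. weight * c j" "\<lambda>_. 0" "{}" "\<lambda>j. if even j then c j else b j"] by simp
      have h2: "comb (\<lambda>j. weight * c j) (\<lambda>_. 0) (\<lambda>j. if j \<in> {} then (if even j then c j else b j) else 0)
          = weight *\<^sub>R (\<Sum>j<L. c j *\<^sub>R Y j 0)"
        by (simp add: comb_def scaleR_sum_right)
      have "norm (\<Sum>j<L. c' j *\<^sub>R d j) \<le> 4 * norm (\<Sum>j<L. c j *\<^sub>R d j)"
      proof -
        define \<theta> where "\<theta> j = (if even j then 1 / (2 * a j) else 0)" for j
        have "(\<Sum>j<L. c' j *\<^sub>R d j) = 2 *\<^sub>R (\<Sum>j<L. \<theta> j *\<^sub>R (c j *\<^sub>R d j))"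
          unfolding scaleR_sum_right using c by (intro sum.cong) (auto simp: c'_def \<theta>_def)
        moreover have "norm (\<Sum>j<L. \<theta> j *\<^sub>R (c j *\<^sub>R d j)) \<le> 2 * norm (\<Sum>j<L. c j *\<^sub>R d j)"
        proof (rule multiplier)
          fix j assume "j < L"
          then show "0 \<le> \<theta> j \<and> \<theta> j \<le> 1" using a[of j] by (auto simp: \<theta>_def field_simps)
        qed
        ultimately show ?thesis by simp
      qed
      note h3 = this
      have "weight * norm (\<Sum>j<L. c j *\<^sub>R Y j 0) \<le> 2 * ((C + 1) * norm (\<Sum>j<L. c' j *\<^sub>R d j))"
        using h1 wt unfolding h2 by simp
      also have "\<dots> \<le> 2 * ((C + 1) * (4 * norm (\<Sum>j<L. c j *\<^sub>R d j)))"
        using h3 C by (intro mult_left_mono) auto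
      also have "\<dots> = 8 * (C + 1) * norm (\<Sum>j<L. c j *\<^sub>R d j)" by simp
      finally show ?thesis .
    qed
    have dom2: "weight * norm (\<Sum>j<L. c j *\<^sub>R d j) \<le> 16 * (C + 1) * norm (\<Sum>j<L. c j *\<^sub>R Y j 1)"
      if c: "\<forall>j<L. odd j \<longrightarrow> c j = 0" for c
    proof -
      obtain a where a: "\<And>j. j < L \<Longrightarrow> even j \<Longrightarrow> 1/2 \<le> a j \<and> a j \<le> 3/2" and
        *: "\<And>c. \<forall>j<L. odd j \<longrightarrow> c j = 0 \<Longrightarrow>
          (\<exists>b. norm (\<Sum>j<L. (if even j then c j * a j else b j) *\<^sub>R
              (if even j then 0 *\<^sub>R Y j 0 + 1 *\<^sub>R Y j 1 + weight *\<^sub>R d j else d j))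
            \<le> (C + 1) * norm (\<Sum>j<L. c j *\<^sub>R (1 *\<^sub>R Y j 1 + 0 *\<^sub>R d j)))"
        using projection[of 0 1 weight 1 0] by auto
      define R where "R = (C + 1) * norm (\<Sum>j<L. c j *\<^sub>R Y j 1)"
      from *[OF c] obtain b where b: "norm (\<Sum>j<L. (if even j then c j * a j else b j) *\<^sub>R
              (if even j then Y j 1 + weight *\<^sub>R d j else d j)) \<le> R"
        by (auto simp: R_def cong: if_cong)
      define e where "e j = (if even j then weight * (c j * a j) else b j)" for j
      have "(\<Sum>j<L. (if even j then c j * a j else b j) *\<^sub>R (if even j then Y j 1 + weight *\<^sub>R d j else d j))
          = comb (\<lambda>_. 0) (\<lambda>j. c j * a j) e"
        unfolding comb_def using c
        by (intro sum.cong refl) (auto simp: e_def scaleR_add_right mult.commute)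
      then have R: "norm (comb (\<lambda>_. 0) (\<lambda>j. c j * a j) (\<lambda>j. if j \<in> A then e j else 0)) \<le> 2 * R" for A
        using b suppress[of "\<lambda>_. 0" "\<lambda>j. c j * a j" A e] by simp
      define T where "T A = comb (\<lambda>_. 0) (\<lambda>j. c j * a j) (\<lambda>j. if j \<in> A then e j else 0)" for A
      have "T (Collect even) - T {} = weight *\<^sub>R (\<Sum>j<L. (c j * a j) *\<^sub>R d j)"
        unfolding comb_def T_def sum_subtractf[symmetric] scaleR_sum_right
      proof (intro sum.cong refl)
        fix j assume "j \<in> {..<L}"
        then show "0 *\<^sub>R Y j 0 + (c j * a j) *\<^sub>R Y j 1 + (if j \<in> Collect even then e j else 0) *\<^sub>R d j -
           (0 *\<^sub>R Y j 0 + (c j * a j) *\<^sub>R Y j 1 + (if j \<in> {} then e j else 0) *\<^sub>R d j) =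
           weight *\<^sub>R (c j * a j) *\<^sub>R d j"
          using c by (cases "even j") (simp_all add: e_def)
      qed
      then have "norm (weight *\<^sub>R (\<Sum>j<L. (c j * a j) *\<^sub>R d j)) \<le> norm (T (Collect even)) + norm (T {})"
        using norm_triangle_ineq4[of "T (Collect even)" "T {}"] by simp
      also have "\<dots> \<le> 2 * R + 2 * R"
        unfolding T_def by (intro add_mono R)
      finally have "norm (weight *\<^sub>R (\<Sum>j<L. (c j * a j) *\<^sub>R d j)) \<le> 2 * R + 2 * R" .
      then have 1: "weight * norm (\<Sum>j<L. (c j * a j) *\<^sub>R d j) \<le> 4 * R" using wt by simp
      define \<theta> where "\<theta> j = (if even j then 1 / (2 * a j) else 0)" for j
      have "(\<Sum>j<L. c j *\<^sub>R d j) = 2 *\<^sub>R (\<Sum>j<L. \<theta> j *\<^sub>R ((c j * a j) *\<^sub>R d j))"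
        unfolding scaleR_sum_right
      proof (intro sum.cong refl)
        fix j assume "j \<in> {..<L}"
        then show "c j *\<^sub>R d j = 2 *\<^sub>R \<theta> j *\<^sub>R (c j * a j) *\<^sub>R d j"
          using a[of j] c by (auto simp: \<theta>_def)
      qed
      moreover have "norm (\<Sum>j<L. \<theta> j *\<^sub>R ((c j * a j) *\<^sub>R d j)) \<le> 2 * norm (\<Sum>j<L. (c j * a j) *\<^sub>R d j)"
      proof (rule multiplier)
        fix j assume "j < L"
        then show "0 \<le> \<theta> j \<and> \<theta> j \<le> 1" using a[of j] by (auto simp: \<theta>_def field_simps)
      qed
      ultimately have "norm (\<Sum>j<L. c j *\<^sub>R d j) \<le> 4 * norm (\<Sum>j<L. (c j * a j) *\<^sub>R d j)" by simp
      then have "weight * norm (\<Sum>j<L. c j *\<^sub>R d j) \<le> weight * (4 * norm (\<Sum>j<L. (c j * a j) *\<^sub>R d j))"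
        using wt by (intro mult_left_mono) auto
      then show ?thesis using 1 by (simp add: R_def algebra_simps)
    qed
    define us' where "us' = map (\<lambda>i. ys ! (2 * i * W)) [0..<n]"
    define ws where "ws = map (\<lambda>i. ys ! (2 * i * W + 1)) [0..<n]"
    have "norm (\<Sum>i<n. c i *\<^sub>R us' ! i) \<le> dominance * norm (\<Sum>i<n. c i *\<^sub>R ws ! i)" for c
    proof -
      define c' where "c' j = (if even j then c (j div 2) else 0)" for j
      have c': "\<forall>j<L. odd j \<longrightarrow> c' j = 0" by (simp add: c'_def)
      have ev: "(\<Sum>j<L. c' j *\<^sub>R h j) = (\<Sum>i<n. c i *\<^sub>R h (2 * i))" for h :: "nat \<Rightarrow> 'a"
      proof -
        have "(\<Sum>j<n * 2. c' j *\<^sub>R h j) = (\<Sum>i<n. c i *\<^sub>R h (2 * i))"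
          unfolding sum_groups
        proof (intro sum.cong refl)
          fix i assume "i \<in> {..<n}"
          have "(\<Sum>r<2. c' (i * 2 + r) *\<^sub>R h (i * 2 + r)) =
              c' (i * 2) *\<^sub>R h (i * 2) + c' (i * 2 + 1) *\<^sub>R h (i * 2 + 1)"
            by (simp add: numeral_2_eq_2)
          then show "(\<Sum>r<2. c' (i * 2 + r) *\<^sub>R h (i * 2 + r)) = c i *\<^sub>R h (2 * i)"
            by (simp add: c'_def mult.commute)
        qed
        then show ?thesis by (simp add: L_def mult.commute)
      qed
      have u: "(\<Sum>i<n. c i *\<^sub>R us' ! i) = (\<Sum>j<L. c' j *\<^sub>R Y j 0)"
        unfolding ev by (simp add: us'_def Y_def)
      have w: "(\<Sum>i<n. c i *\<^sub>R ws ! i) = (\<Sum>j<L. c' j *\<^sub>R Y j 1)"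
        unfolding ev by (simp add: ws_def Y_def)
      have "norm (\<Sum>j<L. c' j *\<^sub>R Y j 0) \<le> 8 * (C + 1) / weight * norm (\<Sum>j<L. c' j *\<^sub>R d j)"
        using dom1[OF c'] wt by (simp add: pos_le_divide_eq mult.commute)
      also have "\<dots> \<le> 8 * (C + 1) / weight * (16 * (C + 1) / weight * norm (\<Sum>j<L. c' j *\<^sub>R Y j 1))"
        using dom2[OF c'] wt C by (intro mult_left_mono) (simp_all add: pos_le_divide_eq mult.commute)
      finally show ?thesis unfolding u w dominance_def by (simp add: mult.assoc)
    qed
    then show ?thesis using ys by (intro exI[of _ us'] exI[of _ ws]) (auto simp: us'_def ws_def)
  qed
qed

end

section \<open>From block homogeneity to power type\<close>

text \<open>
  Stability of the additive Cauchy equation: \<open>\<theta>\<close> is the supremum of the quotients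
  \<open>(\<psi> k - \<kappa>) / k\<close>, which are all bounded by all the quotients \<open>(\<psi> m + \<kappa>) / m\<close>, as one sees by
  expanding \<open>\<psi> (m k)\<close> in two ways.
\<close>

lemma approximately_additive:
  fixes \<psi> :: "nat \<Rightarrow> real"
  assumes add: "\<And>k l. \<bar>\<psi> (k + l) - \<psi> k - \<psi> l\<bar> \<le> \<kappa>"
  obtains \<theta> where "\<And>k. \<bar>\<psi> k - real k * \<theta>\<bar> \<le> \<kappa>"
proof -
  have mult: "\<bar>\<psi> (Suc m * k) - real (Suc m) * \<psi> k\<bar> \<le> real m * \<kappa>" for m k
  proof (induction m)
    case (Suc m)
    have "\<psi> (Suc (Suc m) * k) = \<psi> (Suc m * k + k)" by (simp add: add.commute)
    then have "\<bar>\<psi> (Suc (Suc m) * k) - \<psi> (Suc m * k) - \<psi> k\<bar> \<le> \<kappa>" using add[of "Suc m * k" k] by simp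
    then show ?case using Suc by (simp add: algebra_simps abs_le_iff)
  qed simp
  have cross: "(\<psi> k - \<kappa>) / real k \<le> (\<psi> m + \<kappa>) / real m" if km: "k \<ge> 1" "m \<ge> 1" for k m
  proof -
    have 1: "real m * \<psi> k - (real m - 1) * \<kappa> \<le> \<psi> (m * k)"
      using mult[of "m - 1" k] km by (simp add: of_nat_diff abs_le_iff)
    have 2: "\<psi> (k * m) \<le> real k * \<psi> m + (real k - 1) * \<kappa>"
      using mult[of "k - 1" m] km by (simp add: of_nat_diff abs_le_iff)
    have "\<kappa> \<ge> 0" using add[of 0 0] by linarith
    then have "real m * (\<psi> k - \<kappa>) \<le> real k * (\<psi> m + \<kappa>)"
      using 1 2 by (simp add: algebra_simps)
    then show ?thesis using km by (simp add: field_simps)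
  qed
  define A where "A = {(\<psi> k - \<kappa>) / real k | k. k \<ge> 1}"
  define \<theta> where "\<theta> = Sup A"
  have bdd: "bdd_above A" unfolding A_def bdd_above_def using cross[of _ 1] by auto
  have "\<bar>\<psi> k - real k * \<theta>\<bar> \<le> \<kappa>" for k
  proof (cases "k = 0")
    case True
    then show ?thesis using add[of 0 0] by simp
  next
    case False
    then have k: "k \<ge> 1" by simp
    have "(\<psi> k - \<kappa>) / real k \<le> \<theta>"
      unfolding \<theta>_def by (rule cSup_upper[OF _ bdd]) (use k in \<open>auto simp: A_def\<close>)
    moreover have "\<theta> \<le> (\<psi> k + \<kappa>) / real k"
      unfolding \<theta>_def
    proof (rule cSup_least)
      show "A \<noteq> {}" by (auto simp: A_def)
    qed (use cross k in \<open>auto simp: A_def\<close>)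
    ultimately have "\<psi> k - \<kappa> \<le> real k * \<theta>" "real k * \<theta> \<le> \<psi> k + \<kappa>"
      using k by (simp_all add: field_simps)
    then show ?thesis by (simp add: abs_le_iff)
  qed
  then show thesis using that by blast
qed

text \<open>
  A sequence of lattice-like norms in which, up to a constant, consecutive blocks of ones behave like
  unit vectors scaled by the norms of the blocks.
\<close>

locale block_homogeneous_norms =
  fixes N :: "nat \<Rightarrow> cnorm" and K :: real
  assumes K: "1 \<le> K"
    and cnorm: "n \<ge> 1 \<Longrightarrow> is_cnorm n (N n)"
    and unit: "n \<ge> 1 \<Longrightarrow> i < n \<Longrightarrow> N n (unit_coeff i) = 1"
    and coeff: "n \<ge> 1 \<Longrightarrow> i < n \<Longrightarrow> \<bar>a i\<bar> \<le> K * N n a"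
    and lattice: "n \<ge> 1 \<Longrightarrow> (\<And>i. i < n \<Longrightarrow> \<bar>a i\<bar> \<le> \<bar>b i\<bar>) \<Longrightarrow> N n a \<le> K * N n b"
    and blocks_le: "n \<ge> 1 \<Longrightarrow> (\<And>i. i < n \<Longrightarrow> k i \<ge> 1) \<Longrightarrow>
      N (\<Sum>i<n. k i) (\<lambda>_. 1) \<le> K * N n (\<lambda>i. N (k i) (\<lambda>_. 1))"
    and blocks_ge: "n \<ge> 1 \<Longrightarrow> (\<And>i. i < n \<Longrightarrow> k i \<ge> 1) \<Longrightarrow>
      N n (\<lambda>i. N (k i) (\<lambda>_. 1)) \<le> K * N (\<Sum>i<n. k i) (\<lambda>_. 1)"
begin

definition \<phi> :: "nat \<Rightarrow> real" where
  "\<phi> n = N n (\<lambda>_. 1)"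

lemma \<phi>_lower: "n \<ge> 1 \<Longrightarrow> 1 \<le> K * \<phi> n"
  using coeff[of n 0 "\<lambda>_. 1"] by (simp add: \<phi>_def)

lemma \<phi>_pos: "n \<ge> 1 \<Longrightarrow> 0 < \<phi> n"
  using \<phi>_lower[of n] K by (metis not_less_iff_gr_or_eq not_one_le_zero mult_nonneg_nonpos mult_zero_right order_less_imp_le order_trans zero_le_one)

lemma \<phi>_upper:
  assumes "n \<ge> 1"
  shows "\<phi> n \<le> real n"
  using cnorm_le_sum_coeffs[OF cnorm[OF assms], of "\<lambda>_. 1"] unit[OF assms] by (simp add: \<phi>_def)

lemma N_const:
  assumes "n \<ge> 1" "0 \<le> c"
  shows "N n (\<lambda>_. c) = c * \<phi> n"
  using cnorm_scale[OF cnorm[OF assms(1)], of c "\<lambda>_. 1"] assms(2) by (simp add: \<phi>_def)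

lemma lattice_scaled:
  assumes n: "n \<ge> 1" and c: "0 \<le> c" and le: "\<And>i. i < n \<Longrightarrow> \<bar>a i\<bar> \<le> c * \<bar>b i\<bar>"
  shows "N n a \<le> K * c * N n b"
proof -
  have "N n a \<le> K * N n (\<lambda>i. c * b i)"
    by (rule lattice[OF n]) (use le c in \<open>simp add: abs_mult\<close>)
  then show ?thesis using c by (simp add: cnorm_scale[OF cnorm[OF n]])
qed

lemma \<phi>_mono:
  assumes "1 \<le> n" "n \<le> m"
  shows "\<phi> n \<le> K ^ 3 * \<phi> m"
proof -
  define k where "k i = (if i = n - 1 then m - n + 1 else 1)" for i
  have "(\<Sum>i<n. k i) = m"
  proof -
    have "(\<Sum>i<n. k i) = (\<Sum>i<n - 1. k i) + k (n - 1)"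
      using assms(1) by (metis Suc_diff_1 less_le_trans sum.lessThan_Suc zero_less_one)
    also have "(\<Sum>i<n - 1. k i) = n - 1" by (simp add: k_def)
    finally show ?thesis using assms by (simp add: k_def)
  qed
  then have "N n (\<lambda>i. \<phi> (k i)) \<le> K * \<phi> m"
    using blocks_ge[OF assms(1), of k] by (simp add: \<phi>_def k_def)
  moreover have "\<phi> n \<le> K * K * N n (\<lambda>i. \<phi> (k i))"
    unfolding \<phi>_def[of n]
  proof (rule lattice_scaled[OF assms(1)])
    fix i
    have "1 \<le> k i" using assms by (simp add: k_def)
    then show "\<bar>1\<bar> \<le> K * \<bar>\<phi> (k i)\<bar>" using \<phi>_lower[of "k i"] \<phi>_pos[of "k i"] by simp
  qed (use K in simp)
  moreover have "K * K * N n (\<lambda>i. \<phi> (k i)) \<le> K * K * (K * \<phi> m)"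
    using calculation(1) K by (intro mult_left_mono) auto
  ultimately show ?thesis by (simp add: power3_eq_cube mult.assoc)
qed

text \<open>
  The logarithm of \<open>\<phi>\<close> along powers of \<open>2\<close> is approximately additive, and \<open>\<phi>\<close> is monotone up to a
  constant in between.  The exponent is at most \<open>1\<close> by the triangle inequality, and nonnegative
  because single coefficients are controlled.
\<close>

lemma \<phi>_power:
  obtains \<theta> D where "0 \<le> \<theta>" "\<theta> \<le> 1" "1 \<le> D"
    "\<And>n. n \<ge> 1 \<Longrightarrow> \<phi> n \<le> D * real n powr \<theta>" "\<And>n. n \<ge> 1 \<Longrightarrow> real n powr \<theta> \<le> D * \<phi> n"
proof -
  define \<psi> where "\<psi> k = log 2 (\<phi> (2 ^ k))" for k
  define \<kappa> where "\<kappa> = log 2 K"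
  have "\<bar>\<psi> (k + l) - \<psi> k - \<psi> l\<bar> \<le> \<kappa>" for k l
  proof -
    have p: "\<phi> (2 ^ k) > 0" "\<phi> (2 ^ l) > 0" "\<phi> (2 ^ (k + l)) > 0" by (simp_all add: \<phi>_pos)
    have N1: "N (2 ^ l) (\<lambda>i. N (2 ^ k) (\<lambda>_. 1)) = \<phi> (2 ^ k) * \<phi> (2 ^ l)"
      using N_const[of "2 ^ l" "\<phi> (2 ^ k)"] p by (simp add: \<phi>_def)
    have N2: "N (\<Sum>i<(2::nat) ^ l. (2::nat) ^ k) (\<lambda>_. 1) = \<phi> (2 ^ (k + l))"
      by (simp add: \<phi>_def power_add mult.commute)
    have "\<phi> (2 ^ (k + l)) \<le> K * (\<phi> (2 ^ k) * \<phi> (2 ^ l))"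
      using blocks_le[of "2 ^ l" "\<lambda>_. 2 ^ k"] unfolding N1 N2 by simp
    then have "\<psi> (k + l) \<le> log 2 (K * (\<phi> (2 ^ k) * \<phi> (2 ^ l)))"
      unfolding \<psi>_def using p by simp
    also have "\<dots> = \<kappa> + \<psi> k + \<psi> l" using p K by (simp add: \<psi>_def \<kappa>_def log_mult)
    finally have 1: "\<psi> (k + l) \<le> \<kappa> + \<psi> k + \<psi> l" .
    have "\<phi> (2 ^ k) * \<phi> (2 ^ l) \<le> K * \<phi> (2 ^ (k + l))"
      using blocks_ge[of "2 ^ l" "\<lambda>_. 2 ^ k"] unfolding N1 N2 by simp
    then have "log 2 (\<phi> (2 ^ k) * \<phi> (2 ^ l)) \<le> log 2 (K * \<phi> (2 ^ (k + l)))"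
      using p K by simp
    then have "\<psi> k + \<psi> l \<le> \<kappa> + \<psi> (k + l)" using p K by (simp add: \<psi>_def \<kappa>_def log_mult)
    then show ?thesis using 1 by (simp add: abs_le_iff)
  qed
  then obtain \<theta> where \<theta>: "\<And>k. \<bar>\<psi> k - real k * \<theta>\<bar> \<le> \<kappa>" using approximately_additive[of \<psi> \<kappa>] by blast
  have \<phi>\<psi>: "\<phi> (2 ^ k) = 2 powr \<psi> k" for k by (simp add: \<psi>_def \<phi>_pos)
  have K\<kappa>: "K = 2 powr \<kappa>" using K by (simp add: \<kappa>_def)
  have up: "\<phi> (2 ^ k) \<le> K * 2 powr (real k * \<theta>)" for k
    unfolding \<phi>\<psi> K\<kappa> powr_add[symmetric] using \<theta>[of k] by (intro powr_mono) (auto simp: abs_le_iff)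
  have low: "2 powr (real k * \<theta>) \<le> K * \<phi> (2 ^ k)" for k
    unfolding \<phi>\<psi> K\<kappa> powr_add[symmetric] using \<theta>[of k] by (intro powr_mono) (auto simp: abs_le_iff)
  have \<theta>1: "\<theta> \<le> 1"
  proof (rule ccontr)
    assume "\<not> \<theta> \<le> 1"
    then obtain k :: nat where "\<kappa> / (\<theta> - 1) < real k" using reals_Archimedean2 by blast
    then have "\<kappa> < real k * (\<theta> - 1)" using \<open>\<not> \<theta> \<le> 1\<close> by (simp add: field_simps)
    moreover have "\<psi> k \<le> real k"
    proof -
      have "\<psi> k \<le> log 2 (2 ^ k)" unfolding \<psi>_def
        using \<phi>_upper[of "2 ^ k"] \<phi>_pos[of "2 ^ k"] by (subst log_le_cancel_iff) auto
      then show ?thesis by simp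
    qed
    ultimately show False using \<theta>[of k] by (simp add: abs_le_iff algebra_simps)
  qed
  have \<theta>0: "0 \<le> \<theta>"
  proof (rule ccontr)
    assume "\<not> 0 \<le> \<theta>"
    then obtain k :: nat where "2 * \<kappa> / (- \<theta>) < real k" using reals_Archimedean2 by blast
    then have "2 * \<kappa> < real k * (- \<theta>)" using \<open>\<not> 0 \<le> \<theta>\<close> by (simp add: field_simps)
    moreover have "0 \<le> \<kappa> + \<psi> k"
    proof -
      have "log 2 1 \<le> log 2 (K * \<phi> (2 ^ k))"
        using \<phi>_lower[of "2 ^ k"] by (subst log_le_cancel_iff) auto
      also have "\<dots> = \<kappa> + \<psi> k" using K \<phi>_pos[of "2 ^ k"] by (simp add: \<kappa>_def \<psi>_def log_mult)
      finally show ?thesis by simp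
    qed
    ultimately show False using \<theta>[of k] by (simp add: abs_le_iff algebra_simps)
  qed
  define D where "D = 2 * K ^ 4"
  have "\<phi> n \<le> D * real n powr \<theta> \<and> real n powr \<theta> \<le> D * \<phi> n" if n: "n \<ge> 1" for n
  proof -
    obtain k where k: "2 ^ k \<le> n" "n < 2 ^ (k + 1)" using ex_power_ivl1[of 2 n] n by auto
    have k': "(2 :: real) ^ k \<le> real n" "real n \<le> 2 ^ (k + 1)"
      using k by (metis of_nat_le_iff of_nat_numeral of_nat_power, metis less_imp_le of_nat_le_iff of_nat_numeral of_nat_power)
    have pk: "2 powr (real j * \<theta>) = (2 ^ j) powr \<theta>" for j
      by (simp add: powr_powr[symmetric] powr_realpow)
    have step: "2 powr (real (k + 1) * \<theta>) \<le> 2 * 2 powr (real k * \<theta>)"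
    proof -
      have "2 powr (real (k + 1) * \<theta>) = 2 powr \<theta> * 2 powr (real k * \<theta>)"
        by (simp add: powr_add[symmetric] algebra_simps)
      also have "\<dots> \<le> 2 powr 1 * 2 powr (real k * \<theta>)" using \<theta>1 by (intro mult_right_mono powr_mono) auto
      finally show ?thesis by simp
    qed
    have a: "2 powr (real k * \<theta>) \<le> real n powr \<theta>"
      unfolding pk using k' \<theta>0 by (intro powr_mono2) auto
    have b: "real n powr \<theta> \<le> 2 powr (real (k + 1) * \<theta>)"
      unfolding pk using k' \<theta>0 by (intro powr_mono2) auto
    have "\<phi> n \<le> K ^ 3 * \<phi> (2 ^ (k + 1))" using k n by (intro \<phi>_mono) auto
    also have "\<dots> \<le> K ^ 3 * (K * (2 * real n powr \<theta>))"
    proof (intro mult_left_mono)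
      have "K * 2 powr (real (k + 1) * \<theta>) \<le> K * (2 * real n powr \<theta>)"
        using step a K by (intro mult_left_mono) auto
      then show "\<phi> (2 ^ (k + 1)) \<le> K * (2 * real n powr \<theta>)" using up[of "k + 1"] by linarith
    qed (use K in auto)
    finally have 1: "\<phi> n \<le> D * real n powr \<theta>" by (simp add: D_def power4_eq_xxxx power3_eq_cube mult_ac)
    have "real n powr \<theta> \<le> 2 * 2 powr (real k * \<theta>)" using b step by linarith
    also have "\<dots> \<le> 2 * (K * (K ^ 3 * \<phi> n))"
    proof (intro mult_left_mono)
      have "K * \<phi> (2 ^ k) \<le> K * (K ^ 3 * \<phi> n)"
        using k n K by (intro mult_left_mono \<phi>_mono) auto
      then show "2 powr (real k * \<theta>) \<le> K * (K ^ 3 * \<phi> n)" using low[of k] by linarith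
    qed auto
    finally show ?thesis using 1 by (simp add: D_def power4_eq_xxxx power3_eq_cube mult_ac)
  qed
  moreover have "1 \<le> D" using one_le_power[OF K, of 4] by (simp add: D_def)
  ultimately show thesis using that \<theta>0 \<theta>1 by blast
qed

lemma equivalent_to_l_infinity:
  assumes D: "0 \<le> D" "\<And>n. n \<ge> 1 \<Longrightarrow> \<phi> n \<le> D" and n: "n \<ge> 1"
  shows "N n a \<le> K * D * lp_cnorm \<infinity> n a" "lp_cnorm \<infinity> n a \<le> K * N n a"
proof -
  let ?m = "Max ((\<lambda>i. \<bar>a i\<bar>) ` {..<n})"
  have ne: "(\<lambda>i. \<bar>a i\<bar>) ` {..<n} \<noteq> {}"
  proof -
    have "0 \<in> {..<n}" using n by simp
    then show ?thesis by blast
  qed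
  have le: "\<bar>a i\<bar> \<le> ?m" if "i < n" for i using that by (intro Max_ge) auto
  have m0: "0 \<le> ?m" using le[of 0] n by linarith
  have "N n a \<le> K * N n (\<lambda>_. ?m)" by (rule lattice[OF n]) (use le m0 in auto)
  also have "\<dots> = K * (?m * \<phi> n)" using N_const[OF n m0] by simp
  also have "\<dots> \<le> K * (?m * D)" using K m0 D(2)[OF n] by (intro mult_left_mono) auto
  finally show "N n a \<le> K * D * lp_cnorm \<infinity> n a" by (simp add: lp_cnorm_def mult_ac)
  have "?m \<le> K * N n a" using ne coeff[OF n] by (subst Max_le_iff) auto
  then show "lp_cnorm \<infinity> n a \<le> K * N n a" by (simp add: lp_cnorm_def)
qed

text \<open>
  For a large scale \<open>T\<close>, let \<open>k T i\<close> be the least integer exceeding \<open>T \<bar>a i\<bar>\<^sup>1\<^sup>/\<^sup>\<theta>\<close>, which is at least \<open>1\<close>,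
  as the block condition demands.  Blocks of these lengths have total length \<open>s T \<approx> T \<Sigma> a\<close>, while their
  norms are about \<open>(k T i)\<^sup>\<theta> \<approx> T\<^sup>\<theta> \<bar>a i\<bar>\<close>.  The rounding errors disappear as \<open>T\<close> tends to infinity.
\<close>

lemma equivalent_to_power_sums:
  assumes \<theta>: "0 < \<theta>" and D: "1 \<le> D" "\<And>n. n \<ge> 1 \<Longrightarrow> \<phi> n \<le> D * real n powr \<theta>"
    "\<And>n. n \<ge> 1 \<Longrightarrow> real n powr \<theta> \<le> D * \<phi> n" and n: "n \<ge> 1"
  defines "\<Sigma> \<equiv> \<lambda>a. \<Sum>i<n. \<bar>a i\<bar> powr (1 / \<theta>)" and "G \<equiv> K * K * D * D"
  shows "N n a \<le> K * G * \<Sigma> a powr \<theta>" "\<Sigma> a powr \<theta> \<le> K * K * G * N n a"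
proof -
  have G0: "0 \<le> G" using K D by (simp add: G_def)
  have power: "(\<bar>x\<bar> powr (1 / \<theta>)) powr \<theta> = \<bar>x\<bar>" for x :: real using \<theta> by (simp add: powr_powr)
  have \<Sigma>0: "0 \<le> \<Sigma> a" by (simp add: \<Sigma>_def sum_nonneg)
  note cn = cnorm[OF n]
  define k where "k T i = nat \<lfloor>\<bar>a i\<bar> powr (1 / \<theta>) * T\<rfloor> + 1" for T :: real and i
  define s where "s T = (\<Sum>i<n. k T i)" for T
  define b where "b T i = (real (k T i) / T) powr \<theta>" for T i
  have k: "\<bar>a i\<bar> powr (1 / \<theta>) \<le> real (k T i) / T" "real (k T i) / T \<le> \<bar>a i\<bar> powr (1 / \<theta>) + 1 / T"
    if T: "T > 0" for T i
  proof -
    have "0 \<le> \<bar>a i\<bar> powr (1 / \<theta>) * T" using T by simp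
    then have "\<bar>a i\<bar> powr (1 / \<theta>) * T \<le> real (k T i)" "real (k T i) \<le> \<bar>a i\<bar> powr (1 / \<theta>) * T + 1"
      unfolding k_def by (simp_all add: of_nat_nat) linarith+
    then show "\<bar>a i\<bar> powr (1 / \<theta>) \<le> real (k T i) / T" "real (k T i) / T \<le> \<bar>a i\<bar> powr (1 / \<theta>) + 1 / T"
      using T by (simp_all add: field_simps)
  qed
  have s: "\<Sigma> a \<le> real (s T) / T" "real (s T) / T \<le> \<Sigma> a + real n / T" if T: "T > 0" for T
  proof -
    have e: "real (s T) / T = (\<Sum>i<n. real (k T i) / T)" by (simp add: s_def sum_divide_distrib)
    show "\<Sigma> a \<le> real (s T) / T" unfolding e \<Sigma>_def by (intro sum_mono k T)
    have "(\<Sum>i<n. real (k T i) / T) \<le> (\<Sum>i<n. \<bar>a i\<bar> powr (1 / \<theta>) + 1 / T)" by (intro sum_mono k T)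
    then show "real (s T) / T \<le> \<Sigma> a + real n / T" unfolding e \<Sigma>_def by (simp add: sum.distrib)
  qed
  have k1: "1 \<le> k T i" for T i by (simp add: k_def)
  have s1: "1 \<le> s T" for T
  proof -
    have "k T 0 \<le> s T" unfolding s_def using n by (intro member_le_sum) auto
    then show ?thesis using k1[of T 0] by linarith
  qed
  have ba: "\<bar>a i\<bar> \<le> b T i" if "T > 0" for T i
  proof -
    have "(\<bar>a i\<bar> powr (1 / \<theta>)) powr \<theta> \<le> b T i"
      unfolding b_def using k(1)[OF that] \<theta> by (intro powr_mono2) auto
    then show ?thesis by (simp only: power)
  qed
  have Nb: "N n (b T) \<le> G * (real (s T) / T) powr \<theta>" "(real (s T) / T) powr \<theta> \<le> G * N n (b T)" if T: "T > 0" for T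
  proof -
    define t where "t = (1 / T) powr \<theta>"
    have t0: "t > 0" using T by (simp add: t_def)
    have split: "(x / T) powr \<theta> = t * x powr \<theta>" if "x \<ge> 0" for x
      using that T by (simp add: t_def powr_mult[symmetric])
    have "N n (b T) = N n (\<lambda>i. t * real (k T i) powr \<theta>)" unfolding b_def by (simp add: split)
    also have "\<dots> = t * N n (\<lambda>i. real (k T i) powr \<theta>)" using t0 by (simp add: cnorm_scale[OF cn])
    finally have bt: "N n (b T) = t * N n (\<lambda>i. real (k T i) powr \<theta>)" .
    have st: "(real (s T) / T) powr \<theta> = t * real (s T) powr \<theta>" by (simp add: split)
    have 1: "N n (\<lambda>i. real (k T i) powr \<theta>) \<le> K * D * N n (\<lambda>i. \<phi> (k T i))"
      by (rule lattice_scaled[OF n]) (use D k1 \<phi>_pos in \<open>auto simp: less_imp_le\<close>)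
    have 2: "N n (\<lambda>i. \<phi> (k T i)) \<le> K * D * N n (\<lambda>i. real (k T i) powr \<theta>)"
      by (rule lattice_scaled[OF n]) (use D k1 \<phi>_pos in \<open>auto simp: less_imp_le\<close>)
    have 3: "N n (\<lambda>i. \<phi> (k T i)) \<le> K * \<phi> (s T)"
      using blocks_ge[OF n, of "k T"] k1 by (simp add: \<phi>_def s_def)
    have 4: "\<phi> (s T) \<le> K * N n (\<lambda>i. \<phi> (k T i))"
      using blocks_le[OF n, of "k T"] k1 by (simp add: \<phi>_def s_def)
    have KD: "0 \<le> K * D" using K D by simp
    note 1
    also have "K * D * N n (\<lambda>i. \<phi> (k T i)) \<le> K * D * (K * (D * real (s T) powr \<theta>))"
    proof (rule mult_left_mono[OF _ KD])
      have "K * \<phi> (s T) \<le> K * (D * real (s T) powr \<theta>)"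
        using D(2)[OF s1[of T]] K by (intro mult_left_mono) auto
      then show "N n (\<lambda>i. \<phi> (k T i)) \<le> K * (D * real (s T) powr \<theta>)" using 3 by linarith
    qed
    finally have "N n (\<lambda>i. real (k T i) powr \<theta>) \<le> K * D * (K * (D * real (s T) powr \<theta>))" .
    then show "N n (b T) \<le> G * (real (s T) / T) powr \<theta>"
      unfolding bt st G_def using t0 by (simp add: mult_ac)
    have "real (s T) powr \<theta> \<le> D * \<phi> (s T)" by (rule D(3)[OF s1])
    also have "\<dots> \<le> D * (K * (K * D * N n (\<lambda>i. real (k T i) powr \<theta>)))"
    proof (rule mult_left_mono)
      have "K * N n (\<lambda>i. \<phi> (k T i)) \<le> K * (K * D * N n (\<lambda>i. real (k T i) powr \<theta>))"
        using 2 K by (intro mult_left_mono) auto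
      then show "\<phi> (s T) \<le> K * (K * D * N n (\<lambda>i. real (k T i) powr \<theta>))" using 4 by linarith
    qed (use D in auto)
    finally have "real (s T) powr \<theta> \<le> D * (K * (K * D * N n (\<lambda>i. real (k T i) powr \<theta>)))" .
    then show "(real (s T) / T) powr \<theta> \<le> G * N n (b T)"
      unfolding bt st G_def using t0 by (simp add: mult_ac)
  qed
  define T where "T m = real (Suc m)" for m
  have T0: "T m > 0" for m by (simp add: T_def)
  have invT: "(\<lambda>m. c / T m) \<longlonglongrightarrow> 0" for c
    unfolding T_def using LIMSEQ_Suc[OF lim_const_over_n[of c]] by simp
  have up: "N n a \<le> K * G * (\<Sigma> a + real n / T m) powr \<theta>" for m
  proof -
    have "N n a \<le> K * N n (b (T m))"
      by (rule lattice[OF n]) (rule order_trans[OF ba[OF T0] abs_ge_self])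
    also have "\<dots> \<le> K * (G * (real (s (T m)) / T m) powr \<theta>)"
      using Nb(1)[OF T0[of m]] K by (intro mult_left_mono) auto
    also have "\<dots> \<le> K * (G * (\<Sigma> a + real n / T m) powr \<theta>)"
      using K G0 s(2)[OF T0[of m]] \<theta> T0[of m] by (intro mult_left_mono powr_mono2) auto
    finally show ?thesis by simp
  qed
  have "(\<lambda>m. (\<Sigma> a + real n / T m) powr \<theta>) \<longlonglongrightarrow> (\<Sigma> a + 0) powr \<theta>"
  proof (rule tendsto_powr'[OF tendsto_add[OF tendsto_const invT] tendsto_const])
    have "\<forall>m. 0 \<le> \<Sigma> a + real n / T m" using \<Sigma>0 T0 by (simp add: less_imp_le)
    then show "\<Sigma> a + 0 \<noteq> 0 \<or> 0 < \<theta> \<and> (\<forall>\<^sub>F x in sequentially. 0 \<le> \<Sigma> a + real n / T x)"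
      using \<theta> by simp
  qed
  then have "(\<lambda>m. K * G * (\<Sigma> a + real n / T m) powr \<theta>) \<longlonglongrightarrow> K * G * \<Sigma> a powr \<theta>"
    by (intro tendsto_mult tendsto_const) simp
  then show "N n a \<le> K * G * \<Sigma> a powr \<theta>"
    by (rule LIMSEQ_le_const) (use up in auto)
  define b' where "b' m i = (\<bar>a i\<bar> powr (1 / \<theta>) + 1 / T m) powr \<theta>" for m i
  have low: "\<Sigma> a powr \<theta> \<le> G * (K * (K * N n a + (\<Sum>i<n. \<bar>b' m i - \<bar>a i\<bar>\<bar>)))" for m
  proof -
    have "\<Sigma> a powr \<theta> \<le> (real (s (T m)) / T m) powr \<theta>"
      using s(1)[OF T0[of m]] \<theta> \<Sigma>0 by (intro powr_mono2) auto
    also have "\<dots> \<le> G * N n (b (T m))" by (rule Nb(2)[OF T0])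
    also have "\<dots> \<le> G * (K * N n (b' m))"
    proof (intro mult_left_mono lattice[OF n] G0)
      fix i
      have "b (T m) i \<le> b' m i" unfolding b_def b'_def
        using k(2)[OF T0[of m], of i] \<theta> T0[of m] by (intro powr_mono2) auto
      moreover have "0 \<le> b (T m) i" by (simp add: b_def)
      ultimately show "\<bar>b (T m) i\<bar> \<le> \<bar>b' m i\<bar>" by simp
    qed
    also have "N n (b' m) \<le> N n (\<lambda>i. \<bar>a i\<bar>) + N n (\<lambda>i. b' m i - \<bar>a i\<bar>)" by (rule cnorm_diff[OF cn])
    also have "N n (\<lambda>i. \<bar>a i\<bar>) \<le> K * N n a" by (rule lattice[OF n]) simp
    also have "N n (\<lambda>i. b' m i - \<bar>a i\<bar>) \<le> (\<Sum>i<n. \<bar>b' m i - \<bar>a i\<bar>\<bar>)"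
      using cnorm_le_sum_coeffs[OF cn, of "\<lambda>i. b' m i - \<bar>a i\<bar>"] unit[OF n] by simp
    finally show ?thesis using G0 K by (simp add: mult_left_mono)
  qed
  have bl: "(\<lambda>m. b' m i) \<longlonglongrightarrow> (\<bar>a i\<bar> powr (1 / \<theta>) + 0) powr \<theta>" for i
    unfolding b'_def
  proof (rule tendsto_powr'[OF tendsto_add[OF tendsto_const invT] tendsto_const])
    have "\<forall>m. 0 \<le> \<bar>a i\<bar> powr (1 / \<theta>) + 1 / T m" using T0 by (simp add: less_imp_le)
    then show "\<bar>a i\<bar> powr (1 / \<theta>) + 0 \<noteq> 0 \<or> 0 < \<theta> \<and> (\<forall>\<^sub>F x in sequentially. 0 \<le> \<bar>a i\<bar> powr (1 / \<theta>) + 1 / T x)"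
      using \<theta> by simp
  qed
  then have "(\<lambda>m. b' m i) \<longlonglongrightarrow> \<bar>a i\<bar>" for i using bl[of i] by (simp only: add_0_right power)
  then have "(\<lambda>m. G * (K * (K * N n a + (\<Sum>i<n. \<bar>b' m i - \<bar>a i\<bar>\<bar>))))
      \<longlonglongrightarrow> G * (K * (K * N n a + (\<Sum>i<n. \<bar>\<bar>a i\<bar> - \<bar>a i\<bar>\<bar>)))"
    by (intro tendsto_intros)
  then have "\<Sigma> a powr \<theta> \<le> G * (K * (K * N n a + (\<Sum>i<n. \<bar>\<bar>a i\<bar> - \<bar>a i\<bar>\<bar>)))"
    by (rule LIMSEQ_le_const) (use low in auto)
  then show "\<Sigma> a powr \<theta> \<le> K * K * G * N n a" by (simp add: mult_ac)
qed

theorem equivalent_to_lp: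
  obtains p :: ereal and D :: real where "1 \<le> p" "0 \<le> D"
    "\<And>n a. n \<ge> 1 \<Longrightarrow> N n a \<le> D * lp_cnorm p n a" "\<And>n a. n \<ge> 1 \<Longrightarrow> lp_cnorm p n a \<le> D * N n a"
proof -
  obtain \<theta> D where \<theta>: "0 \<le> \<theta>" "\<theta> \<le> 1" and D: "1 \<le> D"
    "\<And>n. n \<ge> 1 \<Longrightarrow> \<phi> n \<le> D * real n powr \<theta>" "\<And>n. n \<ge> 1 \<Longrightarrow> real n powr \<theta> \<le> D * \<phi> n"
    using \<phi>_power by metis
  show thesis
  proof (cases "\<theta> = 0")
    case True
    have D': "\<phi> n \<le> D" if "n \<ge> 1" for n using D(2)[OF that] True that by simp
    have D0: "0 \<le> D" using D(1) by simp
    show thesis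
    proof (rule that[of \<infinity> "K * D"])
      fix n :: nat and a :: "nat \<Rightarrow> real" assume n: "n \<ge> 1"
      show "N n a \<le> K * D * lp_cnorm \<infinity> n a" by (rule equivalent_to_l_infinity(1)[OF D0 D' n])
      have "lp_cnorm \<infinity> n a \<le> K * N n a" by (rule equivalent_to_l_infinity(2)[OF D0 D' n])
      also have "\<dots> \<le> K * D * N n a"
        using K D(1) cnorm_nonneg[OF cnorm[OF n], of a] by (intro mult_right_mono) auto
      finally show "lp_cnorm \<infinity> n a \<le> K * D * N n a" .
    qed (use K D in auto)
  next
    case False
    then have \<theta>0: "0 < \<theta>" using \<theta> by simp
    define G where "G = K * K * D * D"
    have lp: "lp_cnorm (ereal (1 / \<theta>)) n a = (\<Sum>i<n. \<bar>a i\<bar> powr (1 / \<theta>)) powr \<theta>" for n a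
      by (simp add: lp_cnorm_def)
    have G: "0 \<le> G" using K D by (simp add: G_def)
    show thesis
    proof (rule that[of "ereal (1 / \<theta>)" "K * K * G"])
      show "1 \<le> ereal (1 / \<theta>)" using \<theta> \<theta>0 by (simp add: one_ereal_def)
      show "0 \<le> K * K * G" using K G by simp
      fix n :: nat and a :: "nat \<Rightarrow> real" assume n: "n \<ge> 1"
      have "N n a \<le> K * G * lp_cnorm (ereal (1 / \<theta>)) n a"
        unfolding lp G_def by (rule equivalent_to_power_sums(1)[OF \<theta>0 D n])
      also have "\<dots> \<le> K * K * G * lp_cnorm (ereal (1 / \<theta>)) n a"
      proof (rule mult_right_mono)
        have "1 * (K * G) \<le> K * (K * G)" using K G by (intro mult_right_mono) auto
        then show "K * G \<le> K * K * G" by simp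
      qed (simp add: lp)
      finally show "N n a \<le> K * K * G * lp_cnorm (ereal (1 / \<theta>)) n a" .
      show "lp_cnorm (ereal (1 / \<theta>)) n a \<le> K * K * G * N n a"
        unfolding lp G_def by (rule equivalent_to_power_sums(2)[OF \<theta>0 D n])
    qed
  qed
qed

end

section \<open>Asymptotic spaces are uniformly close to an \<open>\<ell>\<^sub>p\<close> space\<close>

lemma forces_unit:
  assumes "forces B k Q xs" "\<forall>x\<in>set xs. norm x = 1"
  shows "forces B k (\<lambda>ys. Q ys \<and> (\<forall>y\<in>set ys. norm y = 1)) xs"
  using assms
proof (induction k arbitrary: xs)
  case 0
  then show ?case by simp
next
  case (Suc k)
  show ?case unfolding forces.simps
  proof
    fix Z assume "Z \<in> B"
    then obtain x where x: "x \<in> Z \<inter> sphere 0 1" "forces B k Q (xs @ [x])" using Suc.prems(1) by auto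
    have "\<forall>y\<in>set (xs @ [x]). norm y = 1" using x(1) Suc.prems(2) by auto
    from Suc.IH[OF x(2) this] x(1)
    show "\<exists>x\<in>Z \<inter> sphere 0 1. forces B k (\<lambda>ys. Q ys \<and> (\<forall>y\<in>set ys. norm y = 1)) (xs @ [x])" by blast
  qed
qed

lemma forces_True:
  assumes "\<And>Z. Z \<in> B \<Longrightarrow> Z \<inter> sphere 0 1 \<noteq> {}"
  shows "forces B k (\<lambda>_. True) xs"
proof (induction k arbitrary: xs)
  case (Suc k)
  show ?case unfolding forces.simps using assms Suc.IH by blast
qed simp

text \<open>
  A vector dominated coordinatewise by \<open>b\<close> is a convex combination of the sign changes of \<open>b\<close>; the
  coordinates are moved one at a time.
\<close>

lemma cnorm_le_of_signs:
  assumes N: "is_cnorm n N" and signs: "\<And>\<epsilon>. (\<And>i. \<epsilon> i = 1 \<or> \<epsilon> i = (-1 :: real)) \<Longrightarrow> N (\<lambda>i. \<epsilon> i * b i) \<le> M"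
    and ab: "\<And>i. i < n \<Longrightarrow> \<bar>a i\<bar> \<le> \<bar>b i\<bar>"
  shows "N a \<le> M"
proof -
  have "N (\<lambda>i. if i < k then a i else \<epsilon> i * b i) \<le> M"
    if "k \<le> n" "\<And>i. \<epsilon> i = 1 \<or> \<epsilon> i = (-1 :: real)" for k \<epsilon>
    using that
  proof (induction k arbitrary: \<epsilon>)
    case 0
    then show ?case using signs[of \<epsilon>] by simp
  next
    case (Suc k)
    define w where "w s i = (if i < k then a i else (\<epsilon>(k := s)) i * b i)" for s i
    have w: "N (w s) \<le> M" if "s = 1 \<or> s = -1" for s
      unfolding w_def by (rule Suc.IH) (use that Suc.prems in auto)
    define \<theta> where "\<theta> = (if b k = 0 then 1 else (1 + a k / b k) / 2)"
    have abk: "\<bar>a k\<bar> \<le> \<bar>b k\<bar>" using ab Suc.prems(1) by simp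
    have \<theta>: "0 \<le> \<theta>" "\<theta> \<le> 1"
    proof -
      define r where "r = a k / b k"
      have "\<bar>r\<bar> \<le> 1" using abk by (cases "b k = 0") (auto simp: r_def field_simps)
      then have "-1 \<le> r" "r \<le> 1" by linarith+
      then show "0 \<le> \<theta>" "\<theta> \<le> 1" unfolding \<theta>_def r_def[symmetric] by auto
    qed
    have ak: "a k = \<theta> * b k - (1 - \<theta>) * b k"
      using abk by (cases "b k = 0") (auto simp: \<theta>_def field_simps)
    have "(\<lambda>i. if i < Suc k then a i else \<epsilon> i * b i) = (\<lambda>i. \<theta> * w 1 i + (1 - \<theta>) * w (-1) i)"
    proof
      fix i
      consider "i < k" | "i = k" | "k < i" by linarith
      then show "(if i < Suc k then a i else \<epsilon> i * b i) = \<theta> * w 1 i + (1 - \<theta>) * w (-1) i"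
        by cases (auto simp: w_def ak algebra_simps)
    qed
    then have "N (\<lambda>i. if i < Suc k then a i else \<epsilon> i * b i) \<le> N (\<lambda>i. \<theta> * w 1 i) + N (\<lambda>i. (1 - \<theta>) * w (-1) i)"
      using cnorm_triangle[OF N] by simp
    also have "\<dots> = \<theta> * N (w 1) + (1 - \<theta>) * N (w (-1))"
      using cnorm_scale[OF N, of \<theta> "w 1"] cnorm_scale[OF N, of "1 - \<theta>" "w (-1)"] \<theta> by simp
    also have "\<dots> \<le> \<theta> * M + (1 - \<theta>) * M"
      using w \<theta> by (intro add_mono mult_left_mono) auto
    finally show ?case by (simp add: algebra_simps)
  qed
  from this[of n "\<lambda>_. 1"] have "N (\<lambda>i. if i < n then a i else 1 * b i) \<le> M" by simp
  moreover have "N (\<lambda>i. if i < n then a i else 1 * b i) = N a" by (rule cnorm_cong[OF N]) simp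
  ultimately show ?thesis by simp
qed

context complemented_family
begin

abbreviation asymp :: "nat \<Rightarrow> cnorm set" where
  "asymp n \<equiv> asymptotic_spaces B n"

lemma B_nonempty: "B \<noteq> {}"
  using tails by blast

text \<open>
  The strategy provided by the hypothesis is followed up to the end at least once, and the outcome is
  close to some asymptotic space.
\<close>

lemma asymp_nonempty:
  assumes n: "n \<ge> 1"
  shows "asymp n \<noteq> {}"
proof -
  obtain \<sigma> where \<sigma>: "S_winning_strategy B n (asymp n) 1 \<sigma>"
    using complemented n unfolding permissible_far_enough_def by (meson zero_less_one)
  have \<sigma>B: "\<sigma> xs \<in> B" for xs using \<sigma> by (simp add: S_winning_strategy_def)
  have "\<exists>x. S_outcome n \<sigma> x"
  proof (rule long_game[OF forces_True, where \<sigma>=\<sigma> and cand="\<lambda>Y. Y" and \<eta>=1 and T=n])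
    fix ys :: "'a list" and m :: "nat \<Rightarrow> nat"
    assume ys: "length ys = n" "\<And>t. t < n \<Longrightarrow> norm (ys ! t) = 1"
      and prefix: "\<And>a s t. s \<le> t \<Longrightarrow> t \<le> n \<Longrightarrow>
       norm (\<Sum>i<s. a i *\<^sub>R ys ! i) \<le> 2 * norm (\<Sum>i<t. a i *\<^sub>R ys ! i)"
      and in_\<sigma>: "\<And>t xs. t < n \<Longrightarrow> set xs \<subseteq> set (take t ys) \<Longrightarrow> length xs \<le> n \<Longrightarrow> ys ! t \<in> \<sigma> xs"
    have "S_outcome n \<sigma> ((!) ys)"
      unfolding S_outcome_def admissible_move_def
    proof (intro allI impI conjI)
      fix k assume k: "k < n"
      have "map ((!) ys) [0..<k] = take k ys" using k ys(1) by (intro nth_equalityI) auto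
      then have "ys ! k \<in> \<sigma> (map ((!) ys) [0..<k])" using in_\<sigma>[OF k, of "take k ys"] k ys(1) by simp
      then show "ys ! k \<in> \<sigma> (map ((!) ys) [0..<k]) \<inter> sphere 0 1" using ys(2)[OF k] by simp
      show "basic_seq_le 2 (Suc k) ((!) ys)"
      proof (rule prefix_bound_imp_basic_seq)
        fix d :: "nat \<Rightarrow> real" and m assume "m \<le> Suc k"
        then show "norm (\<Sum>j<m. d j *\<^sub>R ys ! j) \<le> 2 * norm (\<Sum>j<Suc k. d j *\<^sub>R ys ! j)"
          by (rule prefix) (use k in simp)
      qed (use ys(2) k in simp)
    qed
    then show ?thesis by blast
  qed (use \<sigma>B unit_vectors in auto)
  then show ?thesis using \<sigma> by (auto simp: S_winning_strategy_def)
qed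

lemma asymp_cnorm: "E \<in> asymp n \<Longrightarrow> is_cnorm n E"
  and asymp_unit: "E \<in> asymp n \<Longrightarrow> i < n \<Longrightarrow> E (unit_coeff i) = 1"
  by (auto simp: asymptotic_spaces_def M_space_def unit_coeff_def)

lemma asymp_forces:
  assumes "E \<in> asymp n" "n \<ge> 1"
  shows "forces B n (\<lambda>xs. two_equivalent n E ((!) xs) \<and> (\<forall>x\<in>set xs. norm x = 1)) []"
  using forces_unit[OF asymptotic_space_forces[OF assms]] by simp

lemma two_equivalentD:
  assumes "two_equivalent n E x"
  shows "E a \<le> 2 * norm (\<Sum>i<n. a i *\<^sub>R x i)" "norm (\<Sum>i<n. a i *\<^sub>R x i) \<le> 2 * E a"
  using assms by (auto simp: two_equivalent_def)

lemma dominance_ge_1: "1 \<le> dominance"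
proof -
  have w: "0 < weight" "weight \<le> 1" using C by (auto simp: weight_def field_simps)
  have "1 \<le> 8 * (C + 1) / weight" "1 \<le> 16 * (C + 1) / weight"
    using w C by (simp_all add: field_simps)
  then have "1 * 1 \<le> dominance" unfolding dominance_def by (intro mult_mono) auto
  then show ?thesis by simp
qed

lemma asymptotic_spaces_equivalent:
  assumes "E \<in> asymp n" "F \<in> asymp n" "n \<ge> 1"
  shows "E c \<le> 4 * dominance * F c"
proof -
  obtain xs ys :: "'a list" where xy: "two_equivalent n E ((!) xs)" "two_equivalent n F ((!) ys)"
    "\<And>c. norm (\<Sum>i<n. c i *\<^sub>R xs ! i) \<le> dominance * norm (\<Sum>i<n. c i *\<^sub>R ys ! i)"
    using comparison[OF assms(3) asymptotic_space_forces[OF assms(1,3)] asymptotic_space_forces[OF assms(2,3)]] by blast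
  have "E c \<le> 2 * norm (\<Sum>i<n. c i *\<^sub>R xs ! i)" by (rule two_equivalentD(1)[OF xy(1)])
  also have "\<dots> \<le> 2 * (dominance * (2 * F c))"
  proof (rule mult_left_mono)
    have "dominance * norm (\<Sum>i<n. c i *\<^sub>R ys ! i) \<le> dominance * (2 * F c)"
      using two_equivalentD(2)[OF xy(2), of c] dominance_ge_1 by (intro mult_left_mono) auto
    then show "norm (\<Sum>i<n. c i *\<^sub>R xs ! i) \<le> dominance * (2 * F c)" using xy(3)[of c] by linarith
  qed simp
  finally show ?thesis by simp
qed

definition block_coeff :: "(nat \<Rightarrow> nat) \<Rightarrow> nat \<Rightarrow> (nat \<Rightarrow> real) \<Rightarrow> (nat \<Rightarrow> real) \<Rightarrow> nat \<Rightarrow> real" where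
  "block_coeff s m c d i = (\<Sum>j<m. if s j \<le> i \<and> i < s (Suc j) then d j * c i else 0)"

lemma sum_block_coeff:
  fixes x :: "nat \<Rightarrow> 'b::real_vector"
  assumes "\<And>j. j < m \<Longrightarrow> s (Suc j) \<le> N"
  shows "(\<Sum>i<N. block_coeff s m c d i *\<^sub>R x i) = (\<Sum>j<m. d j *\<^sub>R (\<Sum>i\<in>{s j..<s (Suc j)}. c i *\<^sub>R x i))"
proof -
  have "(\<Sum>i<N. block_coeff s m c d i *\<^sub>R x i) =
      (\<Sum>j<m. \<Sum>i<N. (if s j \<le> i \<and> i < s (Suc j) then d j * c i else 0) *\<^sub>R x i)"
    unfolding block_coeff_def scaleR_sum_left by (rule sum.swap)
  also have "\<dots> = (\<Sum>j<m. d j *\<^sub>R (\<Sum>i\<in>{s j..<s (Suc j)}. c i *\<^sub>R x i))"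
  proof (intro sum.cong refl)
    fix j assume "j \<in> {..<m}"
    then have "s (Suc j) \<le> N" using assms by simp
    then show "(\<Sum>i<N. (if s j \<le> i \<and> i < s (Suc j) then d j * c i else 0) *\<^sub>R x i)
        = d j *\<^sub>R (\<Sum>i\<in>{s j..<s (Suc j)}. c i *\<^sub>R x i)"
      unfolding scaleR_sum_right by (intro sum.mono_neutral_cong_right) auto
  qed
  finally show ?thesis .
qed

text \<open>
  The vector player can force the normalized blocks of a copy of \<open>E\<close>, so these are compared with a copy
  of \<open>F\<close>.  The number \<open>\<tau> j\<close> is the norm of the \<open>j\<close>-th block in the copy of \<open>E\<close> that is obtained; it
  agrees with the norm \<open>\<beta> j\<close> in \<open>E\<close> only up to a factor \<open>2\<close>, except that blocks of length one have their
  exact norm.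
\<close>

lemma asymptotic_space_blocks:
  assumes E: "E \<in> asymp N" and F: "F \<in> asymp m" and m: "m \<ge> 1" and N: "N \<ge> 1"
    and s: "\<And>j. j < m \<Longrightarrow> s j < s (Suc j)" "\<And>j. j < m \<Longrightarrow> s (Suc j) \<le> N"
    and c: "\<And>i. c i \<noteq> 0"
  defines "\<beta> \<equiv> \<lambda>j. E (\<lambda>i. if s j \<le> i \<and> i < s (Suc j) then c i else 0)"
  shows "\<exists>\<tau>. (\<forall>j<m. \<beta> j \<le> 2 * \<tau> j \<and> \<tau> j \<le> 2 * \<beta> j \<and> (s (Suc j) = Suc (s j) \<longrightarrow> \<tau> j = \<bar>c (s j)\<bar>)) \<and>
           (\<forall>d. E (block_coeff s m c d) \<le> 4 * dominance * F (\<lambda>j. d j * \<tau> j))" (is ?upper)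
    and "\<exists>\<tau>. (\<forall>j<m. \<beta> j \<le> 2 * \<tau> j \<and> \<tau> j \<le> 2 * \<beta> j \<and> (s (Suc j) = Suc (s j) \<longrightarrow> \<tau> j = \<bar>c (s j)\<bar>)) \<and>
           (\<forall>d. F (\<lambda>j. d j * \<tau> j) \<le> 4 * dominance * E (block_coeff s m c d))" (is ?lower)
proof -
  define Q where "Q xs \<longleftrightarrow> two_equivalent N E ((!) xs) \<and> (\<forall>x\<in>set xs. norm x = 1)" for xs :: "'a list"
  define b where "b xs j = (\<Sum>i\<in>{s j..<s (Suc j)}. c i *\<^sub>R xs ! i)" for xs :: "'a list" and j
  note EN = asymp_cnorm[OF E]
  have single: "b xs j = (\<Sum>i<N. (if s j \<le> i \<and> i < s (Suc j) then c i else 0) *\<^sub>R xs ! i)" if "j < m" for xs j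
    unfolding b_def by (rule sum.mono_neutral_cong_left) (use s(2)[OF that] in auto)
  have \<beta>0: "\<beta> j \<noteq> 0" if j: "j < m" for j
    using s[OF j] c by (auto simp: \<beta>_def cnorm_eq_0_iff[OF EN] intro!: exI[of _ "s j"])
  have nb: "\<beta> j \<le> 2 * norm (b xs j) \<and> norm (b xs j) \<le> 2 * \<beta> j" if "Q xs" "j < m" for xs j
    using that two_equivalentD[of N E "(!) xs"] by (simp add: single Q_def \<beta>_def)
  have forced: "forces B m (\<lambda>ys. \<exists>xs. length xs = N \<and> Q xs \<and> (\<forall>j<m. ys ! j = sgn (b xs j))) []"
    unfolding b_def
  proof (rule forces_blocks)
    show "forces B N Q []" unfolding Q_def by (rule asymp_forces[OF E N])
    show "s j \<le> s (Suc j)" if "j < m" for j using s(1)[OF that] by simp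
    show "s m \<le> N" using s(2)[of "m - 1"] m by simp
    fix xs :: "'a list" and j assume "length xs = N" "Q xs" "j < m"
    then have "0 < \<beta> j" "\<beta> j \<le> 2 * norm (b xs j)"
      using nb[of xs j] \<beta>0[of j] cnorm_nonneg[OF EN] by (simp_all add: \<beta>_def order_less_le)
    then have "b xs j \<noteq> 0" by auto
    then show "(\<Sum>i\<in>{s j..<s (Suc j)}. c i *\<^sub>R xs ! i) \<noteq> 0" by (simp add: b_def)
  qed (use subspaces B_nonempty in auto)
  have \<tau>: "\<forall>j<m. \<beta> j \<le> 2 * norm (b xs j) \<and> norm (b xs j) \<le> 2 * \<beta> j \<and>
      (s (Suc j) = Suc (s j) \<longrightarrow> norm (b xs j) = \<bar>c (s j)\<bar>)" if "Q xs" "length xs = N" for xs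
  proof (intro allI impI conjI)
    fix j assume j: "j < m"
    show "\<beta> j \<le> 2 * norm (b xs j)" "norm (b xs j) \<le> 2 * \<beta> j" using nb[OF that(1) j] by auto
    assume e: "s (Suc j) = Suc (s j)"
    then have "{s j..<s (Suc j)} = {s j}" by auto
    moreover have "norm (xs ! s j) = 1" using that s(2)[OF j] e by (simp add: Q_def)
    ultimately show "norm (b xs j) = \<bar>c (s j)\<bar>" by (simp add: b_def)
  qed
  have yb: "(\<Sum>j<m. (d j * norm (b xs j)) *\<^sub>R ys ! j) = (\<Sum>i<N. block_coeff s m c d i *\<^sub>R xs ! i)"
    if "\<forall>j<m. ys ! j = sgn (b xs j)" "Q xs" for d xs ys
  proof -
    have "(d j * norm (b xs j)) *\<^sub>R ys ! j = d j *\<^sub>R b xs j" if "j < m" for j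
      using \<open>\<forall>j<m. ys ! j = sgn (b xs j)\<close> that by (cases "b xs j = 0") (simp_all add: sgn_div_norm)
    moreover have "(\<Sum>i<N. block_coeff s m c d i *\<^sub>R xs ! i) = (\<Sum>j<m. d j *\<^sub>R b xs j)"
      unfolding b_def by (rule sum_block_coeff) (rule s(2))
    ultimately show ?thesis by simp
  qed
  have dom0: "0 \<le> dominance" using dominance_ge_1 by simp
  show ?upper
  proof -
    obtain ys zs xs :: "'a list" where y: "length xs = N" "Q xs" "\<forall>j<m. ys ! j = sgn (b xs j)"
      and z: "two_equivalent m F ((!) zs)"
      and le: "\<And>d. norm (\<Sum>i<m. d i *\<^sub>R ys ! i) \<le> dominance * norm (\<Sum>i<m. d i *\<^sub>R zs ! i)"
      using comparison[OF m forced asymptotic_space_forces[OF F m]] by blast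
    have "E (block_coeff s m c d) \<le> 4 * dominance * F (\<lambda>j. d j * norm (b xs j))" for d
    proof -
      have "E (block_coeff s m c d) \<le> 2 * norm (\<Sum>i<N. block_coeff s m c d i *\<^sub>R xs ! i)"
        using two_equivalentD(1) y(2) by (auto simp: Q_def)
      also have "\<dots> = 2 * norm (\<Sum>j<m. (d j * norm (b xs j)) *\<^sub>R ys ! j)" by (simp add: yb[OF y(3,2)])
      also have "\<dots> \<le> 2 * (dominance * (2 * F (\<lambda>j. d j * norm (b xs j))))"
        using le[of "\<lambda>j. d j * norm (b xs j)"]
          mult_left_mono[OF two_equivalentD(2)[OF z, of "\<lambda>j. d j * norm (b xs j)"] dom0] by linarith
      finally show ?thesis by simp
    qed
    then show ?thesis using \<tau>[OF y(2,1)] by (intro exI[of _ "\<lambda>j. norm (b xs j)"]) auto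
  qed
  show ?lower
  proof -
    obtain ys zs xs :: "'a list" where y: "length xs = N" "Q xs" "\<forall>j<m. ys ! j = sgn (b xs j)"
      and z: "two_equivalent m F ((!) zs)"
      and le: "\<And>d. norm (\<Sum>i<m. d i *\<^sub>R zs ! i) \<le> dominance * norm (\<Sum>i<m. d i *\<^sub>R ys ! i)"
      using comparison[OF m asymptotic_space_forces[OF F m] forced] by blast
    have "F (\<lambda>j. d j * norm (b xs j)) \<le> 4 * dominance * E (block_coeff s m c d)" for d
    proof -
      have "norm (\<Sum>i<N. block_coeff s m c d i *\<^sub>R xs ! i) \<le> 2 * E (block_coeff s m c d)"
        using two_equivalentD(2) y(2) by (auto simp: Q_def)
      then have 1: "dominance * norm (\<Sum>i<N. block_coeff s m c d i *\<^sub>R xs ! i) \<le> dominance * (2 * E (block_coeff s m c d))"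
        using dom0 by (rule mult_left_mono)
      have "F (\<lambda>j. d j * norm (b xs j)) \<le> 2 * norm (\<Sum>j<m. (d j * norm (b xs j)) *\<^sub>R zs ! j)"
        by (rule two_equivalentD(1)[OF z])
      also have "\<dots> \<le> 2 * (dominance * norm (\<Sum>i<N. block_coeff s m c d i *\<^sub>R xs ! i))"
        using le[of "\<lambda>j. d j * norm (b xs j)"] by (simp add: yb[OF y(3,2)])
      finally show ?thesis using 1 by simp
    qed
    then show ?thesis using \<tau>[OF y(2,1)] by (intro exI[of _ "\<lambda>j. norm (b xs j)"]) auto
  qed
qed

text \<open>
  Blocks of length one with coefficients \<open>\<plusminus>1\<close> compare \<open>F\<close> with all its sign changes.
\<close>

lemma asymptotic_space_lattice:
  assumes F: "F \<in> asymp n" and n: "n \<ge> 1" and ab: "\<And>i. i < n \<Longrightarrow> \<bar>a i\<bar> \<le> \<bar>b i\<bar>"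
  shows "F a \<le> 4 * dominance * F b"
proof (rule cnorm_le_of_signs[OF asymp_cnorm[OF F] _ ab])
  fix \<epsilon> :: "nat \<Rightarrow> real" assume \<epsilon>: "\<And>i. \<epsilon> i = 1 \<or> \<epsilon> i = -1"
  have ne: "\<epsilon> i \<noteq> 0" "\<bar>\<epsilon> i\<bar> = 1" for i
    using \<epsilon>[of i] by auto
  obtain \<tau> where \<tau>: "\<forall>j<n. \<tau> j = 1" and
    *: "\<And>d. F (block_coeff (\<lambda>j. j) n \<epsilon> d) \<le> 4 * dominance * F (\<lambda>j. d j * \<tau> j)"
    using asymptotic_space_blocks(1)[OF F F n n, of "\<lambda>j. j" \<epsilon>] ne by auto
  have "F (\<lambda>i. \<epsilon> i * b i) = F (block_coeff (\<lambda>j. j) n \<epsilon> b)"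
  proof (rule cnorm_cong[OF asymp_cnorm[OF F]])
    fix i assume i: "i < n"
    have "block_coeff (\<lambda>j. j) n \<epsilon> b i = (\<Sum>j<n. if j = i then b i * \<epsilon> i else 0)"
      unfolding block_coeff_def by (intro sum.cong) auto
    then show "\<epsilon> i * b i = block_coeff (\<lambda>j. j) n \<epsilon> b i" using i by simp
  qed
  also have "\<dots> \<le> 4 * dominance * F (\<lambda>j. b j * \<tau> j)" by (rule *)
  also have "F (\<lambda>j. b j * \<tau> j) = F b"
    by (rule cnorm_cong[OF asymp_cnorm[OF F]]) (use \<tau> in simp)
  finally show "F (\<lambda>i. \<epsilon> i * b i) \<le> 4 * dominance * F b" .
qed

text \<open>
  An interval of the basis of \<open>E\<close>, seen as blocks of length one, is compared with an asymptotic space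
  of the dimension of the interval.
\<close>

lemma asymptotic_space_interval:
  assumes E: "E \<in> asymp N" and F: "F \<in> asymp k" and k: "k \<ge> 1" "s + k \<le> N"
  defines "\<beta> \<equiv> E (\<lambda>i. if s \<le> i \<and> i < s + k then 1 else 0)"
  shows "\<beta> \<le> 4 * dominance * F (\<lambda>_. 1)" "F (\<lambda>_. 1) \<le> 4 * dominance * \<beta>"
proof -
  have bc: "block_coeff (\<lambda>j. s + j) k (\<lambda>_. 1) (\<lambda>_. 1) = (\<lambda>i. if s \<le> i \<and> i < s + k then 1 else 0)"
  proof
    fix i
    have "block_coeff (\<lambda>j. s + j) k (\<lambda>_. 1) (\<lambda>_. 1) i = (\<Sum>j<k. if j = i - s \<and> s \<le> i then 1 else 0)"
      unfolding block_coeff_def by (intro sum.cong) auto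
    also have "\<dots> = (if s \<le> i \<and> i < s + k then 1 else 0)" by auto
    finally show "block_coeff (\<lambda>j. s + j) k (\<lambda>_. 1) (\<lambda>_. 1) i = (if s \<le> i \<and> i < s + k then 1 else 0)" .
  qed
  have N: "N \<ge> 1" using k by simp
  note blk = asymptotic_space_blocks[OF E F k(1) N, of "\<lambda>j. s + j" "\<lambda>_. 1"]
  have one: "F (\<lambda>j. 1 * \<tau> j) = F (\<lambda>_. 1)" if "\<forall>j<k. \<tau> j = 1" for \<tau>
    by (rule cnorm_cong[OF asymp_cnorm[OF F]]) (use that in simp)
  obtain \<tau> where t: "\<forall>j<k. \<tau> j = 1"
    and up: "\<And>d. E (block_coeff (\<lambda>j. s + j) k (\<lambda>_. 1) d) \<le> 4 * dominance * F (\<lambda>j. d j * \<tau> j)"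
    using blk(1) k by auto
  show "\<beta> \<le> 4 * dominance * F (\<lambda>_. 1)"
    using up[of "\<lambda>_. 1"] unfolding one[OF t] bc \<beta>_def .
  obtain \<tau> where t: "\<forall>j<k. \<tau> j = 1"
    and low: "\<And>d. F (\<lambda>j. d j * \<tau> j) \<le> 4 * dominance * E (block_coeff (\<lambda>j. s + j) k (\<lambda>_. 1) d)"
    using blk(2) k by auto
  show "F (\<lambda>_. 1) \<le> 4 * dominance * \<beta>"
    using low[of "\<lambda>_. 1"] unfolding one[OF t] bc \<beta>_def .
qed

text \<open>
  The blocks of ones in \<open>E\<close> have norms comparable to those of the vectors of ones in the \<open>G i\<close>, by
  \<open>asymptotic_space_interval\<close>; the lattice property of \<open>F\<close> allows one to exchange these norms.
\<close>

lemma asymptotic_space_partition: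
  assumes E: "E \<in> asymp (\<Sum>i<n. k i)" and F: "F \<in> asymp n" and n: "n \<ge> 1"
    and k: "\<And>i. i < n \<Longrightarrow> k i \<ge> 1" and G: "\<And>i. i < n \<Longrightarrow> G i \<in> asymp (k i)"
  defines "A \<equiv> 4 * dominance"
  shows "E (\<lambda>_. 1) \<le> 2 * A ^ 3 * F (\<lambda>i. G i (\<lambda>_. 1))" "F (\<lambda>i. G i (\<lambda>_. 1)) \<le> 2 * A ^ 3 * E (\<lambda>_. 1)"
proof -
  define s where "s j = (\<Sum>i<j. k i)" for j
  define N where "N = (\<Sum>i<n. k i)"
  have E: "E \<in> asymp N" using E by (simp add: N_def)
  have A: "1 \<le> A" using dominance_ge_1 by (simp add: A_def)
  have sSuc: "s (Suc j) = s j + k j" for j by (simp add: s_def)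
  have s_le: "s (Suc j) \<le> N" if "j < n" for j
    unfolding s_def N_def using that by (intro sum_mono2) auto
  have N: "N \<ge> 1" using s_le[of 0] k[of 0] n by (simp add: s_def)
  define \<beta> where "\<beta> j = E (\<lambda>i. if s j \<le> i \<and> i < s (Suc j) then 1 else 0)" for j
  have \<beta>: "\<beta> j \<le> A * G j (\<lambda>_. 1)" "G j (\<lambda>_. 1) \<le> A * \<beta> j" if j: "j < n" for j
    using asymptotic_space_interval[OF E G[OF j] k[OF j], of "s j"] s_le[OF j]
    unfolding \<beta>_def sSuc A_def by auto
  have \<beta>0: "0 \<le> \<beta> j" for j by (simp add: \<beta>_def cnorm_nonneg[OF asymp_cnorm[OF E]])
  have G0: "0 \<le> G j (\<lambda>_. 1)" if "j < n" for j using cnorm_nonneg[OF asymp_cnorm[OF G[OF that]]] .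
  have bc: "E (block_coeff s n (\<lambda>_. 1) (\<lambda>_. 1)) = E (\<lambda>_. 1)"
  proof (rule cnorm_cong[OF asymp_cnorm[OF E]])
    have "block_coeff s m (\<lambda>_. 1) (\<lambda>_. 1) i = (if i < s m then 1 else 0)" for m i
    proof (induction m)
      case (Suc m)
      have "block_coeff s (Suc m) (\<lambda>_. 1) (\<lambda>_. 1) i =
          block_coeff s m (\<lambda>_. 1) (\<lambda>_. 1) i + (if s m \<le> i \<and> i < s (Suc m) then 1 else 0)"
        by (simp add: block_coeff_def)
      then show ?case using Suc sSuc[of m] by auto
    qed (simp add: block_coeff_def s_def)
    then show "block_coeff s n (\<lambda>_. 1) (\<lambda>_. 1) i = 1" if "i < N" for i
      using that by (simp add: s_def N_def)
  qed
  have sl: "\<And>j. j < n \<Longrightarrow> s j < s (Suc j)" using k by (simp add: sSuc Suc_le_eq)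
  note blk = asymptotic_space_blocks[OF E F n N, of s "\<lambda>_. 1", OF sl s_le, folded \<beta>_def A_def]
  note lat = asymptotic_space_lattice[OF F n, folded A_def]
  have F0: "0 \<le> F a" for a by (rule cnorm_nonneg[OF asymp_cnorm[OF F]])
  have scale: "F (\<lambda>j. (2 * A) * a j) = 2 * A * F a" for a
    using cnorm_scale[OF asymp_cnorm[OF F], of "2 * A" a] A by simp
  obtain \<tau> where \<tau>: "\<And>j. j < n \<Longrightarrow> \<beta> j \<le> 2 * \<tau> j" "\<And>j. j < n \<Longrightarrow> \<tau> j \<le> 2 * \<beta> j" and
    up: "\<And>d. E (block_coeff s n (\<lambda>_. 1) d) \<le> A * F (\<lambda>j. d j * \<tau> j)"
    using blk(1) by auto
  have "F \<tau> \<le> A * F (\<lambda>j. (2 * A) * G j (\<lambda>_. 1))"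
  proof (rule lat)
    fix j assume j: "j < n"
    have "0 \<le> \<tau> j" "\<tau> j \<le> 2 * A * G j (\<lambda>_. 1)" using \<tau>[OF j] \<beta>[OF j] \<beta>0[of j] by linarith+
    then show "\<bar>\<tau> j\<bar> \<le> \<bar>(2 * A) * G j (\<lambda>_. 1)\<bar>" by simp
  qed
  then have "A * F \<tau> \<le> A * (A * (2 * A * F (\<lambda>j. G j (\<lambda>_. 1))))"
    using A unfolding scale by (intro mult_left_mono) auto
  then show "E (\<lambda>_. 1) \<le> 2 * A ^ 3 * F (\<lambda>i. G i (\<lambda>_. 1))"
    using up[of "\<lambda>_. 1"] by (simp add: bc power3_eq_cube mult_ac)
  obtain \<tau> where \<tau>: "\<And>j. j < n \<Longrightarrow> \<beta> j \<le> 2 * \<tau> j" "\<And>j. j < n \<Longrightarrow> \<tau> j \<le> 2 * \<beta> j" and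
    low: "\<And>d. F (\<lambda>j. d j * \<tau> j) \<le> A * E (block_coeff s n (\<lambda>_. 1) d)"
    using blk(2) by auto
  have "F (\<lambda>j. G j (\<lambda>_. 1)) \<le> A * F (\<lambda>j. (2 * A) * \<tau> j)"
  proof (rule lat)
    fix j assume j: "j < n"
    have "A * \<beta> j \<le> A * (2 * \<tau> j)" using \<tau>(1)[OF j] A by (intro mult_left_mono) auto
    then have "G j (\<lambda>_. 1) \<le> (2 * A) * \<tau> j" using \<beta>(2)[OF j] by simp
    then show "\<bar>G j (\<lambda>_. 1)\<bar> \<le> \<bar>(2 * A) * \<tau> j\<bar>" using G0[OF j] by simp
  qed
  also have "\<dots> \<le> A * (2 * A * (A * E (\<lambda>_. 1)))"
    using low[of "\<lambda>_. 1"] A unfolding scale by (intro mult_left_mono) (auto simp: bc)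
  finally show "F (\<lambda>i. G i (\<lambda>_. 1)) \<le> 2 * A ^ 3 * E (\<lambda>_. 1)" by (simp add: power3_eq_cube mult_ac)
qed

text \<open>
  Any choice of one asymptotic space in every dimension is block homogeneous, and every other
  asymptotic space is equivalent to the chosen one.
\<close>

theorem asymptotically_lp:
  "\<exists>p::ereal. 1 \<le> p \<and> asymptotic_lp B p"
proof -
  define A where "A = 4 * dominance"
  have A: "1 \<le> A" using dominance_ge_1 by (simp add: A_def)
  have "\<exists>E. n \<ge> 1 \<longrightarrow> E \<in> asymp n" for n using asymp_nonempty by blast
  then obtain E where E: "\<And>n. n \<ge> 1 \<Longrightarrow> E n \<in> asymp n" by metis
  define K where "K = 2 * A ^ 3"
  have K: "1 \<le> K" "A \<le> K"
  proof -
    have "A * 1 \<le> A * (A * A)" using A by (intro mult_left_mono) (auto intro: mult_ge1_I)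
    then show "A \<le> K" using A by (simp add: K_def power3_eq_cube)
    then show "1 \<le> K" using A by simp
  qed
  have lat: "E n a \<le> K * E n b" if "n \<ge> 1" "\<And>i. i < n \<Longrightarrow> \<bar>a i\<bar> \<le> \<bar>b i\<bar>" for n a b
  proof -
    have "E n a \<le> A * E n b" unfolding A_def by (rule asymptotic_space_lattice[OF E]) (use that in auto)
    also have "\<dots> \<le> K * E n b" using K cnorm_nonneg[OF asymp_cnorm[OF E[OF that(1)]]] by (intro mult_right_mono) auto
    finally show ?thesis .
  qed
  interpret block_homogeneous_norms E K
  proof
    show "1 \<le> K" by (rule K)
    fix n :: nat assume n: "n \<ge> 1"
    show "is_cnorm n (E n)" by (rule asymp_cnorm[OF E[OF n]])
    show "E n (unit_coeff i) = 1" if "i < n" for i using asymp_unit[OF E[OF n] that] .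
    show "\<bar>a i\<bar> \<le> K * E n a" if "i < n" for i a
    proof -
      have "\<bar>a i\<bar> = E n (\<lambda>j. a i * unit_coeff i j)"
        using cnorm_scale[OF asymp_cnorm[OF E[OF n]], of "a i" "unit_coeff i"] asymp_unit[OF E[OF n] that] by simp
      also have "\<dots> \<le> K * E n a" by (rule lat[OF n]) (auto simp: unit_coeff_def)
      finally show ?thesis .
    qed
    show "E n a \<le> K * E n b" if "\<And>i. i < n \<Longrightarrow> \<bar>a i\<bar> \<le> \<bar>b i\<bar>" for a b by (rule lat[OF n that])
    fix k :: "nat \<Rightarrow> nat" assume k: "\<And>i. i < n \<Longrightarrow> k i \<ge> 1"
    have "k 0 \<le> (\<Sum>i<n. k i)" using n by (intro member_le_sum) auto
    then have s: "(\<Sum>i<n. k i) \<ge> 1" using k[of 0] n by simp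
    note part = asymptotic_space_partition[OF E[OF s] E[OF n] n k E[OF k]]
    show "E (\<Sum>i<n. k i) (\<lambda>_. 1) \<le> K * E n (\<lambda>i. E (k i) (\<lambda>_. 1))"
      using part(1) by (simp add: K_def A_def)
    show "E n (\<lambda>i. E (k i) (\<lambda>_. 1)) \<le> K * E (\<Sum>i<n. k i) (\<lambda>_. 1)"
      using part(2) by (simp add: K_def A_def)
  qed
  obtain p :: ereal and D where p: "1 \<le> p" "0 \<le> D"
    "\<And>n a. n \<ge> 1 \<Longrightarrow> E n a \<le> D * lp_cnorm p n a" "\<And>n a. n \<ge> 1 \<Longrightarrow> lp_cnorm p n a \<le> D * E n a"
    using equivalent_to_lp by metis
  have "d_b F (lp_cnorm p n) \<le> (D * A) * (A * D)" if n: "n \<ge> 1" and F: "F \<in> asymp n" for n F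
  proof (rule d_b_le)
    fix a
    have 1: "E n a \<le> A * F a" "F a \<le> A * E n a"
      unfolding A_def by (rule asymptotic_spaces_equivalent[OF E[OF n] F n], rule asymptotic_spaces_equivalent[OF F E[OF n] n])
    show "lp_cnorm p n a \<le> D * A * F a"
      using p(4)[OF n, of a] mult_left_mono[OF 1(1) p(2)] by simp
    show "F a \<le> A * D * lp_cnorm p n a"
    proof -
      have "A * E n a \<le> A * (D * lp_cnorm p n a)" using p(3)[OF n, of a] A by (intro mult_left_mono) auto
      then show ?thesis using 1(2) by (simp add: mult.assoc)
    qed
    show "0 \<le> F a" by (rule cnorm_nonneg[OF asymp_cnorm[OF F]])
    show "0 \<le> lp_cnorm p n a"
    proof (cases "p = \<infinity>")
      case True
      have "\<bar>a 0\<bar> \<le> Max ((\<lambda>i. \<bar>a i\<bar>) ` {..<n})" using n by (intro Max_ge) auto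
      then show ?thesis using True by (simp add: lp_cnorm_def)
    qed (simp add: lp_cnorm_def)
  qed (use A p(2) in auto)
  then show ?thesis using p(1) unfolding asymptotic_lp_def by blast
qed

end

lemma permissible_far_enough_mono:
  assumes "permissible_far_enough B P" "\<And>n x. P n x \<Longrightarrow> P' n x"
  shows "permissible_far_enough B P'"
  using assms unfolding permissible_far_enough_def by meson

theorem theorem4:
  fixes u :: "nat \<Rightarrow> 'a::banach"
    and us :: "nat \<Rightarrow> 'a \<Rightarrow>\<^sub>L real"
    and B :: "'a set set"
  assumes infinite_dim: "\<And>F::'a set. finite F \<Longrightarrow> span F \<noteq> UNIV"
    and basis: "schauder_basis u"
    and biorth: "biorthogonal u us"
    and family: "B = finite_codim_subspaces \<or> B = tail_subspaces u"
    and standing: "almost_monotone_family B"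
    and complemented: "\<exists>C. permissible_far_enough B (permissibly_complemented us C)"
  shows "\<exists>p::ereal. 1 \<le> p \<and> asymptotic_lp B p"
proof -
  obtain C0 where C0: "permissible_far_enough B (permissibly_complemented us C0)"
    using complemented by blast
  define C where "C = max 1 C0"
  interpret biorthogonal_basis u us
    using basis biorth by unfold_locales
  interpret permissible_family u us B
    by (rule permissible_family_finite_codim_or_tails[OF infinite_dim family standing])
  interpret complemented_family u us B C
  proof
    show "1 \<le> C" by (simp add: C_def)
    show "permissible_far_enough B (permissibly_complemented us C)"
      by (rule permissible_far_enough_mono[OF C0]) (force simp: permissibly_complemented_def C_def)
  qed
  show ?thesis by (rule asymptotically_lp)
qed

end
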